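(* Let $n>3$, let $I\subset\mathbb{R}$ be an open interval, $\omega:I\to(0,+\infty)$ a differentiable function and $\epsilon\in\{-1,0,1\}$. Let $\Sigma$ be a connected $\Lambda$-Einstein hypersurface of $I\times_\omega\mathbb{Q}_\epsilon^n$ such that $(\beta\circ\xi)T$ vanishes (identically) on $\Sigma$. Then $\alpha\circ\xi$ is constant. Furthermore, defining $$\sigma:=\Lambda+(n-1)(\alpha\circ\xi),$$ the following assertions hold: (i) If $\sigma>0$, $\Sigma$ is trivial and totally umbilical (with constant umbilical function). (ii) If $\sigma=0$, $\Sigma$ is trivial and its shape operator has rank at most one. (iii) If $\sigma<0$, $\Sigma$ is nontrivial and has precisely two distinct nonzero constant principal curvatures with opposite signs, both with constant multiplicity $\ge 2$. In particular, $\Sigma$ has constant mean curvature.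
   Context: $\mathbb{Q}_\epsilon^n$ is the simply connected space form of dimension $n$ and constant sectional curvature $\epsilon\in\{-1,0,1\}$, with metric $ds_\epsilon^2$. The warped product $I\times_\omega\mathbb{Q}_\epsilon^n$ is $I\times\mathbb{Q}_\epsilon^n$ with the metric $dt^2+\omega(t)^2ds_\epsilon^2$ ("differentiable" means smooth). Associated functions on $I$: $$\alpha=\frac{(\omega')^2-\epsilon}{\omega^2},\qquad \beta=\frac{\omega''}{\omega}-\alpha .$$ For a hypersurface $\Sigma$ (with the induced metric), the height function $\xi$ is the restriction to $\Sigma$ of the projection $I\times\mathbb{Q}_\epsilon^n\to I$, and $T=\nabla\xi$ is its gradient on $\Sigma$. The shape operator with respect to a unit normal $N$ is $AX=-\overline\nabla_XN$, with $\overline\nabla$ the Levi-Civita connection of the warped product; principal curvatures are the eigenvalues of $A$. A Riemannian manifold $(M,g)$ is $\Lambda$-Einstein if $\mathrm{Ric}_M=\Lambda g$ with $\Lambda\in\mathbb{R}$ a constant. An Einstein manifold is called trivial if it has constant sectional curvature, and nontrivial otherwise. *)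

theory Defs
  imports "HOL-Analysis.Analysis"
begin

section \<open>Smooth maps on open subsets of normed spaces\<close>

primrec ck_on :: "'a::real_normed_vector set \<Rightarrow> ('a \<Rightarrow> 'b::real_normed_vector) \<Rightarrow> nat \<Rightarrow> bool" where
  "ck_on U f 0 \<longleftrightarrow> continuous_on U f"
| "ck_on U f (Suc k) \<longleftrightarrow> (\<forall>x\<in>U. f differentiable (at x))
      \<and> (\<forall>v. ck_on U (\<lambda>x. frechet_derivative f (at x) v) k)"

definition smooth_on :: "'a::real_normed_vector set \<Rightarrow> ('a \<Rightarrow> 'b::real_normed_vector) \<Rightarrow> bool" where
  "smooth_on U f \<longleftrightarrow> (\<forall>k. ck_on U f k)"


section \<open>Riemannian metrics on open subsets of a Euclidean space\<close>

text \<open>A metric is a function \<open>g\<close> with \<open>g x u v\<close> the inner product of \<open>u\<close>, \<open>v\<close> at the point \<open>x\<close>.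
  Tangent vectors are identified with elements of the model space, so a vector also stands for
  the parallel (constant coefficient) vector field it defines; such fields commute.\<close>

type_synonym 'e metric_tensor = "'e \<Rightarrow> 'e \<Rightarrow> 'e \<Rightarrow> real"

definition riemannian_metric_on :: "'e::euclidean_space set \<Rightarrow> 'e metric_tensor \<Rightarrow> bool" where
  "riemannian_metric_on U g \<longleftrightarrow>
     (\<forall>x\<in>U. bilinear (g x) \<and> (\<forall>u v. g x u v = g x v u) \<and> (\<forall>u. u \<noteq> 0 \<longrightarrow> g x u u > 0))
     \<and> (\<forall>u v. smooth_on U (\<lambda>x. g x u v))"

text \<open>Koszul's formula on constant coefficient fields: \<open>christoffel g x u v\<close> is the
  Levi-Civita derivative of the constant field \<open>v\<close> in the direction \<open>u\<close> at \<open>x\<close>.\<close>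

definition christoffel :: "'e::euclidean_space metric_tensor \<Rightarrow> 'e \<Rightarrow> 'e \<Rightarrow> 'e \<Rightarrow> 'e" where
  "christoffel g x u v = (THE z. \<forall>w. g x z w =
     (frechet_derivative (\<lambda>y. g y v w) (at x) u
      + frechet_derivative (\<lambda>y. g y u w) (at x) v
      - frechet_derivative (\<lambda>y. g y u v) (at x) w) / 2)"

text \<open>\<open>cov_along g F Y x u\<close> is the Levi-Civita derivative, in the direction \<open>u\<close> at \<open>x\<close>, of the
  vector field \<open>Y\<close> along the map \<open>F\<close>.\<close>

definition cov_along ::
  "'h::euclidean_space metric_tensor \<Rightarrow> ('m::real_normed_vector \<Rightarrow> 'h) \<Rightarrow> ('m \<Rightarrow> 'h) \<Rightarrow> 'm \<Rightarrow> 'm \<Rightarrow> 'h" where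
  "cov_along g F Y x u = frechet_derivative Y (at x) u
     + christoffel g (F x) (frechet_derivative F (at x) u) (Y x)"

text \<open>\<open>R(u,v)w = \<nabla>\<^sub>u\<nabla>\<^sub>vw - \<nabla>\<^sub>v\<nabla>\<^sub>uw\<close> for constant fields \<open>u\<close>, \<open>v\<close>, \<open>w\<close>.\<close>

definition curvature :: "'e::euclidean_space metric_tensor \<Rightarrow> 'e \<Rightarrow> 'e \<Rightarrow> 'e \<Rightarrow> 'e \<Rightarrow> 'e" where
  "curvature g x u v w =
       cov_along g (\<lambda>y. y) (\<lambda>y. christoffel g y v w) x u
     - cov_along g (\<lambda>y. y) (\<lambda>y. christoffel g y u w) x v"

definition linear_trace :: "('e::euclidean_space \<Rightarrow> 'e) \<Rightarrow> real" where
  "linear_trace A = (\<Sum>b\<in>Basis. A b \<bullet> b)"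

definition ricci :: "'e::euclidean_space metric_tensor \<Rightarrow> 'e \<Rightarrow> 'e \<Rightarrow> 'e \<Rightarrow> real" where
  "ricci g x v w = linear_trace (\<lambda>u. curvature g x u v w)"

definition sectional :: "'e::euclidean_space metric_tensor \<Rightarrow> 'e \<Rightarrow> 'e \<Rightarrow> 'e \<Rightarrow> real" where
  "sectional g x u v = g x (curvature g x u v v) u / (g x u u * g x v v - (g x u v)\<^sup>2)"

definition gradient :: "'e::euclidean_space metric_tensor \<Rightarrow> ('e \<Rightarrow> real) \<Rightarrow> 'e \<Rightarrow> 'e" where
  "gradient g h x = (THE z. \<forall>u. g x z u = frechet_derivative h (at x) u)"


section \<open>Riemannian manifolds\<close>

text \<open>A Riemannian manifold modelled on \<open>'e\<close> is given by an atlas whose charts carry the local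
  expression of the metric; its underlying set is the union of the chart domains. Its dimension
  is \<open>DIM('e)\<close>.\<close>

record ('a, 'e) rchart =
  cdom :: "'a set"
  cmap :: "'a \<Rightarrow> 'e"
  cmet :: "'e metric_tensor"

definition cimg :: "('a, 'e) rchart \<Rightarrow> 'e set" where
  "cimg c = cmap c ` cdom c"

definition cinv :: "('a, 'e) rchart \<Rightarrow> 'e \<Rightarrow> 'a" where
  "cinv c = inv_into (cdom c) (cmap c)"

definition local_rep ::
  "('a, 'e) rchart \<Rightarrow> ('b, 'h) rchart \<Rightarrow> ('a \<Rightarrow> 'b) \<Rightarrow> 'e \<Rightarrow> 'h" where
  "local_rep c d f = cmap d \<circ> f \<circ> cinv c"

definition transition :: "('a, 'e) rchart \<Rightarrow> ('a, 'e) rchart \<Rightarrow> 'e \<Rightarrow> 'e" where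
  "transition c d = local_rep c d (\<lambda>p. p)"

definition carrier :: "('a, 'e) rchart set \<Rightarrow> 'a set" where
  "carrier M = (\<Union>c\<in>M. cdom c)"

definition riemannian_manifold ::
  "('a::{t2_space, second_countable_topology}, 'e::euclidean_space) rchart set \<Rightarrow> bool" where
  "riemannian_manifold M \<longleftrightarrow> carrier M \<noteq> {}
     \<and> (\<forall>c\<in>M. open (cdom c) \<and> open (cimg c)
           \<and> homeomorphism (cdom c) (cimg c) (cmap c) (cinv c)
           \<and> riemannian_metric_on (cimg c) (cmet c))
     \<and> (\<forall>c\<in>M. \<forall>d\<in>M.
           smooth_on (cmap c ` (cdom c \<inter> cdom d)) (transition c d)
           \<and> (\<forall>x \<in> cmap c ` (cdom c \<inter> cdom d). \<forall>u v.
                cmet c x u v = cmet d (transition c d x)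
                  (frechet_derivative (transition c d) (at x) u)
                  (frechet_derivative (transition c d) (at x) v)))"

definition einstein :: "real \<Rightarrow> ('a, 'e::euclidean_space) rchart set \<Rightarrow> bool" where
  "einstein \<Lambda> M \<longleftrightarrow> (\<forall>c\<in>M. \<forall>x\<in>cimg c. \<forall>u v. ricci (cmet c) x u v = \<Lambda> * cmet c x u v)"

definition has_constant_curvature :: "real \<Rightarrow> ('a, 'e::euclidean_space) rchart set \<Rightarrow> bool" where
  "has_constant_curvature \<kappa> M \<longleftrightarrow> (\<forall>c\<in>M. \<forall>x\<in>cimg c. \<forall>u v.
     u \<noteq> v \<and> independent {u, v} \<longrightarrow> sectional (cmet c) x u v = \<kappa>)"

definition trivial_einstein :: "('a, 'e::euclidean_space) rchart set \<Rightarrow> bool" where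
  "trivial_einstein M \<longleftrightarrow> (\<exists>\<kappa>. has_constant_curvature \<kappa> M)"

definition entire_geodesic ::
  "('a::{t2_space, second_countable_topology}, 'e::euclidean_space) rchart set
     \<Rightarrow> (real \<Rightarrow> 'a) \<Rightarrow> bool" where
  "entire_geodesic M \<gamma> \<longleftrightarrow> continuous_on UNIV \<gamma> \<and> range \<gamma> \<subseteq> carrier M
     \<and> (\<forall>c\<in>M. smooth_on (\<gamma> -` cdom c) (cmap c \<circ> \<gamma>)
          \<and> (\<forall>t \<in> \<gamma> -` cdom c. cov_along (cmet c) (cmap c \<circ> \<gamma>)
                (\<lambda>s. frechet_derivative (cmap c \<circ> \<gamma>) (at s) 1) t 1 = 0))"

definition geodesically_complete ::
  "('a::{t2_space, second_countable_topology}, 'e::euclidean_space) rchart set \<Rightarrow> bool" where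
  "geodesically_complete M \<longleftrightarrow> (\<forall>c\<in>M. \<forall>p\<in>cdom c. \<forall>v. \<exists>\<gamma>.
     entire_geodesic M \<gamma> \<and> \<gamma> 0 = p \<and> frechet_derivative (cmap c \<circ> \<gamma>) (at 0) 1 = v)"

text \<open>By the Killing--Hopf theorem these are, up to isometry, the sphere, the Euclidean space and
  the hyperbolic space (of curvature \<open>\<epsilon>\<close>).\<close>

definition simply_connected_space_form ::
  "real \<Rightarrow> ('a::{t2_space, second_countable_topology}, 'e::euclidean_space) rchart set \<Rightarrow> bool" where
  "simply_connected_space_form \<epsilon> Q \<longleftrightarrow> riemannian_manifold Q \<and> geodesically_complete Q
     \<and> has_constant_curvature \<epsilon> Q \<and> simply_connected (carrier Q)"


section \<open>Warped products\<close>

definition warped_chart ::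
  "real set \<Rightarrow> (real \<Rightarrow> real) \<Rightarrow> ('q, 'e) rchart \<Rightarrow> (real \<times> 'q, real \<times> 'e) rchart" where
  "warped_chart I \<omega> c = \<lparr> cdom = I \<times> cdom c,
     cmap = (\<lambda>(t, p). (t, cmap c p)),
     cmet = (\<lambda>(t, x) (a, u) (b, v). a * b + (\<omega> t)\<^sup>2 * cmet c x u v) \<rparr>"

definition warped_product ::
  "real set \<Rightarrow> (real \<Rightarrow> real) \<Rightarrow> ('q, 'e) rchart set \<Rightarrow> (real \<times> 'q, real \<times> 'e) rchart set" where
  "warped_product I \<omega> Q = warped_chart I \<omega> ` Q"

definition warp_alpha :: "real \<Rightarrow> (real \<Rightarrow> real) \<Rightarrow> real \<Rightarrow> real" where
  "warp_alpha \<epsilon> \<omega> t = ((deriv \<omega> t)\<^sup>2 - \<epsilon>) / (\<omega> t)\<^sup>2"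

definition warp_beta :: "real \<Rightarrow> (real \<Rightarrow> real) \<Rightarrow> real \<Rightarrow> real" where
  "warp_beta \<epsilon> \<omega> t = deriv (deriv \<omega>) t / \<omega> t - warp_alpha \<epsilon> \<omega> t"


section \<open>Isometric immersions and shape operators\<close>

definition isometric_immersion ::
  "('s::{t2_space, second_countable_topology}, 'e::euclidean_space) rchart set
     \<Rightarrow> ('m::{t2_space, second_countable_topology}, 'h::euclidean_space) rchart set
     \<Rightarrow> ('s \<Rightarrow> 'm) \<Rightarrow> bool" where
  "isometric_immersion S M f \<longleftrightarrow>
     continuous_on (carrier S) f \<and> f ` carrier S \<subseteq> carrier M
     \<and> (\<forall>c\<in>S. \<forall>d\<in>M.
          smooth_on (cmap c ` (cdom c \<inter> f -` cdom d)) (local_rep c d f)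
          \<and> (\<forall>x \<in> cmap c ` (cdom c \<inter> f -` cdom d).
               inj (frechet_derivative (local_rep c d f) (at x))
               \<and> (\<forall>u v. cmet c x u v = cmet d (local_rep c d f x)
                    (frechet_derivative (local_rep c d f) (at x) u)
                    (frechet_derivative (local_rep c d f) (at x) v))))"

definition hypersurface ::
  "('s::{t2_space, second_countable_topology}, 'e::euclidean_space) rchart set
     \<Rightarrow> ('m::{t2_space, second_countable_topology}, 'h::euclidean_space) rchart set
     \<Rightarrow> ('s \<Rightarrow> 'm) \<Rightarrow> bool" where
  "hypersurface S M f \<longleftrightarrow> riemannian_manifold S \<and> isometric_immersion S M f
     \<and> DIM('h) = DIM('e) + 1"

text \<open>A vector field \<open>N\<close> along \<open>f\<close> is given by its components \<open>N d p\<close> at \<open>p\<close> with respect to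
  each chart \<open>d\<close> of the ambient manifold around \<open>f p\<close>. Since a hypersurface need not be two-sided,
  unit normal fields are considered on open subsets \<open>W\<close>.\<close>

definition unit_normal_field ::
  "('s::{t2_space, second_countable_topology}, 'e::euclidean_space) rchart set
     \<Rightarrow> ('m::{t2_space, second_countable_topology}, 'h::euclidean_space) rchart set
     \<Rightarrow> ('s \<Rightarrow> 'm) \<Rightarrow> 's set \<Rightarrow> (('m, 'h) rchart \<Rightarrow> 's \<Rightarrow> 'h) \<Rightarrow> bool" where
  "unit_normal_field S M f W N \<longleftrightarrow> open W \<and> W \<subseteq> carrier S
     \<and> (\<forall>d\<in>M. \<forall>d'\<in>M. \<forall>p\<in>W. f p \<in> cdom d \<inter> cdom d' \<longrightarrow>
          N d' p = frechet_derivative (transition d d') (at (cmap d (f p))) (N d p))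
     \<and> (\<forall>c\<in>S. \<forall>d\<in>M.
          smooth_on (cmap c ` (W \<inter> cdom c \<inter> f -` cdom d)) (N d \<circ> cinv c)
          \<and> (\<forall>p \<in> W \<inter> cdom c \<inter> f -` cdom d.
               cmet d (cmap d (f p)) (N d p) (N d p) = 1
               \<and> (\<forall>u. cmet d (cmap d (f p)) (N d p)
                        (frechet_derivative (local_rep c d f) (at (cmap c p)) u) = 0)))"

text \<open>The expression in the chart \<open>c\<close> of the shape operator with respect to \<open>N\<close> at the point with
  coordinates \<open>x\<close>. The derivative of \<open>N\<close> is computed in the ambient chart \<open>d\<close>; it is tangent to
  the hypersurface, and is pulled back along the differential of the immersion.\<close>

definition shape_operator ::
  "('s, 'e::euclidean_space) rchart \<Rightarrow> ('m, 'h::euclidean_space) rchart \<Rightarrow> ('s \<Rightarrow> 'm)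
     \<Rightarrow> (('m, 'h) rchart \<Rightarrow> 's \<Rightarrow> 'h) \<Rightarrow> 'e \<Rightarrow> 'e \<Rightarrow> 'e" where
  "shape_operator c d f N x u = (THE z. frechet_derivative (local_rep c d f) (at x) z
      = - cov_along (cmet d) (local_rep c d f) (N d \<circ> cinv c) x u)"

text \<open>The property \<open>P\<close> of linear operators (invariant under conjugation, as the charts vary) holds
  for the shape operator at every point, for a consistent choice of unit normals: given a unit
  normal field \<open>N\<close> on a connected open set, it holds throughout either for \<open>N\<close> or for \<open>-N\<close>,
  whose shape operators differ by the sign. For a two-sided connected hypersurface one can take
  a globally defined \<open>N\<close>.\<close>

definition shape_operator_satisfies ::
  "('s::{t2_space, second_countable_topology}, 'e::euclidean_space) rchart set
     \<Rightarrow> ('m::{t2_space, second_countable_topology}, 'h::euclidean_space) rchart set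
     \<Rightarrow> ('s \<Rightarrow> 'm) \<Rightarrow> (('e \<Rightarrow> 'e) \<Rightarrow> bool) \<Rightarrow> bool" where
  "shape_operator_satisfies S M f P \<longleftrightarrow>
     (\<forall>W N. connected W \<and> unit_normal_field S M f W N \<longrightarrow>
        (\<exists>s\<in>{1, -1}. \<forall>c\<in>S. \<forall>d\<in>M. \<forall>p \<in> W \<inter> cdom c \<inter> f -` cdom d.
           P (\<lambda>u. s *\<^sub>R shape_operator c d f N (cmap c p) u)))"

definition eigenspace :: "('e::real_vector \<Rightarrow> 'e) \<Rightarrow> real \<Rightarrow> 'e set" where
  "eigenspace A a = {u. A u = a *\<^sub>R u}"

definition eigenvalues :: "('e::real_vector \<Rightarrow> 'e) \<Rightarrow> real set" where
  "eigenvalues A = {a. \<exists>u. u \<noteq> 0 \<and> u \<in> eigenspace A a}"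

definition mean_curvature :: "('e::euclidean_space \<Rightarrow> 'e) \<Rightarrow> real" where
  "mean_curvature A = linear_trace A / real DIM('e)"

text \<open>The height function is \<open>fst \<circ> f\<close>; its gradient is expressed in the chart \<open>c\<close>.\<close>

definition height_gradient ::
  "('s, 'e::euclidean_space) rchart \<Rightarrow> ('s \<Rightarrow> real \<times> 'q) \<Rightarrow> 's \<Rightarrow> 'e" where
  "height_gradient c f p = gradient (cmet c) (fst \<circ> f \<circ> cinv c) (cmap c p)"

end

(* The curvature tensor of the warped product differs from that of a space form of curvature -alpha
   only by terms carrying the factor beta and the height components of two of the arguments. As
   (beta o xi) T = 0, these vanish on tangent vectors, so the Gauss equation is that of a
   hypersurface of a space form of curvature -alpha, and moreover
   grad (alpha o xi) = 2 (omega'/omega) (beta o xi) T = 0. Tracing the Gauss equation, the Einstein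
   condition becomes A^2 - (tr A) A + sigma = 0, and comparing the multiplicities p, q of the two
   roots with the trace gives (p - 1) lambda + (q - 1) mu = 0. This determines A for each sign of
   sigma; for sigma < 0 it leaves only finitely many values for (tr A)^2, which is a continuous
   function on the connected hypersurface and hence constant. *)

theory Submission
  imports Defs
begin

section \<open>Calculus with directional derivatives\<close>

text \<open>Two obstacles shape the proof. First, Christoffel vectors and pointwise shape operators
  are given by definite descriptions of the form
  \<open>THE z. \<forall>w. g x z w = \<phi> w\<close>. Before curvature can be computed, such
  representing vectors must be shown to depend continuously and differentiably on the point; a
  coercivity estimate does this, without inverting Gram matrices. Second, the hypersurface need not
  carry a global unit normal, so neither \<open>A\<close> nor its trace is a function on it. Only
  the squared trace is: it is the squared length of the mean curvature vector. The sign is restored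
  afterwards, separately for each unit normal field on a connected open set. Working with the square
  also replaces an argument that the multiplicities are locally constant. For sigma < 0, multiplying
  (p - 1) lambda = - (q - 1) mu by either root and using lambda * mu = sigma makes the squared trace
  an explicit function of p and q; once the trace is known to be constant, it determines the
  multiplicities in turn.\<close>

abbreviation dd :: "('a::real_normed_vector \<Rightarrow> 'b::real_normed_vector) \<Rightarrow> 'a \<Rightarrow> 'a \<Rightarrow> 'b" where
  "dd f x \<equiv> frechet_derivative f (at x)"

lemma dd_eqI: "(f has_derivative f') (at x) \<Longrightarrow> dd f x = f'"
  by (metis frechet_derivative_at)

lemma dd_has_derivative: "f differentiable (at x) \<Longrightarrow> (f has_derivative dd f x) (at x)"
  by (simp add: frechet_derivative_works)

text \<open>Functions that agree near \<open>x\<close> have the same derivatives, hence the same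
  choice in \<open>frechet_derivative\<close>. This also covers points at which neither function is
  differentiable.\<close>

lemma dd_cong:
  assumes "open U" "x \<in> U" "\<And>y. y \<in> U \<Longrightarrow> f y = g y"
  shows "dd f x = dd g x"
proof -
  have "eventually (\<lambda>y. y \<in> U) (nhds x)"
    using assms by (simp add: eventually_nhds_in_open)
  then have ev: "eventually (\<lambda>y. f y = g y) (at x)" "eventually (\<lambda>y. g y = f y) (at x)"
    unfolding eventually_at_filter by (auto elim!: eventually_mono simp: assms(3))
  have "(f has_derivative f') (at x) \<longleftrightarrow> (g has_derivative f') (at x)" for f'
    using ev assms(2,3) has_derivative_transform_eventually[of f f' x UNIV g]
      has_derivative_transform_eventually[of g f' x UNIV f] by auto
  then show ?thesis unfolding frechet_derivative_def by simp
qed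

lemma differentiable_cong_open:
  assumes "open U" "x \<in> U" "\<And>y. y \<in> U \<Longrightarrow> f y = g y"
    and "f differentiable (at x)"
  shows "g differentiable (at x)"
  using assms has_derivative_transform_within_open unfolding differentiable_def by blast

lemma dd_linear: "f differentiable (at x) \<Longrightarrow> linear (dd f x)"
  by (rule linear_frechet_derivative)

lemma dd_compose:
  assumes "f differentiable (at (F x))" "F differentiable (at x)"
  shows "dd (\<lambda>y. f (F y)) x u = dd f (F x) (dd F x u)"
  using frechet_derivative_compose[of F x f] assms by (simp add: o_def fun_eq_iff)

lemma differentiable_compose_at:
  assumes "f differentiable (at (F x))" "F differentiable (at x)"
  shows "(\<lambda>y. f (F y)) differentiable (at x)"
  using differentiable_chain_at[OF assms(2,1)] by (simp add: o_def)

lemma dd_deriv: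
  fixes f :: "real \<Rightarrow> real"
  assumes "f differentiable (at t)"
  shows "dd f t a = deriv f t * a"
proof -
  have "(f has_field_derivative deriv f t) (at t)"
    using assms by (simp add: DERIV_deriv_iff_real_differentiable)
  then show ?thesis
    by (metis dd_eqI has_field_derivative_def)
qed

section \<open>Smooth functions and their closure properties\<close>

lemma smooth_onD:
  assumes "smooth_on U f"
  shows "continuous_on U f" "x \<in> U \<Longrightarrow> f differentiable (at x)" "smooth_on U (\<lambda>x. dd f x v)"
proof -
  have *: "ck_on U f k" for k using assms by (simp add: smooth_on_def)
  show "continuous_on U f" using *[of 0] by simp
  show "x \<in> U \<Longrightarrow> f differentiable (at x)" using *[of 1] by simp
  show "smooth_on U (\<lambda>x. dd f x v)" unfolding smooth_on_def
  proof
    fix k show "ck_on U (\<lambda>x. dd f x v) k" using *[of "Suc k"] by simp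
  qed
qed

lemma ck_on_mono: "V \<subseteq> U \<Longrightarrow> ck_on U f k \<Longrightarrow> ck_on V f k"
  by (induction k arbitrary: f) (auto intro: continuous_on_subset)

lemma smooth_on_mono: "smooth_on U f \<Longrightarrow> V \<subseteq> U \<Longrightarrow> smooth_on V f"
  unfolding smooth_on_def by (auto intro: ck_on_mono)

text \<open>Openness lets \<open>dd_cong\<close> transfer the agreement of values to all iterated
  derivatives. The closure lemmas below use this to replace \<open>frechet_derivative\<close> by an
  explicit formula.\<close>

lemma ck_on_cong:
  assumes "open U" "\<And>x. x \<in> U \<Longrightarrow> f x = g x" "ck_on U f k"
  shows "ck_on U g k"
  using assms(2,3)
proof (induction k arbitrary: f g)
  case 0
  then show ?case by (simp cong: continuous_on_cong)
next
  case (Suc k)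
  have "ck_on U (\<lambda>x. dd g x v) k" for v
    by (rule Suc.IH[of "\<lambda>x. dd f x v"])
      (use Suc.prems dd_cong[OF assms(1), of _ f g] in auto)
  moreover have "g differentiable (at x)" if "x \<in> U" for x
    using differentiable_cong_open[OF assms(1) that, of f g] Suc.prems that by simp
  ultimately show ?case by simp
qed

lemma smooth_on_cong:
  assumes "open U" "\<And>x. x \<in> U \<Longrightarrow> f x = g x" "smooth_on U f"
  shows "smooth_on U g"
  using ck_on_cong[OF assms(1,2)] assms(3) by (auto simp: smooth_on_def)

lemma ck_on_Suc_imp: "ck_on U f (Suc k) \<Longrightarrow> ck_on U f k"
proof (induction k arbitrary: f)
  case 0
  then show ?case
    by (simp add: continuous_at_imp_continuous_on differentiable_imp_continuous_within)
next
  case (Suc k)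
  from Suc.prems have "\<forall>v. ck_on U (\<lambda>x. dd f x v) (Suc k)" by simp
  then show ?case using Suc.IH Suc.prems by simp
qed

lemma ck_on_const: "ck_on U (\<lambda>x. c) k"
  by (induction k arbitrary: c) auto

lemma ck_on_add:
  assumes "open U" "ck_on U f k" "ck_on U g k"
  shows "ck_on U (\<lambda>x. f x + g x) k"
  using assms(2,3)
proof (induction k arbitrary: f g)
  case 0
  then show ?case by (simp add: continuous_on_add)
next
  case (Suc k)
  have "ck_on U (\<lambda>x. dd (\<lambda>x. f x + g x) x v) k" for v
  proof (rule ck_on_cong[OF assms(1)])
    show "ck_on U (\<lambda>x. dd f x v + dd g x v) k"
      using Suc by simp
    fix x assume "x \<in> U"
    then show "dd f x v + dd g x v = dd (\<lambda>x. f x + g x) x v"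
      using Suc.prems dd_eqI[OF has_derivative_add[OF dd_has_derivative dd_has_derivative], of f x g]
      by simp
  qed
  then show ?case using Suc.prems by simp
qed

lemma ck_on_mult:
  fixes f g :: "'a::real_normed_vector \<Rightarrow> real"
  assumes "open U" "ck_on U f k" "ck_on U g k"
  shows "ck_on U (\<lambda>x. f x * g x) k"
  using assms(2,3)
proof (induction k arbitrary: f g)
  case 0
  then show ?case by (simp add: continuous_on_mult)
next
  case (Suc k)
  have "ck_on U (\<lambda>x. dd (\<lambda>x. f x * g x) x v) k" for v
  proof (rule ck_on_cong[OF assms(1)])
    \<comment> \<open>The factors \<open>f\<close> and \<open>g\<close> also occur undifferentiated;
      \<open>ck_on_Suc_imp\<close> supplies them to order \<open>k\<close>.\<close>
    show "ck_on U (\<lambda>x. f x * dd g x v + dd f x v * g x) k"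
      using Suc.prems ck_on_Suc_imp[OF Suc.prems(1)] ck_on_Suc_imp[OF Suc.prems(2)]
      by (intro ck_on_add Suc.IH assms(1)) auto
    fix x assume "x \<in> U"
    then show "f x * dd g x v + dd f x v * g x = dd (\<lambda>x. f x * g x) x v"
      using Suc.prems dd_eqI[OF has_derivative_mult[OF dd_has_derivative dd_has_derivative], of f x g]
      by simp
  qed
  then show ?case using Suc.prems by simp
qed

text \<open>Meant for the projections of a product. The derivative of the inner map is constant, so
  differentiating the composite only evaluates \<open>dd f\<close> at the fixed vector
  \<open>L v\<close>, and the induction closes.\<close>

lemma ck_on_linear_compose:
  assumes "bounded_linear L" "\<And>x. x \<in> U \<Longrightarrow> L x \<in> V" "ck_on V f k"
  shows "open U \<Longrightarrow> ck_on U (\<lambda>x. f (L x)) k"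
  using assms(3)
proof (induction k arbitrary: f)
  case 0
  then show ?case
    using continuous_on_compose2[OF _ linear_continuous_on[OF assms(1)], of V f U] assms(2) by auto
next
  case (Suc k)
  have Ld: "L differentiable (at x)" "dd L x = L" for x
    using bounded_linear_imp_has_derivative[OF assms(1), of "at x"]
    by (auto simp: differentiable_def dd_eqI)
  have "ck_on U (\<lambda>x. dd (\<lambda>x. f (L x)) x v) k" for v
  proof (rule ck_on_cong[OF Suc.prems(1)])
    show "ck_on U (\<lambda>x. (\<lambda>y. dd f y (L v)) (L x)) k"
      by (rule Suc.IH) (use Suc.prems in auto)
    fix x assume "x \<in> U"
    then show "dd f (L x) (L v) = dd (\<lambda>x. f (L x)) x v"
      using dd_compose[of f L x v] Suc.prems assms(2) Ld by simp
  qed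
  moreover have "(\<lambda>x. f (L x)) differentiable (at x)" if "x \<in> U" for x
    using differentiable_compose_at[of f L x] Suc.prems assms(2) Ld that by simp
  ultimately show ?case by simp
qed

lemma ck_on_Pair:
  assumes "open U" "ck_on U f k" "ck_on U g k"
  shows "ck_on U (\<lambda>x. (f x, g x)) k"
  using assms(2,3)
proof (induction k arbitrary: f g)
  case 0
  then show ?case by (simp add: continuous_on_Pair)
next
  case (Suc k)
  have d: "((\<lambda>x. (f x, g x)) has_derivative (\<lambda>v. (dd f x v, dd g x v))) (at x)" if "x \<in> U" for x
    by (intro has_derivative_Pair dd_has_derivative) (use Suc.prems that in auto)
  have "ck_on U (\<lambda>x. dd (\<lambda>x. (f x, g x)) x v) k" for v
    by (rule ck_on_cong[OF assms(1), of "\<lambda>x. (dd f x v, dd g x v)"])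
      (use Suc dd_eqI[OF d] in simp_all)
  then show ?case using d by (auto simp: differentiable_def)
qed

text \<open>Both mixed derivatives equal, up to a small displacement, the same second difference
  quotient over a parallelogram.\<close>

lemma second_difference:
  fixes f :: "'a::real_normed_vector \<Rightarrow> real"
  assumes "0 < h"
    and U: "\<And>s t. 0 \<le> s \<Longrightarrow> s \<le> h \<Longrightarrow> 0 \<le> t \<Longrightarrow> t \<le> h \<Longrightarrow> x + s *\<^sub>R u + t *\<^sub>R v \<in> U"
    and f: "\<And>y. y \<in> U \<Longrightarrow> f differentiable (at y)"
    and fu: "\<And>y. y \<in> U \<Longrightarrow> (\<lambda>z. dd f z u) differentiable (at y)"
  shows "\<exists>s t. 0 < s \<and> s < h \<and> 0 < t \<and> t < h \<and>
    f (x + h *\<^sub>R u + h *\<^sub>R v) - f (x + h *\<^sub>R u) - f (x + h *\<^sub>R v) + f x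
      = h * h * dd (\<lambda>z. dd f z u) (x + s *\<^sub>R u + t *\<^sub>R v) v"
proof -
  have D: "((\<lambda>s. f (a + s *\<^sub>R w)) has_real_derivative dd f (a + s *\<^sub>R w) w) (at s)"
    if "f differentiable (at (a + s *\<^sub>R w))" for f :: "'a \<Rightarrow> real" and a w s
  proof -
    have g: "((\<lambda>s. a + s *\<^sub>R w) has_derivative (\<lambda>r. r *\<^sub>R w)) (at s)"
      by (auto intro!: derivative_eq_intros)
    have "((\<lambda>s. f (a + s *\<^sub>R w)) has_derivative (\<lambda>r. dd f (a + s *\<^sub>R w) (r *\<^sub>R w))) (at s)"
      using has_derivative_compose[OF g dd_has_derivative[OF that]] .
    moreover have "dd f (a + s *\<^sub>R w) (r *\<^sub>R w) = dd f (a + s *\<^sub>R w) w * r" for r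
      using linear_scale[OF dd_linear[OF that]] by simp
    ultimately show ?thesis by (simp add: has_field_derivative_def)
  qed
  \<comment> \<open>The increment of \<open>f\<close> along \<open>v\<close>. The mean value theorem
    in direction \<open>u\<close> turns the second difference into an increment of
    \<open>dd f _ u\<close> along \<open>v\<close>, to which it is applied once more.\<close>
  define g where "g s = f (x + h *\<^sub>R v + s *\<^sub>R u) - f (x + s *\<^sub>R u)" for s
  have "\<exists>s>0. s < h \<and> g h - g 0 = (h - 0) * (dd f (x + h *\<^sub>R v + s *\<^sub>R u) u - dd f (x + s *\<^sub>R u) u)"
  proof (rule MVT2[OF \<open>0 < h\<close>])
    fix s assume s: "0 \<le> s" "s \<le> h"
    have "x + h *\<^sub>R v + s *\<^sub>R u \<in> U" "x + s *\<^sub>R u \<in> U"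
      using U[of s h] U[of s 0] s \<open>0 < h\<close> by (simp_all add: algebra_simps)
    then show "(g has_real_derivative dd f (x + h *\<^sub>R v + s *\<^sub>R u) u - dd f (x + s *\<^sub>R u) u) (at s)"
      unfolding g_def by (intro DERIV_diff D f) auto
  qed
  then obtain s where s: "0 < s" "s < h"
    and gs: "g h - g 0 = h * (dd f (x + h *\<^sub>R v + s *\<^sub>R u) u - dd f (x + s *\<^sub>R u) u)" by auto
  have "\<exists>t>0. t < h \<and> dd f (x + s *\<^sub>R u + h *\<^sub>R v) u - dd f (x + s *\<^sub>R u + 0 *\<^sub>R v) u
      = (h - 0) * dd (\<lambda>z. dd f z u) (x + s *\<^sub>R u + t *\<^sub>R v) v"
    by (rule MVT2[OF \<open>0 < h\<close>]) (use U s in \<open>auto intro!: D fu\<close>)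
  then obtain t where "0 < t" "t < h" "dd f (x + s *\<^sub>R u + h *\<^sub>R v) u - dd f (x + s *\<^sub>R u) u
      = h * dd (\<lambda>z. dd f z u) (x + s *\<^sub>R u + t *\<^sub>R v) v" by auto
  then show ?thesis
    using s gs by (intro exI[of _ s] exI[of _ t]) (auto simp: g_def algebra_simps)
qed

lemma symmetric_second_derivative_real:
  fixes f :: "'a::real_normed_vector \<Rightarrow> real"
  assumes "open U" "x \<in> U" "smooth_on U f"
  shows "dd (\<lambda>y. dd f y v) x u = dd (\<lambda>y. dd f y u) x v"
proof (rule ccontr)
  define P where "P u v y = dd (\<lambda>y. dd f y u) y v" for u v y
  assume "\<not> ?thesis"
  then have "P u v x \<noteq> P v u x" by (simp add: P_def)
  \<comment> \<open>Within half of the gap around \<open>x\<close>, with strict inequality, the two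
    mixed derivatives can no longer take a common value.\<close>
  then have e: "0 < \<bar>P u v x - P v u x\<bar> / 2" (is "0 < ?e") by simp
  have "continuous_on U (P u v)" for u v
    unfolding P_def by (intro smooth_onD assms(3))
  then have "isCont (P u v) x" for u v
    using assms(1,2) continuous_on_eq_continuous_at by blast
  then have "\<forall>u v. \<exists>d>0. \<forall>y. dist y x < d \<longrightarrow> dist (P u v y) (P u v x) < ?e"
    using e unfolding continuous_at_eps_delta by blast
  then obtain d where d: "\<And>u v. d u v > 0" "\<And>u v y. dist y x < d u v \<Longrightarrow> dist (P u v y) (P u v x) < ?e"
    by metis
  obtain r where r: "r > 0" "ball x r \<subseteq> U" using assms(1,2) open_contains_ball by blast
  define m where "m = min r (min (d u v) (d v u))"
  have m: "m > 0" using r d by (simp add: m_def)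
  \<comment> \<open>The side is chosen so that the whole parallelogram lies within distance
    \<open>m\<close> of \<open>x\<close>; the summand 1 keeps the denominator positive when
    \<open>u\<close> and \<open>v\<close> vanish.\<close>
  define h where "h = m / (2 * (norm u + norm v + 1))"
  have h: "h > 0" using m by (simp add: h_def add_nonneg_pos)
  have hm: "h * (norm u + norm v) < m"
  proof -
    have "h * (norm u + norm v) \<le> h * (norm u + norm v + 1)" using h by simp
    also have "\<dots> = m / 2" by (simp add: h_def field_simps add_nonneg_eq_0_iff)
    finally show ?thesis using m by simp
  qed
  have near: "dist (x + s *\<^sub>R u + t *\<^sub>R v) x < m" if "0 \<le> s" "s \<le> h" "0 \<le> t" "t \<le> h" for s t
  proof -
    have "dist (x + s *\<^sub>R u + t *\<^sub>R v) x = norm (s *\<^sub>R u + t *\<^sub>R v)" by (simp add: dist_norm)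
    also have "\<dots> \<le> s * norm u + t * norm v"
      using norm_triangle_ineq[of "s *\<^sub>R u" "t *\<^sub>R v"] that by simp
    also have "\<dots> \<le> h * norm u + h * norm v"
      using that by (intro add_mono mult_right_mono) auto
    finally show ?thesis using hm by (simp add: algebra_simps)
  qed
  have inU: "y \<in> U" if "dist y x < m" for y
    using r(2) that by (auto simp: m_def dist_commute)
  note S = smooth_onD(2)[OF assms(3)] smooth_onD(2)[OF smooth_onD(3)[OF assms(3)]]
  obtain s t where 1: "0 < s" "s < h" "0 < t" "t < h"
    "f (x + h *\<^sub>R u + h *\<^sub>R v) - f (x + h *\<^sub>R u) - f (x + h *\<^sub>R v) + f x
      = h * h * P u v (x + s *\<^sub>R u + t *\<^sub>R v)"
    using second_difference[OF h, of x u v U f] near inU S unfolding P_def by blast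
  have near': "dist (x + t *\<^sub>R v + s *\<^sub>R u) x < m" if "0 \<le> s" "s \<le> h" "0 \<le> t" "t \<le> h" for s t
    using near[OF that] by (simp add: algebra_simps)
  obtain s' t' where 2: "0 < s'" "s' < h" "0 < t'" "t' < h"
    "f (x + h *\<^sub>R v + h *\<^sub>R u) - f (x + h *\<^sub>R v) - f (x + h *\<^sub>R u) + f x
      = h * h * P v u (x + s' *\<^sub>R v + t' *\<^sub>R u)"
    using second_difference[OF h, of x v u U f] near' inU S unfolding P_def by blast
  have "P u v (x + s *\<^sub>R u + t *\<^sub>R v) = P v u (x + s' *\<^sub>R v + t' *\<^sub>R u)"
    using 1(5) 2(5) h by (simp add: algebra_simps)
  moreover have "dist (P u v (x + s *\<^sub>R u + t *\<^sub>R v)) (P u v x) < ?e"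
    using near[of s t] 1 by (intro d) (auto simp: m_def)
  moreover have "dist (P v u (x + s' *\<^sub>R v + t' *\<^sub>R u)) (P v u x) < ?e"
    using near'[of t' s'] 2 by (intro d) (auto simp: m_def)
  ultimately show False by (auto simp: dist_real_def abs_if split: if_splits)
qed

lemma dd_inner_right:
  assumes "f differentiable (at x)"
  shows "dd (\<lambda>y. f y \<bullet> b) x u = dd f x u \<bullet> b"
  by (rule fun_cong[OF dd_eqI]) (intro has_derivative_inner_left dd_has_derivative assms)

lemma smooth_on_inner:
  assumes "open U" "smooth_on U f"
  shows "smooth_on U (\<lambda>x. f x \<bullet> b)"
  unfolding smooth_on_def
proof
  fix k
  have "ck_on U f k" using assms(2) by (simp add: smooth_on_def)
  then show "ck_on U (\<lambda>x. f x \<bullet> b) k"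
  proof (induction k arbitrary: f)
    case 0
    then show ?case by (simp add: continuous_on_inner)
  next
    case (Suc k)
    have "ck_on U (\<lambda>x. dd (\<lambda>x. f x \<bullet> b) x v) k" for v
      by (rule ck_on_cong[OF assms(1), of "\<lambda>x. dd f x v \<bullet> b"])
        (use Suc in \<open>auto simp: dd_inner_right\<close>)
    then show ?case using Suc.prems
      by (auto intro!: differentiable_inner)
  qed
qed

lemma symmetric_second_derivative:
  fixes f :: "'a::real_normed_vector \<Rightarrow> 'b::euclidean_space"
  assumes "open U" "x \<in> U" "smooth_on U f"
  shows "dd (\<lambda>y. dd f y v) x u = dd (\<lambda>y. dd f y u) x v"
proof (rule euclidean_eqI)
  fix b :: 'b assume "b \<in> Basis"
  have "dd (\<lambda>y. dd f y v) x u \<bullet> b = dd (\<lambda>y. dd (\<lambda>z. f z \<bullet> b) y v) x u" for u v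
  proof -
    have "dd (\<lambda>y. dd f y v) x u \<bullet> b = dd (\<lambda>y. dd f y v \<bullet> b) x u"
      by (rule dd_inner_right[symmetric]) (rule smooth_onD(2)[OF smooth_onD(3)[OF assms(3)] assms(2)])
    also have "dd (\<lambda>y. dd f y v \<bullet> b) x = dd (\<lambda>y. dd (\<lambda>z. f z \<bullet> b) y v) x"
      by (rule dd_cong[OF assms(1,2)]) (rule dd_inner_right[symmetric], rule smooth_onD(2)[OF assms(3)])
    finally show ?thesis .
  qed
  then show "dd (\<lambda>y. dd f y v) x u \<bullet> b = dd (\<lambda>y. dd f y u) x v \<bullet> b"
    using symmetric_second_derivative_real[OF assms(1,2) smooth_on_inner[OF assms(1,3)]] by simp
qed

section \<open>Fields inserted into point-dependent linear and bilinear maps\<close>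

lemma linear_sum_Basis: "linear L \<Longrightarrow> L v = (\<Sum>b\<in>Basis. (v \<bullet> b) *\<^sub>R L b)" for v :: "'a::euclidean_space"
  by (subst euclidean_representation[symmetric]) (simp add: linear_sum linear_scale)

text \<open>A Leibniz rule obtained by expanding the argument in the standard basis. The derivative
  of the family is expressed with the argument frozen at \<open>Y x\<close>, so no topology on a
  space of linear maps enters.\<close>

lemma has_derivative_linear_apply:
  fixes Y :: "'m::real_normed_vector \<Rightarrow> 'e::euclidean_space"
    and L :: "'m \<Rightarrow> 'e \<Rightarrow> 'f::real_normed_vector"
  assumes "open U" "x \<in> U" "\<And>y. y \<in> U \<Longrightarrow> linear (L y)"
    and "\<And>v. (\<lambda>y. L y v) differentiable (at x)" "Y differentiable (at x)"
  shows "((\<lambda>y. L y (Y y)) has_derivative (\<lambda>u. dd (\<lambda>y. L y (Y x)) x u + L x (dd Y x u))) (at x)"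
proof -
  have eq: "L y v = (\<Sum>b\<in>Basis. (v \<bullet> b) *\<^sub>R L y b)" if "y \<in> U" for y v
    using linear_sum_Basis assms(3)[OF that] by blast
  have "((\<lambda>y. \<Sum>b\<in>Basis. (Y y \<bullet> b) *\<^sub>R L y b) has_derivative
      (\<lambda>u. \<Sum>b\<in>Basis. (Y x \<bullet> b) *\<^sub>R dd (\<lambda>y. L y b) x u + (dd Y x u \<bullet> b) *\<^sub>R L x b)) (at x)"
    by (intro has_derivative_sum has_derivative_scaleR has_derivative_inner_left
        dd_has_derivative assms)
  then have 1: "((\<lambda>y. L y (Y y)) has_derivative
      (\<lambda>u. \<Sum>b\<in>Basis. (Y x \<bullet> b) *\<^sub>R dd (\<lambda>y. L y b) x u + (dd Y x u \<bullet> b) *\<^sub>R L x b)) (at x)"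
    by (rule has_derivative_transform_within_open[OF _ assms(1,2)]) (simp add: eq)
  have "((\<lambda>y. \<Sum>b\<in>Basis. (Y x \<bullet> b) *\<^sub>R L y b) has_derivative
      (\<lambda>u. \<Sum>b\<in>Basis. (Y x \<bullet> b) *\<^sub>R dd (\<lambda>y. L y b) x u)) (at x)"
    by (intro has_derivative_sum has_derivative_scaleR_right dd_has_derivative assms)
  then have "((\<lambda>y. L y (Y x)) has_derivative
      (\<lambda>u. \<Sum>b\<in>Basis. (Y x \<bullet> b) *\<^sub>R dd (\<lambda>y. L y b) x u)) (at x)"
    by (rule has_derivative_transform_within_open[OF _ assms(1,2)]) (simp add: eq)
  from dd_eqI[OF this] 1 show ?thesis
    by (simp add: sum.distrib eq[OF assms(2), of "dd Y x _"])
qed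

lemma has_derivative_bilinear_apply:
  fixes Y :: "'m::real_normed_vector \<Rightarrow> 'e::euclidean_space"
    and Z :: "'m \<Rightarrow> 'h::euclidean_space"
    and B :: "'m \<Rightarrow> 'e \<Rightarrow> 'h \<Rightarrow> 'f::real_normed_vector"
  assumes "open U" "x \<in> U" "\<And>y. y \<in> U \<Longrightarrow> bilinear (B y)"
    and B: "\<And>v w. (\<lambda>y. B y v w) differentiable (at x)"
    and Y: "Y differentiable (at x)" and Z: "Z differentiable (at x)"
  shows "((\<lambda>y. B y (Y y) (Z y)) has_derivative
    (\<lambda>u. dd (\<lambda>y. B y (Y x) (Z x)) x u + B x (dd Y x u) (Z x) + B x (Y x) (dd Z x u))) (at x)"
proof -
  have lin: "linear (\<lambda>v. B y v w)" "linear (B y v)" if "y \<in> U" for y v w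
    using assms(3)[OF that] unfolding bilinear_def by auto
  have 1: "((\<lambda>y. B y (Y y) w) has_derivative
      (\<lambda>u. dd (\<lambda>y. B y (Y x) w) x u + B x (dd Y x u) w)) (at x)" for w
    by (rule has_derivative_linear_apply[OF assms(1,2), of "\<lambda>y v. B y v w"])
      (use lin B Y in auto)
  have "((\<lambda>y. B y (Y y) (Z y)) has_derivative
      (\<lambda>u. dd (\<lambda>y. B y (Y y) (Z x)) x u + B x (Y x) (dd Z x u))) (at x)"
    by (rule has_derivative_linear_apply[OF assms(1,2), of "\<lambda>y w. B y (Y y) w"])
      (use lin Z differentiableI[OF 1] in auto)
  then show ?thesis using dd_eqI[OF 1] by simp
qed

lemma continuous_on_linear_apply:
  fixes Y :: "'m::topological_space \<Rightarrow> 'e::euclidean_space"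
    and L :: "'m \<Rightarrow> 'e \<Rightarrow> 'f::real_normed_vector"
  assumes "\<And>y. y \<in> U \<Longrightarrow> linear (L y)" "\<And>v. continuous_on U (\<lambda>y. L y v)" "continuous_on U Y"
  shows "continuous_on U (\<lambda>y. L y (Y y))"
proof -
  have "continuous_on U (\<lambda>y. \<Sum>b\<in>Basis. (Y y \<bullet> b) *\<^sub>R L y b)"
    by (intro continuous_intros assms)
  then show ?thesis
    by (rule continuous_on_eq) (metis linear_sum_Basis assms(1))
qed

lemma continuous_on_bilinear_apply:
  fixes Y :: "'m::topological_space \<Rightarrow> 'e::euclidean_space"
    and Z :: "'m \<Rightarrow> 'h::euclidean_space"
    and B :: "'m \<Rightarrow> 'e \<Rightarrow> 'h \<Rightarrow> 'f::real_normed_vector"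
  assumes "\<And>y. y \<in> U \<Longrightarrow> bilinear (B y)" "\<And>v w. continuous_on U (\<lambda>y. B y v w)"
    "continuous_on U Y" "continuous_on U Z"
  shows "continuous_on U (\<lambda>y. B y (Y y) (Z y))"
proof (rule continuous_on_linear_apply[OF _ _ assms(4)])
  show "linear (B y (Y y))" if "y \<in> U" for y
    using assms(1)[OF that] by (simp add: bilinear_def)
  show "continuous_on U (\<lambda>y. B y (Y y) w)" for w
    by (rule continuous_on_linear_apply[OF _ _ assms(3), of "\<lambda>y v. B y v w"])
      (use assms in \<open>auto simp: bilinear_def\<close>)
qed

section \<open>Inner products and their representing vectors\<close>

definition inner_form :: "('e::euclidean_space \<Rightarrow> 'e \<Rightarrow> real) \<Rightarrow> bool" where
  "inner_form B \<longleftrightarrow> bilinear B \<and> (\<forall>u v. B u v = B v u) \<and> (\<forall>u. u \<noteq> 0 \<longrightarrow> B u u > 0)"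

lemma bilinear_linear_left: "bilinear B \<Longrightarrow> linear (\<lambda>u. B u v)"
  and bilinear_linear_right: "bilinear B \<Longrightarrow> linear (B u)"
  by (simp_all add: bilinear_def)

lemmas bilinear_simps = bilinear_ladd bilinear_radd bilinear_lmul bilinear_rmul bilinear_lneg
  bilinear_rneg bilinear_lsub bilinear_rsub bilinear_lzero bilinear_rzero

lemma inner_formD:
  assumes "inner_form B"
  shows "bilinear B" "B u v = B v u" "u \<noteq> 0 \<Longrightarrow> B u u > 0" "B u u \<ge> 0" "B u u = 0 \<longleftrightarrow> u = 0"
proof -
  show b: "bilinear B" and "B u v = B v u" and p: "u \<noteq> 0 \<Longrightarrow> B u u > 0"
    using assms by (auto simp: inner_form_def)
  show "B u u \<ge> 0" "B u u = 0 \<longleftrightarrow> u = 0"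
    using p bilinear_lzero[OF b] by (cases "u = 0"; force)+
qed

lemma inner_form_eqI:
  assumes "inner_form B" "\<And>w. B a w = B b w"
  shows "a = b"
  using assms(2)[of "a - b"] inner_formD(5)[OF assms(1), of "a - b"] inner_formD(1)[OF assms(1)]
  by (simp add: bilinear_lsub)

text \<open>The map \<open>J\<close> sends \<open>z\<close> to the Euclidean representative of
  \<open>B z\<close>. Positivity makes it injective, and finite dimension makes it onto. This
  justifies the definite descriptions for connections, gradients and shape operators.\<close>

lemma inner_form_representation:
  assumes "inner_form B" "linear \<phi>"
  shows "\<exists>!z. \<forall>w. B z w = \<phi> w"
proof -
  note b = inner_formD(1)[OF assms(1)]
  define J where "J z = (\<Sum>b\<in>Basis. B z b *\<^sub>R b)" for z
  have J: "J z \<bullet> w = B z w" for z w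
    unfolding J_def inner_sum_left using linear_sum_Basis[OF bilinear_linear_right[OF b], of z w]
    by (simp add: inner_commute mult.commute)
  have "linear J"
    unfolding J_def
    by (rule linearI) (simp_all add: bilinear_simps[OF b] scaleR_add_left sum.distrib scaleR_sum_right)
  moreover have "inj J"
    using J inner_form_eqI[OF assms(1)] by (metis injI)
  ultimately have "surj J" by (simp add: linear_injective_imp_surjective)
  then obtain z where "J z = (\<Sum>b\<in>Basis. \<phi> b *\<^sub>R b)" by (metis surjD)
  then have "B z w = \<phi> w" for w
    unfolding J[symmetric] using linear_sum_Basis[OF assms(2), of w]
    by (simp add: inner_sum_right inner_commute[of _ w] mult.commute)
  then show ?thesis using inner_form_eqI[OF assms(1)] by metis
qed

lemma inner_form_THE:
  assumes "inner_form B" "linear \<phi>"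
  shows "B (THE z. \<forall>w. B z w = \<phi> w) w = \<phi> w"
  using theI'[OF inner_form_representation[OF assms]] by blast

section \<open>Dependence of representing vectors on the point\<close>

text \<open>The constant is the minimum of the quadratic form on the compact unit sphere;
  homogeneity extends the bound to all vectors.\<close>

lemma inner_form_lower_bound:
  fixes B :: "'e::euclidean_space \<Rightarrow> 'e \<Rightarrow> real"
  assumes "inner_form B"
  shows "\<exists>c>0. \<forall>v. c * (norm v)\<^sup>2 \<le> B v v"
proof -
  note b = inner_formD(1)[OF assms]
  have "continuous_on (sphere 0 1) (\<lambda>v. B v v)"
    by (rule continuous_on_bilinear_apply[of _ "\<lambda>_. B"]) (auto intro: b)
  moreover have "sphere (0::'e) 1 \<noteq> {}" by simp
  ultimately obtain w where w: "w \<in> sphere 0 1" "\<And>v. v \<in> sphere 0 1 \<Longrightarrow> B w w \<le> B v v"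
    using continuous_attains_inf[of "sphere (0::'e) 1" "\<lambda>v. B v v"] by auto
  have "B w w * (norm v)\<^sup>2 \<le> B v v" for v
  proof (cases "v = 0")
    case False
    have "B w w \<le> B (v /\<^sub>R norm v) (v /\<^sub>R norm v)" using False by (intro w) simp
    then show ?thesis using False by (simp add: bilinear_simps[OF b] field_simps power2_eq_square)
  qed (simp add: bilinear_lzero[OF b])
  moreover have "B w w > 0" using w(1) by (intro inner_formD(3)[OF assms]) auto
  ultimately show ?thesis by blast
qed

lemma bilinear_bound_Basis:
  fixes B :: "'e::euclidean_space \<Rightarrow> 'e \<Rightarrow> real"
  assumes "bilinear B"
  shows "\<bar>B v w\<bar> \<le> (\<Sum>a\<in>Basis. \<Sum>b\<in>Basis. \<bar>B a b\<bar>) * norm v * norm w"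
proof -
  have "B v w = (\<Sum>a\<in>Basis. \<Sum>b\<in>Basis. (v \<bullet> a) * (w \<bullet> b) * B a b)"
    using linear_sum_Basis[OF bilinear_linear_left[OF assms], of v w]
      linear_sum_Basis[OF bilinear_linear_right[OF assms], of _ w]
    by (simp add: sum_distrib_left mult.assoc)
  also have "\<bar>\<dots>\<bar> \<le> (\<Sum>a\<in>Basis. \<Sum>b\<in>Basis. \<bar>(v \<bullet> a) * (w \<bullet> b) * B a b\<bar>)"
    by (intro order.trans[OF sum_abs] sum_mono sum_abs)
  also have "\<dots> \<le> (\<Sum>a\<in>Basis. \<Sum>b\<in>Basis. \<bar>B a b\<bar> * norm v * norm w)"
  proof (intro sum_mono)
    fix a b :: 'e assume "a \<in> Basis" "b \<in> Basis"
    then have "\<bar>v \<bullet> a\<bar> * \<bar>w \<bullet> b\<bar> \<le> norm v * norm w"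
      by (intro mult_mono) (auto simp: Basis_le_norm)
    then have "\<bar>v \<bullet> a\<bar> * \<bar>w \<bullet> b\<bar> * \<bar>B a b\<bar> \<le> norm v * norm w * \<bar>B a b\<bar>"
      by (intro mult_right_mono) auto
    then show "\<bar>(v \<bullet> a) * (w \<bullet> b) * B a b\<bar> \<le> \<bar>B a b\<bar> * norm v * norm w"
      by (simp add: abs_mult mult_ac)
  qed
  finally show ?thesis by (simp add: sum_distrib_right)
qed

text \<open>Testing the defining equations of \<open>z x - z x0\<close> against \<open>z x - z x0\<close> itself.\<close>

lemma representation_continuous_at:
  fixes g :: "'m::t2_space \<Rightarrow> 'e::euclidean_space \<Rightarrow> 'e \<Rightarrow> real"
  assumes "open U" "x\<^sub>0 \<in> U" "\<And>x. x \<in> U \<Longrightarrow> inner_form (g x)" "\<And>x. x \<in> U \<Longrightarrow> linear (\<phi> x)"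
    and g: "\<And>v w. isCont (\<lambda>x. g x v w) x\<^sub>0" and \<phi>: "\<And>w. isCont (\<lambda>x. \<phi> x w) x\<^sub>0"
    and z: "\<And>x w. x \<in> U \<Longrightarrow> g x (z x) w = \<phi> x w"
  shows "isCont z x\<^sub>0"
proof -
  obtain c where c: "c > 0" "\<And>v. c * (norm v)\<^sup>2 \<le> g x\<^sub>0 v v"
    using inner_form_lower_bound[OF assms(3)[OF assms(2)]] by blast
  define \<delta> where "\<delta> x = (\<Sum>a\<in>Basis. \<Sum>b\<in>Basis. \<bar>g x a b - g x\<^sub>0 a b\<bar>)" for x
  define \<eta> where "\<eta> x = (\<Sum>b\<in>Basis. \<bar>\<phi> x b - \<phi> x\<^sub>0 b\<bar>)" for x
  have d0: "(\<delta> \<longlongrightarrow> 0) (at x\<^sub>0)"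
  proof -
    have "(\<delta> \<longlongrightarrow> (\<Sum>a\<in>(Basis::'e set). \<Sum>b\<in>(Basis::'e set). \<bar>g x\<^sub>0 a b - g x\<^sub>0 a b\<bar>)) (at x\<^sub>0)"
      unfolding \<delta>_def by (intro tendsto_intros g[unfolded isCont_def])
    then show ?thesis by simp
  qed
  have e0: "(\<eta> \<longlongrightarrow> 0) (at x\<^sub>0)"
  proof -
    have "(\<eta> \<longlongrightarrow> (\<Sum>b\<in>(Basis::'e set). \<bar>\<phi> x\<^sub>0 b - \<phi> x\<^sub>0 b\<bar>)) (at x\<^sub>0)"
      unfolding \<eta>_def by (intro tendsto_intros \<phi>[unfolded isCont_def])
    then show ?thesis by simp
  qed
  have nonneg: "\<delta> x \<ge> 0" "\<eta> x \<ge> 0" for x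
    by (simp_all add: \<delta>_def \<eta>_def sum_nonneg)
  \<comment> \<open>Once \<open>\<delta> x\<close> is below \<open>c / 2\<close>, half of the
    coercivity constant absorbs the error term proportional to the distance being estimated; the
    other half produces the factor \<open>2 / c\<close>.\<close>
  have bound: "norm (z x - z x\<^sub>0) \<le> 2 / c * (\<eta> x + \<delta> x * norm (z x\<^sub>0))"
    if "x \<in> U" "\<delta> x < c / 2" for x
  proof -
    define d where "d = z x - z x\<^sub>0"
    note bx = inner_formD(1)[OF assms(3)[OF that(1)]]
    note b0 = inner_formD(1)[OF assms(3)[OF assms(2)]]
    have bd: "bilinear (\<lambda>v w. g x v w - g x\<^sub>0 v w)"
      using bx b0 by (auto simp: bilinear_def intro: linear_compose_sub)
    have 1: "\<bar>\<phi> x d - \<phi> x\<^sub>0 d\<bar> \<le> \<eta> x * norm d"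
    proof -
      have "\<phi> x d - \<phi> x\<^sub>0 d = (\<Sum>b\<in>Basis. (d \<bullet> b) * (\<phi> x b - \<phi> x\<^sub>0 b))"
        using linear_sum_Basis[OF assms(4)[OF that(1)], of d]
          linear_sum_Basis[OF assms(4)[OF assms(2)], of d]
        by (simp add: right_diff_distrib sum_subtractf)
      also have "\<bar>\<dots>\<bar> \<le> (\<Sum>b\<in>Basis. \<bar>\<phi> x b - \<phi> x\<^sub>0 b\<bar> * norm d)"
        by (rule order.trans[OF sum_abs], rule sum_mono)
          (simp add: abs_mult mult.commute[of _ "norm d"] Basis_le_norm mult_right_mono)
      finally show ?thesis by (simp add: \<eta>_def sum_distrib_right)
    qed
    have "g x\<^sub>0 d d = g x (z x) d - g x\<^sub>0 (z x\<^sub>0) d - (g x (z x) d - g x\<^sub>0 (z x) d)"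
      by (simp add: d_def bilinear_simps[OF b0])
    then have "c * (norm d)\<^sup>2 \<le> \<bar>\<phi> x d - \<phi> x\<^sub>0 d\<bar> + \<bar>g x (z x) d - g x\<^sub>0 (z x) d\<bar>"
      using c(2)[of d] z[OF that(1), of d] z[OF assms(2), of d] by linarith
    also have "\<dots> \<le> \<eta> x * norm d + \<delta> x * norm (z x) * norm d"
      using 1 bilinear_bound_Basis[OF bd, of "z x" d] unfolding \<delta>_def by linarith
    also have "\<dots> \<le> \<eta> x * norm d + \<delta> x * (norm (z x\<^sub>0) + norm d) * norm d"
      using norm_triangle_ineq[of "z x\<^sub>0" d] nonneg
      by (intro add_left_mono mult_right_mono mult_left_mono) (auto simp: d_def)
    finally have *: "c * norm d * norm d \<le> (\<eta> x + \<delta> x * (norm (z x\<^sub>0) + norm d)) * norm d"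
      by (simp add: power2_eq_square algebra_simps)
    have "c * norm d \<le> \<eta> x + \<delta> x * (norm (z x\<^sub>0) + norm d)"
    proof (cases "d = 0")
      case True
      then show ?thesis using nonneg by simp
    next
      case False
      then show ?thesis using * by simp
    qed
    also have "\<dots> \<le> \<eta> x + \<delta> x * norm (z x\<^sub>0) + c / 2 * norm d"
      using mult_right_mono[of "\<delta> x" "c/2" "norm d"] that(2) by (simp add: algebra_simps)
    finally have "c / 2 * norm d \<le> \<eta> x + \<delta> x * norm (z x\<^sub>0)" by (simp add: algebra_simps)
    then show ?thesis using c(1) by (simp add: d_def field_simps)
  qed
  have "((\<lambda>x. 2 / c * (\<eta> x + \<delta> x * norm (z x\<^sub>0))) \<longlongrightarrow> 2 / c * (0 + 0 * norm (z x\<^sub>0))) (at x\<^sub>0)"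
    by (intro tendsto_intros d0 e0)
  then have lim: "((\<lambda>x. 2 / c * (\<eta> x + \<delta> x * norm (z x\<^sub>0))) \<longlongrightarrow> 0) (at x\<^sub>0)" by simp
  have "eventually (\<lambda>x. \<delta> x < c / 2) (at x\<^sub>0)"
    using order_tendstoD(2)[OF d0, of "c / 2"] c(1) by simp
  moreover have "eventually (\<lambda>x. x \<in> U) (at x\<^sub>0)"
    using assms(1,2) by (simp add: eventually_at_topological) blast
  ultimately have ev: "eventually (\<lambda>x. norm (z x - z x\<^sub>0) \<le> 2 / c * (\<eta> x + \<delta> x * norm (z x\<^sub>0))) (at x\<^sub>0)"
    by eventually_elim (rule bound)
  have "((\<lambda>x. z x - z x\<^sub>0) \<longlongrightarrow> 0) (at x\<^sub>0)"
    by (rule Lim_null_comparison[OF ev lim])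
  then show ?thesis unfolding isCont_def by (simp add: LIM_zero_iff)
qed

lemma representation_continuous_on:
  fixes g :: "'m::t2_space \<Rightarrow> 'e::euclidean_space \<Rightarrow> 'e \<Rightarrow> real"
  assumes "open U" "\<And>x. x \<in> U \<Longrightarrow> inner_form (g x)" "\<And>x. x \<in> U \<Longrightarrow> linear (\<phi> x)"
    and "\<And>v w. continuous_on U (\<lambda>x. g x v w)" "\<And>w. continuous_on U (\<lambda>x. \<phi> x w)"
    and "\<And>x w. x \<in> U \<Longrightarrow> g x (z x) w = \<phi> x w"
  shows "continuous_on U z"
proof (rule continuous_at_imp_continuous_on, rule ballI)
  fix x assume "x \<in> U"
  with assms show "isCont z x"
    by (intro representation_continuous_at[of U x g \<phi>]) (auto simp: continuous_on_eq_continuous_at)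
qed

text \<open>The product rule for a factor \<open>s\<close> that is merely continuous: since
  \<open>r\<close> vanishes at \<open>x\<close>, the increment of \<open>s\<close> contributes only
  to second order. In the next lemma \<open>s\<close> is a coordinate of the representing vector, so
  far known only to be continuous.\<close>

lemma has_derivative_mult_vanishing:
  fixes s :: "'m::real_normed_vector \<Rightarrow> real" and r :: "'m \<Rightarrow> 'f::real_normed_vector"
  assumes "isCont s x" "(r has_derivative r') (at x)" "r x = 0"
  shows "((\<lambda>y. s y *\<^sub>R r y) has_derivative (\<lambda>h. s x *\<^sub>R r' h)) (at x)"
proof -
  from has_derivative_bounded_linear[OF assms(2)] interpret r': bounded_linear r' .
  obtain K where K: "\<And>h. norm (r' h) \<le> norm h * K" using r'.bounded by blast
  have lim: "((\<lambda>h. norm (r (x + h) - r' h) / norm h) \<longlongrightarrow> 0) (at 0)"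
    using assms(2,3) by (simp add: has_derivative_at)
  have s: "((\<lambda>h. s (x + h)) \<longlongrightarrow> s x) (at 0)"
    using assms(1) by (simp add: isCont_iff)
  have "((\<lambda>h. \<bar>s (x + h)\<bar> * (norm (r (x + h) - r' h) / norm h) + \<bar>s (x + h) - s x\<bar> * K)
      \<longlongrightarrow> \<bar>s x\<bar> * 0 + \<bar>s x - s x\<bar> * K) (at 0)"
    by (intro tendsto_intros lim s)
  then have null: "((\<lambda>h. \<bar>s (x + h)\<bar> * (norm (r (x + h) - r' h) / norm h) + \<bar>s (x + h) - s x\<bar> * K)
      \<longlongrightarrow> 0) (at 0)" by simp
  have "norm (s (x + h) *\<^sub>R r (x + h) - s x *\<^sub>R r' h) / norm h
      \<le> \<bar>s (x + h)\<bar> * (norm (r (x + h) - r' h) / norm h) + \<bar>s (x + h) - s x\<bar> * K"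
    if "h \<noteq> 0" for h
  proof -
    have "s (x + h) *\<^sub>R r (x + h) - s x *\<^sub>R r' h
        = s (x + h) *\<^sub>R (r (x + h) - r' h) + (s (x + h) - s x) *\<^sub>R r' h"
      by (simp add: algebra_simps)
    also have "norm \<dots> \<le> \<bar>s (x + h)\<bar> * norm (r (x + h) - r' h) + \<bar>s (x + h) - s x\<bar> * (norm h * K)"
      by (rule order.trans[OF norm_triangle_ineq]) (simp add: K mult_left_mono)
    finally show ?thesis using that by (simp add: field_simps)
  qed
  then have ev: "eventually (\<lambda>h. norm (norm (s (x + h) *\<^sub>R r (x + h) - s x *\<^sub>R r' h) / norm h)
      \<le> \<bar>s (x + h)\<bar> * (norm (r (x + h) - r' h) / norm h) + \<bar>s (x + h) - s x\<bar> * K) (at 0)"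
    by (intro eventually_at_filter[THEN iffD2] always_eventually) simp
  show ?thesis
    using Lim_null_comparison[OF ev null] assms(3)
    by (simp add: has_derivative_at r'.bounded_linear_axioms bounded_linear_scaleR_const
        bounded_linear_const_scaleR)
qed

text \<open>Subtracting the equation at \<open>x\<^sub>0\<close> expresses the increment of
  \<open>z\<close> through the increment of the functional and products of coordinates of
  \<open>z\<close> with metric increments. The latter vanish at \<open>x\<^sub>0\<close>, so
  continuity of \<open>z\<close> already makes these products differentiable.\<close>

lemma representation_differentiable:
  fixes g :: "'m::real_normed_vector \<Rightarrow> 'e::euclidean_space \<Rightarrow> 'e \<Rightarrow> real"
  assumes "open U" "x\<^sub>0 \<in> U" "\<And>x. x \<in> U \<Longrightarrow> inner_form (g x)" "\<And>x. x \<in> U \<Longrightarrow> linear (\<phi> x)"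
    and g: "\<And>v w. (\<lambda>x. g x v w) differentiable (at x\<^sub>0)"
    and \<phi>: "\<And>w. (\<lambda>x. \<phi> x w) differentiable (at x\<^sub>0)"
    and z: "\<And>x w. x \<in> U \<Longrightarrow> g x (z x) w = \<phi> x w"
  shows "z differentiable (at x\<^sub>0)"
proof -
  note b = inner_formD(1)[OF assms(3)]
  \<comment> \<open>The \<open>g x\<^sub>0\<close>-dual of \<open>b\<close>. Testing against it
    recovers the \<open>b\<close>-coordinate of a vector.\<close>
  define K where "K b = (THE z. \<forall>w. g x\<^sub>0 z w = b \<bullet> w)" for b
  have "linear (\<lambda>w. b \<bullet> w)" for b :: 'e by (simp add: bounded_linear.linear bounded_linear_inner_right)
  then have K: "g x\<^sub>0 (K b) w = b \<bullet> w" for b w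
    unfolding K_def using inner_form_THE[OF assms(3)[OF assms(2)]] by simp
  have zc: "isCont z x\<^sub>0"
    by (rule representation_continuous_at[OF assms(1-4)])
      (use g \<phi> z in \<open>auto intro: differentiable_imp_continuous_within\<close>)
  \<comment> \<open>This right-hand side turns out to be
    \<open>g x\<^sub>0 (z x - z x\<^sub>0) w\<close>, now written in terms whose differentiability
    is accessible.\<close>
  define q where "q x w = \<phi> x w - \<phi> x\<^sub>0 w - (\<Sum>b\<in>Basis. (z x \<bullet> b) *\<^sub>R (g x b w - g x\<^sub>0 b w))" for x w
  have q: "(\<lambda>x. q x w) differentiable (at x\<^sub>0)" for w
  proof -
    have "(\<lambda>x. (z x \<bullet> b) *\<^sub>R (g x b w - g x\<^sub>0 b w)) differentiable (at x\<^sub>0)" for b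
    proof (rule differentiableI[OF has_derivative_mult_vanishing])
      show "isCont (\<lambda>x. z x \<bullet> b) x\<^sub>0" using zc by (intro continuous_intros)
      show "((\<lambda>x. g x b w - g x\<^sub>0 b w) has_derivative (\<lambda>h. dd (\<lambda>x. g x b w) x\<^sub>0 h - 0)) (at x\<^sub>0)"
        by (intro has_derivative_diff dd_has_derivative g has_derivative_const)
    qed simp
    then show ?thesis unfolding q_def using \<phi>
      by (intro differentiable_diff differentiable_sum differentiable_const) auto
  qed
  have q_eq: "g x\<^sub>0 (z x - z x\<^sub>0) w = q x w" if "x \<in> U" for x w
  proof -
    have "(\<Sum>b\<in>Basis. (z x \<bullet> b) *\<^sub>R (g x b w - g x\<^sub>0 b w)) = g x (z x) w - g x\<^sub>0 (z x) w"
      using linear_sum_Basis[OF bilinear_linear_left[OF b[OF that]], of "z x" w]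
        linear_sum_Basis[OF bilinear_linear_left[OF b[OF assms(2)]], of "z x" w]
      by (simp add: right_diff_distrib sum_subtractf)
    then show ?thesis
      by (simp add: q_def bilinear_simps[OF b[OF assms(2)]] z[OF that] z[OF assms(2)])
  qed
  have "z x = z x\<^sub>0 + (\<Sum>b\<in>Basis. q x (K b) *\<^sub>R b)" if "x \<in> U" for x
  proof -
    have "q x (K b) = (z x - z x\<^sub>0) \<bullet> b" for b
      using K[of b "z x - z x\<^sub>0"] q_eq[OF that, of "K b"] inner_formD(2)[OF assms(3)[OF assms(2)]]
      by (simp add: inner_commute)
    then show ?thesis by (simp add: euclidean_representation)
  qed
  moreover have "(\<lambda>x. z x\<^sub>0 + (\<Sum>b\<in>Basis. q x (K b) *\<^sub>R b)) differentiable (at x\<^sub>0)"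
    using q by (intro differentiable_add differentiable_sum differentiable_scaleR differentiable_const) auto
  ultimately show ?thesis
    by (intro differentiable_cong_open[OF assms(1,2), of "\<lambda>x. z x\<^sub>0 + (\<Sum>b\<in>Basis. q x (K b) *\<^sub>R b)" z]) auto
qed

section \<open>The Levi-Civita connection and its curvature in a chart\<close>

lemma linear_dd_family:
  fixes L :: "'m::real_normed_vector \<Rightarrow> 'e::real_vector \<Rightarrow> 'f::real_normed_vector"
  assumes "open U" "x \<in> U" "\<And>y. y \<in> U \<Longrightarrow> linear (L y)" "\<And>v. (\<lambda>y. L y v) differentiable (at x)"
  shows "linear (\<lambda>v. dd (\<lambda>y. L y v) x u)"
proof (rule linearI)
  fix v w :: 'e and c :: real
  have "dd (\<lambda>y. L y (v + w)) x = dd (\<lambda>y. L y v + L y w) x"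
    by (rule dd_cong[OF assms(1,2)]) (simp add: linear_add assms(3))
  also have "\<dots> = (\<lambda>u. dd (\<lambda>y. L y v) x u + dd (\<lambda>y. L y w) x u)"
    by (rule dd_eqI) (intro has_derivative_add dd_has_derivative assms)
  finally show "dd (\<lambda>y. L y (v + w)) x u = dd (\<lambda>y. L y v) x u + dd (\<lambda>y. L y w) x u" by simp
  have "dd (\<lambda>y. L y (c *\<^sub>R v)) x = dd (\<lambda>y. c *\<^sub>R L y v) x"
    by (rule dd_cong[OF assms(1,2)]) (simp add: linear_scale assms(3))
  also have "\<dots> = (\<lambda>u. c *\<^sub>R dd (\<lambda>y. L y v) x u)"
    by (rule dd_eqI) (intro has_derivative_scaleR_right dd_has_derivative assms)
  finally show "dd (\<lambda>y. L y (c *\<^sub>R v)) x u = c *\<^sub>R dd (\<lambda>y. L y v) x u" by simp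
qed

text \<open>The equality case of the Cauchy-Schwarz inequality:
  \<open>B v v *\<^sub>R u - B u v *\<^sub>R v\<close> has squared length \<open>B v v\<close> times
  the Gram determinant, so a vanishing determinant would make \<open>u\<close> a multiple of
  \<open>v\<close>.\<close>

lemma gram_nonzero:
  assumes B: "inner_form B" and uv: "u \<noteq> v" "independent {u, v}"
  shows "B u u * B v v - (B u v)\<^sup>2 \<noteq> 0"
proof
  note b = bilinear_simps[OF inner_formD(1)[OF B]]
  assume 0: "B u u * B v v - (B u v)\<^sup>2 = 0"
  have "B (B v v *\<^sub>R u - B u v *\<^sub>R v) (B v v *\<^sub>R u - B u v *\<^sub>R v)
    = B v v * (B u u * B v v - (B u v)\<^sup>2)"
    by (simp add: b algebra_simps power2_eq_square inner_formD(2)[OF B, of v u])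
  then have "B v v *\<^sub>R u - B u v *\<^sub>R v = 0"
    using 0 inner_formD(5)[OF B] by simp
  moreover have "v \<noteq> 0" using uv by (auto simp: independent_insert dependent_single)
  then have "B v v \<noteq> 0" using inner_formD(5)[OF B, of v] by simp
  ultimately have "u = inverse (B v v) *\<^sub>R (B u v *\<^sub>R v)"
    by (metis eq_iff_diff_eq_0 left_inverse scaleR_one scaleR_scaleR)
  then have "u = (inverse (B v v) * B u v) *\<^sub>R v" by simp
  then have "u \<in> span {v}" by (metis span_base span_scale insertI1)
  then show False using uv by (simp add: independent_insert)
qed

locale metric_chart =
  fixes U :: "'e::euclidean_space set" and g :: "'e metric_tensor"
  assumes open_U: "open U" and metric: "riemannian_metric_on U g"
begin

lemma form: "x \<in> U \<Longrightarrow> inner_form (g x)"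
  using metric by (auto simp: riemannian_metric_on_def inner_form_def)

lemma smooth: "smooth_on U (\<lambda>x. g x u v)"
  using metric by (auto simp: riemannian_metric_on_def)

lemma bil: "x \<in> U \<Longrightarrow> bilinear (g x)"
  and sym: "x \<in> U \<Longrightarrow> g x u v = g x v u"
  using form inner_formD by blast+

lemma differentiable: "x \<in> U \<Longrightarrow> (\<lambda>y. g y u v) differentiable (at x)"
  using smooth smooth_onD by blast

lemma dd_differentiable: "x \<in> U \<Longrightarrow> (\<lambda>y. dd (\<lambda>z. g z u v) y w) differentiable (at x)"
  by (rule smooth_onD(2)[OF smooth_onD(3)[OF smooth]])

lemma dd_sym: "x \<in> U \<Longrightarrow> dd (\<lambda>y. g y u v) x = dd (\<lambda>y. g y v u) x"
  by (rule dd_cong[OF open_U]) (auto intro: sym)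

lemma dd_linear_right: "x \<in> U \<Longrightarrow> linear (\<lambda>w. dd (\<lambda>y. g y v w) x u)"
  by (rule linear_dd_family[OF open_U]) (auto intro: bilinear_linear_right bil differentiable)

lemma dd_linear_left: "x \<in> U \<Longrightarrow> linear (\<lambda>w. dd (\<lambda>y. g y w v) x u)"
  by (rule linear_dd_family[OF open_U, of _ "\<lambda>y w. g y w v"])
    (auto intro: bilinear_linear_left bil differentiable)

lemma dd_linear_dir: "x \<in> U \<Longrightarrow> linear (dd (\<lambda>y. g y v w) x)"
  by (rule dd_linear[OF differentiable])

abbreviation koszul :: "'e \<Rightarrow> 'e \<Rightarrow> 'e \<Rightarrow> 'e \<Rightarrow> real" where
  "koszul x u v w \<equiv> (dd (\<lambda>y. g y v w) x u + dd (\<lambda>y. g y u w) x v - dd (\<lambda>y. g y u v) x w) / 2"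

lemma koszul_linear:
  assumes "x \<in> U"
  shows "linear (koszul x u v)"
  using linear_add[OF dd_linear_right[OF assms]] linear_scale[OF dd_linear_right[OF assms]]
    linear_add[OF dd_linear_dir[OF assms]] linear_scale[OF dd_linear_dir[OF assms]]
  by (intro linearI) (simp_all add: field_simps)

lemma christoffel_koszul: "x \<in> U \<Longrightarrow> g x (christoffel g x u v) w = koszul x u v w"
  unfolding christoffel_def by (rule inner_form_THE[OF form koszul_linear])

lemma christoffel_eqI:
  assumes "x \<in> U" "\<And>w. g x z w = koszul x u v w"
  shows "christoffel g x u v = z"
  by (rule inner_form_eqI[OF form[OF assms(1)]]) (simp add: assms christoffel_koszul)

lemma christoffel_sym: "x \<in> U \<Longrightarrow> christoffel g x u v = christoffel g x v u"
  by (rule christoffel_eqI) (simp_all add: christoffel_koszul dd_sym[of x u v])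

lemma christoffel_linear:
  assumes "x \<in> U"
  shows "linear (\<lambda>u. christoffel g x u v)"
proof (rule linearI)
  note lin = linear_add[OF dd_linear_dir[OF assms]] linear_scale[OF dd_linear_dir[OF assms]]
    linear_add[OF dd_linear_left[OF assms]] linear_scale[OF dd_linear_left[OF assms]]
  fix u u' :: 'e and c :: real
  show "christoffel g x (u + u') v = christoffel g x u v + christoffel g x u' v"
    by (rule christoffel_eqI[OF assms])
      (simp add: bilinear_simps[OF bil[OF assms]] christoffel_koszul assms lin field_simps)
  show "christoffel g x (c *\<^sub>R u) v = c *\<^sub>R christoffel g x u v"
    by (rule christoffel_eqI[OF assms])
      (simp add: bilinear_simps[OF bil[OF assms]] christoffel_koszul assms lin field_simps)
qed

lemma christoffel_bilinear:
  assumes "x \<in> U"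
  shows "bilinear (christoffel g x)"
proof -
  have "christoffel g x u = (\<lambda>v. christoffel g x v u)" for u
    using christoffel_sym[OF assms] by auto
  then show ?thesis
    unfolding bilinear_def using christoffel_linear[OF assms] by metis
qed

lemma christoffel_differentiable:
  assumes "x \<in> U"
  shows "(\<lambda>y. christoffel g y u v) differentiable (at x)"
proof (rule representation_differentiable[OF open_U assms form])
  show "linear (koszul y u v)" if "y \<in> U" for y by (rule koszul_linear[OF that])
  show "(\<lambda>x. koszul x u v w) differentiable (at x)" for w
    by (intro differentiable_divide differentiable_diff differentiable_add dd_differentiable assms
        differentiable_const) simp
  show "g y (christoffel g y u v) w = koszul y u v w" if "y \<in> U" for y w
    by (rule christoffel_koszul[OF that])
qed (auto intro: differentiable[OF assms])

lemma christoffel_continuous: "continuous_on U (\<lambda>y. christoffel g y u v)"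
  by (intro continuous_at_imp_continuous_on ballI differentiable_imp_continuous_within
      christoffel_differentiable)

lemma metric_compat:
  assumes "x \<in> U"
  shows "dd (\<lambda>y. g y v w) x u = g x (christoffel g x u v) w + g x v (christoffel g x u w)"
  using dd_sym[OF assms, of v w] dd_sym[OF assms, of u v] dd_sym[OF assms, of u w]
  by (simp add: christoffel_koszul assms sym[OF assms, of v] field_simps)

lemma curvature_eq: "curvature g x u v w = dd (\<lambda>y. christoffel g y v w) x u
    + christoffel g x u (christoffel g x v w)
    - (dd (\<lambda>y. christoffel g y u w) x v + christoffel g x v (christoffel g x u w))"
  by (simp add: curvature_def cov_along_def)

lemma curvature_swap: "curvature g x u v w = - curvature g x v u w"
  by (simp add: curvature_eq)

lemma curvature_linear:
  assumes "x \<in> U"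
  shows "linear (\<lambda>u. curvature g x u v w)" "linear (\<lambda>v. curvature g x u v w)"
    "linear (curvature g x u v)"
proof -
  have d: "linear (\<lambda>u. dd (\<lambda>y. christoffel g y u w) x v)"
      "linear (\<lambda>w. dd (\<lambda>y. christoffel g y u w) x v)"
      "linear (dd (\<lambda>y. christoffel g y v w) x)" for u v w
  proof -
    show "linear (\<lambda>u. dd (\<lambda>y. christoffel g y u w) x v)"
      by (rule linear_dd_family[OF open_U assms, of "\<lambda>y u. christoffel g y u w"])
        (auto intro: christoffel_linear christoffel_differentiable[OF assms])
    show "linear (\<lambda>w. dd (\<lambda>y. christoffel g y u w) x v)"
      by (rule linear_dd_family[OF open_U assms, of "\<lambda>y w. christoffel g y u w"])
        (auto intro: bilinear_linear_right christoffel_bilinear christoffel_differentiable[OF assms])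
  qed (rule dd_linear[OF christoffel_differentiable[OF assms]])
  note simps = bilinear_simps[OF christoffel_bilinear[OF assms]]
    linear_add[OF d(1)] linear_scale[OF d(1)] linear_add[OF d(2)] linear_scale[OF d(2)]
    linear_add[OF d(3)] linear_scale[OF d(3)]
  show "linear (\<lambda>u. curvature g x u v w)" "linear (\<lambda>v. curvature g x u v w)"
    "linear (curvature g x u v)"
    by (rule linearI; simp add: curvature_eq simps algebra_simps)+
qed

lemma curvature_bianchi:
  assumes "x \<in> U"
  shows "curvature g x u v w + curvature g x v w u + curvature g x w u v = 0"
proof -
  have "dd (\<lambda>y. christoffel g y u v) x = dd (\<lambda>y. christoffel g y v u) x" for u v
    by (rule dd_cong[OF open_U assms]) (rule christoffel_sym)
  from this[of v u] this[of w u] this[of w v] show ?thesis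
    unfolding curvature_eq
    by (simp add: christoffel_sym[OF assms, of v u] christoffel_sym[OF assms, of w u]
        christoffel_sym[OF assms, of w v])
qed

text \<open>Apply metric compatibility twice to the function \<open>g y w z\<close> and
  antisymmetrize in the two directions. Second derivatives are symmetric and the products of
  first-order terms cancel, so the two curvature terms must add up to zero.\<close>

lemma curvature_skew:
  assumes "x \<in> U"
  shows "g x (curvature g x u v w) z = - g x (curvature g x u v z) w"
proof -
  have second: "dd (\<lambda>y. dd (\<lambda>y. g y w z) y v) x u
    = g x (dd (\<lambda>y. christoffel g y v w) x u + christoffel g x u (christoffel g x v w)) z
      + g x (christoffel g x v w) (christoffel g x u z)
      + g x (dd (\<lambda>y. christoffel g y v z) x u + christoffel g x u (christoffel g x v z)) w
      + g x (christoffel g x v z) (christoffel g x u w)" for u v w z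
  proof -
    have 1: "dd (\<lambda>y. g y (christoffel g y v w) z) x u
      = dd (\<lambda>y. g y (christoffel g x v w) z) x u + g x (dd (\<lambda>y. christoffel g y v w) x u) z" for w z
    proof (rule fun_cong[OF dd_eqI])
      show "((\<lambda>y. g y (christoffel g y v w) z) has_derivative (\<lambda>u.
          dd (\<lambda>y. g y (christoffel g x v w) z) x u + g x (dd (\<lambda>y. christoffel g y v w) x u) z)) (at x)"
        by (rule has_derivative_linear_apply[OF open_U assms, of "\<lambda>y a. g y a z"])
          (auto intro: bilinear_linear_left bil differentiable assms christoffel_differentiable)
    qed
    have d: "(\<lambda>y. g y (christoffel g y v w) z) differentiable (at x)" for w z
      by (rule differentiableI, rule has_derivative_linear_apply[OF open_U assms, of "\<lambda>y a. g y a z"])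
          (auto intro: bilinear_linear_left bil differentiable assms christoffel_differentiable)
    have 2: "dd (\<lambda>y. dd (\<lambda>y. g y w z) y v) x
      = dd (\<lambda>y. g y (christoffel g y v w) z + g y (christoffel g y v z) w) x"
      by (rule dd_cong[OF open_U assms]) (simp add: metric_compat sym)
    have 3: "dd (\<lambda>y. g y (christoffel g y v w) z + g y (christoffel g y v z) w) x u
        = dd (\<lambda>y. g y (christoffel g y v w) z) x u + dd (\<lambda>y. g y (christoffel g y v z) w) x u"
      by (rule fun_cong[OF dd_eqI]) (intro has_derivative_add dd_has_derivative d)
    show ?thesis unfolding 2 3
      by (simp add: 1 metric_compat[OF assms] bilinear_simps[OF bil[OF assms]])
  qed
  have "dd (\<lambda>y. dd (\<lambda>y. g y w z) y v) x u = dd (\<lambda>y. dd (\<lambda>y. g y w z) y u) x v"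
    by (rule symmetric_second_derivative[OF open_U assms smooth])
  then show ?thesis
    unfolding second curvature_eq
    by (simp add: bilinear_simps[OF bil[OF assms]] sym[OF assms, of "christoffel g x u _" "christoffel g x v _"])
qed

end

section \<open>From sectional curvature to the full curvature tensor\<close>

text \<open>Polarizing the sectional values makes \<open>S\<close> alternating in its first three
  arguments; the cyclic sum in the Bianchi identity is then three times \<open>S\<close>.\<close>

lemma curvature_like_zero:
  fixes S :: "'e::real_vector \<Rightarrow> 'e \<Rightarrow> 'e \<Rightarrow> 'e \<Rightarrow> real"
  assumes add2: "\<And>u v v' w z. S u (v + v') w z = S u v w z + S u v' w z"
    and add3: "\<And>u v w w' z. S u v (w + w') z = S u v w z + S u v w' z"
    and s12: "\<And>u v w z. S u v w z = - S v u w z"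
    and s34: "\<And>u v w z. S u v w z = - S u v z w"
    and bianchi: "\<And>u v w z. S u v w z + S v w u z + S w u v z = 0"
    and sec: "\<And>u v. S u v v u = 0"
  shows "S u v w z = 0"
proof -
  \<comment> \<open>Symmetry between the two pairs, from four instances of the Bianchi identity and
    the two skew symmetries.\<close>
  have pair: "S u v w z = S w z u v" for u v w z
    using bianchi[of u v w z] bianchi[of v w z u] bianchi[of w z u v] bianchi[of z u v w]
      s12[of u v w z] s12[of u v z w] s12[of v w] s12[of w z u v] s12[of z u] s12[of u w] s12[of v z]
      s34[of u v w z] s34[of v w u z] s34[of w u v z] s34[of v w z u] s34[of w z v u] s34[of z v w u]
      s34[of w z u v] s34[of z u w v] s34[of u w z v] s34[of z u v w] s34[of u v z w] s34[of v z u w]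
    by (smt (verit) s12 s34)
  \<comment> \<open>Polarization in the repeated middle argument; pair symmetry makes the two mixed
    terms equal.\<close>
  have a: "S u v w u = 0" for u v w
  proof -
    have "S u v w u + S u w v u = 0"
      using sec[of u "v + w"] sec[of u v] sec[of u w] add2 add3 by simp
    moreover have "S u w v u = S u v w u"
      using pair[of u w v u] s12[of v u u w] s34[of u v u w] by simp
    ultimately show ?thesis by simp
  qed
  have add1: "S (u + u') v w z = S u v w z + S u' v w z" for u u' v w z
    using s12[of "u + u'" v w z] s12[of u v w z] s12[of u' v w z] add2[of v u u' w z] by simp
  have add4: "S u v w (z + z') = S u v w z + S u v w z'" for u v w z z'
    using s34[of u v w "z + z'"] s34[of u v w z] s34[of u v w z'] add3[of u v z z' w] by simp
  \<comment> \<open>Polarization in the repeated outer argument.\<close>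
  have b: "S u v w z = - S z v w u" for u v w z
    using a[of "u + z" v w] a[of u v w] a[of z v w] add1 add4 by simp
  have c: "S u v w z = - S u w v z" for u v w z
    using b[of u v w z] pair[of z v w u] s12[of w u z v] s34[of u w z v] by simp
  show ?thesis
    using bianchi[of u v w z] c[of v w u z] s12[of v u w z] c[of w u v z] s12[of w v u z] c[of v u w z]
      c[of u v w z] s12[of w u v z] by simp
qed

context metric_chart
begin

lemma constant_sectional_curvature:
  assumes x: "x \<in> U" and sec: "\<And>u v. u \<noteq> v \<Longrightarrow> independent {u, v} \<Longrightarrow> sectional g x u v = k"
  shows "curvature g x u v w = k *\<^sub>R (g x v w *\<^sub>R u - g x u w *\<^sub>R v)"
proof (rule inner_form_eqI[OF form[OF x]])
  fix z
  note b = bilinear_simps[OF bil[OF x]]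
  \<comment> \<open>The deviation of the curvature from the constant curvature model, which has the
    same algebraic symmetries.\<close>
  define S where "S u v w z = g x (curvature g x u v w) z - k * (g x v w * g x u z - g x u w * g x v z)"
    for u v w z
  have "S u v w z = 0"
  proof (rule curvature_like_zero[of S])
    fix u v v' w w' z
    show "S u (v + v') w z = S u v w z + S u v' w z" "S u v (w + w') z = S u v w z + S u v w' z"
      by (simp_all add: S_def b algebra_simps linear_add[OF curvature_linear(2)[OF x]]
          linear_add[OF curvature_linear(3)[OF x]])
    show "S u v w z = - S v u w z"
      using curvature_swap[of x u v w] by (simp add: S_def b algebra_simps)
    show "S u v w z = - S u v z w"
      using curvature_skew[OF x, of u v w z] by (simp add: S_def algebra_simps)
    have "g x (curvature g x u v w) z + g x (curvature g x v w u) z + g x (curvature g x w u v) z = 0"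
      using arg_cong[OF curvature_bianchi[OF x, of u v w], of "\<lambda>a. g x a z"] by (simp add: b)
    then show "S u v w z + S v w u z + S w u v z = 0"
      by (simp add: S_def algebra_simps sym[OF x, of v u] sym[OF x, of w u] sym[OF x, of w v])
    show "S u v v u = 0"
    \<comment> \<open>The hypothesis covers independent pairs. For dependent ones the curvature and
      the model expression vanish separately, by antisymmetry or because \<open>v\<close> is
      zero.\<close>
    proof (cases "u \<noteq> v \<and> independent {u, v}")
      case True
      from gram_nonzero[OF form[OF x], of u v] True
      have "g x u u * g x v v - (g x u v)\<^sup>2 \<noteq> 0" by blast
      then show ?thesis
        using sec[of u v] True by (simp add: sectional_def S_def field_simps power2_eq_square sym[OF x, of v u])
    next
      case False
      then have "u = v \<or> u \<in> span {v} \<or> v = 0"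
        by (auto simp: independent_insert split: if_splits)
      moreover have "u = 1 *\<^sub>R v" if "u = v" using that by simp
      ultimately consider c where "u = c *\<^sub>R v" | "v = 0"
        unfolding span_singleton by blast
      then show ?thesis
      proof cases
        case 1
        have "curvature g x v v v = 0" by (simp add: curvature_eq)
        then show ?thesis
          by (simp add: 1 S_def b linear_scale[OF curvature_linear(1)[OF x]])
      next
        case 2
        then show ?thesis
          by (simp add: S_def b linear_0[OF curvature_linear(3)[OF x]])
      qed
    qed
  qed
  then show "g x (curvature g x u v w) z = g x (k *\<^sub>R (g x v w *\<^sub>R u - g x u w *\<^sub>R v)) z"
    by (simp add: S_def b)
qed

end

section \<open>The second fundamental form of an isometric map\<close>

text \<open>The Hessian of the map \<open>F\<close>, that is, the covariant derivative of its
  differential. It mentions no normal vector and makes sense for every map between charts, so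
  immersions and chart transitions are treated alike.\<close>

definition second_form ::
  "'e::euclidean_space metric_tensor \<Rightarrow> 'h::euclidean_space metric_tensor \<Rightarrow> ('e \<Rightarrow> 'h)
     \<Rightarrow> 'e \<Rightarrow> 'e \<Rightarrow> 'e \<Rightarrow> 'h" where
  "second_form g G F x u v = dd (\<lambda>y. dd F y v) x u
     + christoffel G (F x) (dd F x u) (dd F x v) - dd F x (christoffel g x u v)"

lemma second_form_cong:
  assumes "open U" "x \<in> U" "\<And>y. y \<in> U \<Longrightarrow> F y = F' y"
  shows "second_form g G F x = second_form g G F' x"
proof -
  have "dd F y = dd F' y" if "y \<in> U" for y using dd_cong[OF assms(1) that] assms(3) by blast
  then show ?thesis
    unfolding second_form_def using dd_cong[OF assms(1,2), of "\<lambda>y. dd F y _" "\<lambda>y. dd F' y _"] assms(2,3)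
    by (intro ext) simp
qed

text \<open>The chain rule for Hessians; the Christoffel terms of the intermediate metric
  \<open>G\<close> cancel. Together with the vanishing Hessian of local isometries it yields
  independence of the charts.\<close>

lemma second_form_compose:
  fixes F :: "'e::euclidean_space \<Rightarrow> 'h::euclidean_space" and T :: "'h \<Rightarrow> 'k::euclidean_space"
  assumes U: "open U" "x \<in> U" "smooth_on U F" and V: "\<And>y. y \<in> U \<Longrightarrow> F y \<in> V" "smooth_on V T"
  shows "second_form g K (\<lambda>y. T (F y)) x u v
    = second_form G K T (F x) (dd F x u) (dd F x v) + dd T (F x) (second_form g G F x u v)"
proof -
  note Fd = smooth_onD(2)[OF U(3)] and Td = smooth_onD(2)[OF V(2) V(1)]
  note Fd' = smooth_onD(2)[OF smooth_onD(3)[OF U(3)]]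
    and Td' = smooth_onD(2)[OF smooth_onD(3)[OF V(2)] V(1)]
  have 1: "dd (\<lambda>y. T (F y)) y v = dd T (F y) (dd F y v)" if "y \<in> U" for y v
    by (rule dd_compose) (use that Fd Td in auto)
  have "dd (\<lambda>y. dd (\<lambda>y. T (F y)) y v) x u = dd (\<lambda>y. dd T (F y) (dd F y v)) x u"
    by (rule fun_cong[OF dd_cong[OF U(1,2)]]) (rule 1)
  also have "((\<lambda>y. dd T (F y) (dd F y v)) has_derivative (\<lambda>u. dd (\<lambda>y. dd T (F y) (dd F x v)) x u
      + dd T (F x) (dd (\<lambda>y. dd F y v) x u))) (at x)"
    by (rule has_derivative_linear_apply[OF U(1,2)])
      (use U(2) Td Fd' in \<open>auto intro!: dd_linear differentiable_compose_at[of "\<lambda>z. dd T z _"] Fd Td'\<close>)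
  note dd_eqI[OF this]
  also have "dd (\<lambda>y. dd T (F y) (dd F x v)) x u = dd (\<lambda>z. dd T z (dd F x v)) (F x) (dd F x u)"
    by (rule dd_compose[of "\<lambda>z. dd T z (dd F x v)"]) (use U(2) Fd Td' in auto)
  finally have 2: "dd (\<lambda>y. dd (\<lambda>y. T (F y)) y v) x u
    = dd (\<lambda>z. dd T z (dd F x v)) (F x) (dd F x u) + dd T (F x) (dd (\<lambda>y. dd F y v) x u)" .
  have lin: "linear (dd T (F x))" using Td U(2) by (simp add: dd_linear)
  show ?thesis
    unfolding second_form_def 2
    by (simp add: 1[OF U(2)] linear_add[OF lin] linear_diff[OF lin])
qed

lemma (in metric_chart) dd_metric_field:
  assumes "x \<in> U" "Y differentiable (at x)"
  shows "dd (\<lambda>y. g y (Y y) z) x u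
    = g x (dd Y x u + christoffel g x u (Y x)) z + g x (Y x) (christoffel g x u z)"
proof -
  have "dd (\<lambda>y. g y (Y y) z) x = (\<lambda>u. dd (\<lambda>y. g y (Y x) z) x u + g x (dd Y x u) z)"
    by (rule dd_eqI, rule has_derivative_linear_apply[OF open_U assms(1), of "\<lambda>y a. g y a z"])
      (auto intro: bilinear_linear_left bil differentiable assms)
  then show ?thesis
    by (simp add: metric_compat[OF assms(1)] bilinear_simps[OF bil[OF assms(1)]])
qed

text \<open>The dimensions are left open: equal dimensions describe a change of charts, and a target
  larger by one describes the hypersurface.\<close>

locale isometric_map = dom: metric_chart U g + cod: metric_chart V G
  for U :: "'e::euclidean_space set" and g :: "'e metric_tensor"
    and V :: "'h::euclidean_space set" and G :: "'h metric_tensor" +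
  fixes F :: "'e \<Rightarrow> 'h"
  assumes smooth_F: "smooth_on U F" and F_in: "x \<in> U \<Longrightarrow> F x \<in> V"
    and isometric: "x \<in> U \<Longrightarrow> g x u v = G (F x) (dd F x u) (dd F x v)"
begin

abbreviation II :: "'e \<Rightarrow> 'e \<Rightarrow> 'e \<Rightarrow> 'h" where
  "II \<equiv> second_form g G F"

abbreviation cov :: "('e \<Rightarrow> 'h) \<Rightarrow> 'e \<Rightarrow> 'e \<Rightarrow> 'h" where
  "cov \<equiv> cov_along G F"

lemma F_differentiable: "x \<in> U \<Longrightarrow> F differentiable (at x)"
  using smooth_F smooth_onD(2) by blast

lemma dF_smooth: "smooth_on U (\<lambda>y. dd F y v)"
  by (rule smooth_onD(3)[OF smooth_F])

lemma dF_differentiable: "x \<in> U \<Longrightarrow> (\<lambda>y. dd F y v) differentiable (at x)"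
  by (rule smooth_onD(2)[OF dF_smooth])

lemma ddF_differentiable: "x \<in> U \<Longrightarrow> (\<lambda>y. dd (\<lambda>y. dd F y v) y u) differentiable (at x)"
  by (rule smooth_onD(2)[OF smooth_onD(3)[OF dF_smooth]])

lemma dF_linear: "x \<in> U \<Longrightarrow> linear (dd F x)"
  by (rule dd_linear[OF F_differentiable])

lemma dF_inj: "x \<in> U \<Longrightarrow> inj (dd F x)"
  by (rule linear_injective_0[OF dF_linear, THEN iffD2])
    (auto, metis inner_formD(5) dom.form isometric cod.bil F_in bilinear_lzero)

lemma dF_eq_iff: "x \<in> U \<Longrightarrow> dd F x u = dd F x v \<longleftrightarrow> u = v"
  using dF_inj by (auto dest: injD)

lemma has_derivative_along:
  assumes "x \<in> U" "Y differentiable (at x)" "Z differentiable (at x)"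
  shows "((\<lambda>y. G (F y) (Y y) (Z y)) has_derivative
    (\<lambda>u. G (F x) (cov Y x u) (Z x) + G (F x) (Y x) (cov Z x u))) (at x)"
proof -
  have "((\<lambda>y. G (F y) (Y y) (Z y)) has_derivative
    (\<lambda>u. dd (\<lambda>y. G (F y) (Y x) (Z x)) x u + G (F x) (dd Y x u) (Z x) + G (F x) (Y x) (dd Z x u))) (at x)"
    by (rule has_derivative_bilinear_apply[OF dom.open_U assms(1), of "\<lambda>y. G (F y)"])
      (use assms in \<open>auto intro!: cod.bil F_in F_differentiable
        differentiable_compose_at[of "\<lambda>z. G z _ _"] cod.differentiable\<close>)
  moreover have "dd (\<lambda>y. G (F y) (Y x) (Z x)) x u
    = G (F x) (christoffel G (F x) (dd F x u) (Y x)) (Z x)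
      + G (F x) (Y x) (christoffel G (F x) (dd F x u) (Z x))" for u
  proof -
    have "dd (\<lambda>y. G (F y) (Y x) (Z x)) x u = dd (\<lambda>z. G z (Y x) (Z x)) (F x) (dd F x u)"
      by (rule dd_compose[of "\<lambda>z. G z (Y x) (Z x)"])
        (use assms in \<open>auto intro!: cod.differentiable F_in F_differentiable\<close>)
    then show ?thesis by (simp add: cod.metric_compat[OF F_in[OF assms(1)]])
  qed
  ultimately show ?thesis
    by (simp add: cov_along_def bilinear_simps[OF cod.bil[OF F_in[OF assms(1)]]] algebra_simps)
qed

lemmas dd_along = fun_cong[OF dd_eqI[OF has_derivative_along]]

lemma cov_dF: "cov (\<lambda>y. dd F y v) x u = dd F x (christoffel g x u v) + II x u v"
  by (simp add: second_form_def cov_along_def)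

lemma second_form_sym: "x \<in> U \<Longrightarrow> II x u v = II x v u"
  unfolding second_form_def
  using symmetric_second_derivative[OF dom.open_U _ smooth_F, of x v u]
    cod.christoffel_sym[OF F_in, of x "dd F x u" "dd F x v"] dom.christoffel_sym[of x u v] by simp

lemma second_form_bilinear:
  assumes "x \<in> U"
  shows "bilinear (II x)"
proof -
  note b = bilinear_simps[OF cod.christoffel_bilinear[OF F_in[OF assms]]]
    bilinear_simps[OF dom.christoffel_bilinear[OF assms]]
    linear_add[OF dF_linear[OF assms]] linear_scale[OF dF_linear[OF assms]]
    linear_add[OF dd_linear[OF dF_differentiable[OF assms]]]
    linear_scale[OF dd_linear[OF dF_differentiable[OF assms]]]
  have "linear (\<lambda>u. II x u v)" for v
    by (rule linearI) (simp_all add: second_form_def b algebra_simps)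
  moreover have "II x u = (\<lambda>v. II x v u)" for u
    using second_form_sym[OF assms] by auto
  ultimately show ?thesis unfolding bilinear_def by metis
qed

text \<open>The tangential part of the ambient derivative is symmetric in its two fields and
  compatible with the induced metric; the uniqueness argument for the Levi-Civita connection
  identifies it with the intrinsic derivative, and only a normal part remains.\<close>

lemma second_form_normal:
  assumes "x \<in> U"
  shows "G (F x) (II x u v) (dd F x w) = 0"
proof -
  note y = F_in[OF assms]
  define S where "S u v w = G (F x) (cov (\<lambda>y. dd F y v) x u) (dd F x w)" for u v w
  have S: "dd (\<lambda>y. g y v w) x u = S u v w + S u w v" for u v w
  proof -
    have "dd (\<lambda>y. g y v w) x = dd (\<lambda>y. G (F y) (dd F y v) (dd F y w)) x"
      by (rule dd_cong[OF dom.open_U assms]) (rule isometric)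
    then show ?thesis
      by (simp add: dd_along[OF assms dF_differentiable[OF assms] dF_differentiable[OF assms]] S_def
          cod.sym[OF y, of "dd F x v"])
  qed
  have "S u v w = S v u w" for u v w
    unfolding S_def cov_dF using second_form_sym[OF assms, of u v] dom.christoffel_sym[OF assms, of u v]
    by simp
  \<comment> \<open>The three symmetries turn the sum of first derivatives of the metric into
    Koszul's formula.\<close>
  from this[of v u w] this[of w u v] this[of w v u] have "S u v w = dom.koszul x u v w"
    unfolding S by simp
  also have "\<dots> = G (F x) (dd F x (christoffel g x u v)) (dd F x w)"
    using dom.christoffel_koszul[OF assms, of u v w] isometric[OF assms] by simp
  finally show ?thesis
    by (simp add: S_def cov_dF bilinear_simps[OF cod.bil[OF y]])
qed

lemma christoffel_field_differentiable:
  assumes "x \<in> U" "Y differentiable (at x)" "Z differentiable (at x)"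
  shows "((\<lambda>y. christoffel G (F y) (Y y) (Z y)) has_derivative
    (\<lambda>u. dd (\<lambda>z. christoffel G z (Y x) (Z x)) (F x) (dd F x u)
      + christoffel G (F x) (dd Y x u) (Z x) + christoffel G (F x) (Y x) (dd Z x u))) (at x)"
proof -
  have "((\<lambda>y. christoffel G (F y) (Y y) (Z y)) has_derivative
    (\<lambda>u. dd (\<lambda>y. christoffel G (F y) (Y x) (Z x)) x u
      + christoffel G (F x) (dd Y x u) (Z x) + christoffel G (F x) (Y x) (dd Z x u))) (at x)"
    by (rule has_derivative_bilinear_apply[OF dom.open_U assms(1), of "\<lambda>y. christoffel G (F y)"])
      (use assms in \<open>auto intro!: cod.christoffel_bilinear F_in F_differentiable
        differentiable_compose_at[of "\<lambda>z. christoffel G z _ _"] cod.christoffel_differentiable\<close>)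
  moreover have "dd (\<lambda>y. christoffel G (F y) (Y x) (Z x)) x u
      = dd (\<lambda>z. christoffel G z (Y x) (Z x)) (F x) (dd F x u)" for u
    by (rule dd_compose[of "\<lambda>z. christoffel G z (Y x) (Z x)"])
      (use assms in \<open>auto intro!: cod.christoffel_differentiable F_in F_differentiable\<close>)
  ultimately show ?thesis by simp
qed

lemma cov_dF_derivative:
  assumes "x \<in> U"
  shows "((\<lambda>y. cov (\<lambda>y. dd F y w) y v) has_derivative
    (\<lambda>u. dd (\<lambda>y. dd (\<lambda>y. dd F y w) y v) x u
      + (dd (\<lambda>z. christoffel G z (dd F x v) (dd F x w)) (F x) (dd F x u)
        + christoffel G (F x) (dd (\<lambda>y. dd F y v) x u) (dd F x w)
        + christoffel G (F x) (dd F x v) (dd (\<lambda>y. dd F y w) x u)))) (at x)"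
  unfolding cov_along_def
  by (intro has_derivative_add dd_has_derivative ddF_differentiable christoffel_field_differentiable
      dF_differentiable assms)

text \<open>Third derivatives of \<open>F\<close> cancel by symmetry, as do the terms in its second
  derivatives. What survives is the coordinate expression of the target curvature on the image
  vectors.\<close>

lemma curvature_along:
  assumes "x \<in> U"
  shows "cov (\<lambda>y. cov (\<lambda>y. dd F y w) y v) x u - cov (\<lambda>y. cov (\<lambda>y. dd F y w) y u) x v
    = curvature G (F x) (dd F x u) (dd F x v) (dd F x w)"
proof -
  have "dd (\<lambda>y. dd (\<lambda>y. dd F y w) y v) x u = dd (\<lambda>y. dd (\<lambda>y. dd F y w) y u) x v"
    by (rule symmetric_second_derivative[OF dom.open_U assms dF_smooth])
  moreover have "dd (\<lambda>y. dd F y v) x u = dd (\<lambda>y. dd F y u) x v"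
    by (rule symmetric_second_derivative[OF dom.open_U assms smooth_F])
  moreover have "cov (\<lambda>y. cov (\<lambda>y. dd F y w) y v) x u
    = dd (\<lambda>y. dd (\<lambda>y. dd F y w) y v) x u
      + (dd (\<lambda>z. christoffel G z (dd F x v) (dd F x w)) (F x) (dd F x u)
        + christoffel G (F x) (dd (\<lambda>y. dd F y v) x u) (dd F x w)
        + christoffel G (F x) (dd F x v) (dd (\<lambda>y. dd F y w) x u))
      + christoffel G (F x) (dd F x u) (cov (\<lambda>y. dd F y w) x v)" for u v
    by (subst cov_along_def) (simp only: dd_eqI[OF cov_dF_derivative[OF assms]])
  ultimately show ?thesis
    unfolding cod.curvature_eq
    by (simp add: cov_along_def bilinear_simps[OF cod.christoffel_bilinear[OF F_in[OF assms]]])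
qed

text \<open>The tangential component of an ambient derivative is the intrinsic one. Differentiating
  this identity once more and splitting every ambient derivative into tangential and normal parts
  leaves products of second fundamental forms, which antisymmetrization turns into the two extra
  terms.\<close>

lemma gauss:
  assumes "x \<in> U"
  shows "g x (curvature g x u v w) z
    = G (F x) (curvature G (F x) (dd F x u) (dd F x v) (dd F x w)) (dd F x z)
      + G (F x) (II x v w) (II x u z) - G (F x) (II x u w) (II x v z)"
proof -
  note y = F_in[OF assms]
  note b = bilinear_simps[OF cod.bil[OF y]] bilinear_simps[OF dom.bil[OF assms]]
  have normal: "G (F y) (II y u v) (dd F y w) = 0" "G (F y) (dd F y w) (II y u v) = 0"
    if "y \<in> U" for y u v w
    using second_form_normal[OF that] cod.sym[OF F_in[OF that]] by metis+
  \<comment> \<open>One and the same function is differentiated with the ambient and with the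
    intrinsic connection. The tangential products cancel, and the normal ones become the product of
    the two values of \<open>II\<close>.\<close>
  have *: "G (F x) (cov (\<lambda>y. cov (\<lambda>y. dd F y w) y v) x u) (dd F x z)
    = g x (dd (\<lambda>y. christoffel g y v w) x u + christoffel g x u (christoffel g x v w)) z
      - G (F x) (II x v w) (II x u z)" for u v
  proof -
    have "dd (\<lambda>y. G (F y) (cov (\<lambda>y. dd F y w) y v) (dd F y z)) x
        = dd (\<lambda>y. g y (christoffel g y v w) z) x"
    proof (rule dd_cong[OF dom.open_U assms])
      fix y assume "y \<in> U"
      then show "G (F y) (cov (\<lambda>y. dd F y w) y v) (dd F y z) = g y (christoffel g y v w) z"
        by (simp add: cov_dF isometric bilinear_ladd[OF cod.bil[OF F_in]] normal)
    qed
    then have "G (F x) (cov (\<lambda>y. cov (\<lambda>y. dd F y w) y v) x u) (dd F x z)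
        + G (F x) (cov (\<lambda>y. dd F y w) x v) (cov (\<lambda>y. dd F y z) x u)
      = g x (dd (\<lambda>y. christoffel g y v w) x u + christoffel g x u (christoffel g x v w)) z
        + g x (christoffel g x v w) (christoffel g x u z)"
      using dd_along[OF assms differentiableI[OF cov_dF_derivative[OF assms]] dF_differentiable[OF assms], of w v z u]
        dom.dd_metric_field[OF assms dom.christoffel_differentiable[OF assms], of v w z u] by simp
    then show ?thesis
      by (simp add: cov_dF b normal[OF assms] isometric[OF assms] algebra_simps)
  qed
  have "g x (curvature g x u v w) z
    = g x (dd (\<lambda>y. christoffel g y v w) x u + christoffel g x u (christoffel g x v w)) z
     - g x (dd (\<lambda>y. christoffel g y u w) x v + christoffel g x v (christoffel g x u w)) z"
    by (simp add: dom.curvature_eq b)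
  then show ?thesis
    unfolding curvature_along[OF assms, symmetric] using *[of v u] *[of u v] by (simp add: b)
qed

lemma second_form_continuous: "continuous_on U (\<lambda>x. II x u v)"
  unfolding second_form_def
proof (intro continuous_on_add continuous_on_diff)
  show "continuous_on U (\<lambda>x. dd (\<lambda>y. dd F y v) x u)"
    by (rule smooth_onD(1)[OF smooth_onD(3)[OF dF_smooth]])
  have "continuous_on U (\<lambda>x. christoffel G (F x) v w)" for v w
    by (rule continuous_on_compose2[OF cod.christoffel_continuous smooth_onD(1)[OF smooth_F]])
      (use F_in in auto)
  then show "continuous_on U (\<lambda>x. christoffel G (F x) (dd F x u) (dd F x v))"
    using smooth_onD(1)[OF dF_smooth, of u] smooth_onD(1)[OF dF_smooth, of v]
    by (intro continuous_on_bilinear_apply[of U "\<lambda>x. christoffel G (F x)" "\<lambda>x. dd F x u" "\<lambda>x. dd F x v"]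
        cod.christoffel_bilinear F_in) assumption+
  show "continuous_on U (\<lambda>x. dd F x (christoffel g x u v))"
    by (rule continuous_on_linear_apply[OF dF_linear smooth_onD(1)[OF dF_smooth]
          dom.christoffel_continuous])
qed

text \<open>In equal dimensions every target vector is tangent, and \<open>II\<close> is orthogonal
  to all tangent vectors. Thus local isometries preserve the Levi-Civita connection.\<close>

lemma second_form_isometry_zero:
  assumes "DIM('e) = DIM('h)" "x \<in> U"
  shows "II x u v = 0"
proof -
  have "surj (dd F x)"
    using dF_linear dF_inj assms by (simp add: linear_injective_imp_surjective)
  then obtain w where "II x u v = dd F x w" by (metis surjD)
  then show ?thesis
    using second_form_normal[OF assms(2), of u v w] inner_formD(5)[OF cod.form[OF F_in[OF assms(2)]]]
    by simp
qed

end

section \<open>Hypersurfaces in a pair of charts\<close>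

lemma linear_trace_commute:
  fixes f :: "'a::euclidean_space \<Rightarrow> 'b::euclidean_space" and h :: "'b \<Rightarrow> 'a"
  assumes "linear f" "linear h"
  shows "linear_trace (\<lambda>x. f (h x)) = linear_trace (\<lambda>x. h (f x))"
proof -
  have 1: "f (h b) \<bullet> b = (\<Sum>a\<in>Basis. (h b \<bullet> a) * (f a \<bullet> b))" for b
    using linear_sum_Basis[OF assms(1), of "h b"] by (simp add: inner_sum_left)
  have 2: "h (f a) \<bullet> a = (\<Sum>b\<in>Basis. (f a \<bullet> b) * (h b \<bullet> a))" for a
    using linear_sum_Basis[OF assms(2), of "f a"] by (simp add: inner_sum_left)
  show ?thesis
    unfolding linear_trace_def 1 2 by (subst sum.swap) (simp add: mult.commute)
qed

text \<open>Since \<open>linear_trace\<close> refers to the standard basis, invariance under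
  conjugation is what makes it meaningful across charts.\<close>

lemma linear_trace_conjugate:
  fixes L :: "'e::euclidean_space \<Rightarrow> 'e"
  assumes "linear L" "inj L" "linear A" "linear A'" "\<And>u. A' (L u) = L (A u)"
  shows "linear_trace A' = linear_trace A"
proof -
  obtain M where M: "linear M" "M \<circ> L = id" "L \<circ> M = id"
    using linear_injective_isomorphism[OF assms(1,2)]
    by (metis assms(1,2) linear_injective_left_inverse linear_inverse_left)
  have "linear (\<lambda>u. L (A u))" using linear_compose[OF assms(3,1)] by (simp add: o_def)
  then have "linear_trace (\<lambda>u. L (A (M u))) = linear_trace (\<lambda>u. M (L (A u)))"
    using linear_trace_commute[of "\<lambda>u. L (A u)" M] M(1) by simp
  moreover have "L (A (M u)) = A' u" "M (L (A u)) = A u" for u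
    using assms(5)[of "M u"] M(2,3) by (auto simp: fun_eq_iff)
  ultimately show ?thesis by simp
qed

section \<open>Shape operators and mean curvature at a point\<close>

definition unit_normal_at ::
  "'h::euclidean_space metric_tensor \<Rightarrow> ('e::euclidean_space \<Rightarrow> 'h) \<Rightarrow> 'e \<Rightarrow> 'h \<Rightarrow> bool" where
  "unit_normal_at G F x \<nu> \<longleftrightarrow> G (F x) \<nu> \<nu> = 1 \<and> (\<forall>u. G (F x) \<nu> (dd F x u) = 0)"

text \<open>In contrast to \<open>shape_operator\<close>, which differentiates a normal field, this
  depends only on the normal vector at the point. It is therefore available at every point, whether
  or not a normal field has been chosen.\<close>

definition shape_at ::
  "'e::euclidean_space metric_tensor \<Rightarrow> 'h::euclidean_space metric_tensor \<Rightarrow> ('e \<Rightarrow> 'h)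
     \<Rightarrow> 'e \<Rightarrow> 'h \<Rightarrow> 'e \<Rightarrow> 'e" where
  "shape_at g G F x \<nu> u = (THE z. \<forall>v. g x z v = G (F x) \<nu> (second_form g G F x u v))"

text \<open>The trace of the second fundamental form: on the standard basis and its \<open>g\<close>-dual basis.\<close>

definition mean_vector ::
  "'e::euclidean_space metric_tensor \<Rightarrow> 'h::euclidean_space metric_tensor \<Rightarrow> ('e \<Rightarrow> 'h)
     \<Rightarrow> 'e \<Rightarrow> 'h" where
  "mean_vector g G F x = (\<Sum>b\<in>Basis. second_form g G F x b (THE z. \<forall>w. g x z w = b \<bullet> w))"

context isometric_map
begin

abbreviation shape :: "'e \<Rightarrow> 'h \<Rightarrow> 'e \<Rightarrow> 'e" where
  "shape \<equiv> shape_at g G F"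

lemma shape_functional_linear: "x \<in> U \<Longrightarrow> linear (\<lambda>v. G (F x) \<nu> (II x u v))"
  using linear_compose[OF bilinear_linear_right[OF second_form_bilinear[of x], of u]
      bilinear_linear_right[OF cod.bil[OF F_in[of x]], of \<nu>]]
  by (simp add: o_def)

lemma shape_eq: "x \<in> U \<Longrightarrow> g x (shape x \<nu> u) v = G (F x) \<nu> (II x u v)"
  unfolding shape_at_def by (rule inner_form_THE[OF dom.form shape_functional_linear])

lemma shape_eqI:
  assumes "x \<in> U" "\<And>v. g x z v = G (F x) \<nu> (II x u v)"
  shows "shape x \<nu> u = z"
  by (rule inner_form_eqI[OF dom.form[OF assms(1)]]) (simp add: assms shape_eq)

lemma shape_linear:
  assumes "x \<in> U"
  shows "linear (shape x \<nu>)"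
  by (rule linearI; rule shape_eqI)
    (simp_all add: assms shape_eq bilinear_simps[OF dom.bil[OF assms]]
      bilinear_simps[OF second_form_bilinear[OF assms]] bilinear_simps[OF cod.bil[OF F_in[OF assms]]])

lemma shape_selfadjoint: "x \<in> U \<Longrightarrow> g x (shape x \<nu> u) v = g x u (shape x \<nu> v)"
  by (simp add: shape_eq dom.sym[of x u] second_form_sym)

lemma shape_scale: "x \<in> U \<Longrightarrow> shape x (s *\<^sub>R \<nu>) u = s *\<^sub>R shape x \<nu> u"
  by (rule shape_eqI) (simp_all add: shape_eq bilinear_simps[OF dom.bil]
      bilinear_simps[OF cod.bil[OF F_in]])

text \<open>Differentiate the two constant functions given by the products of \<open>N\<close> with
  a tangent field and with itself.\<close>

lemma weingarten:
  assumes W: "open W" "x \<in> W" "W \<subseteq> U" and N: "\<And>y. y \<in> W \<Longrightarrow> unit_normal_at G F y (N y)"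
    and dN: "N differentiable (at x)"
  shows "G (F x) (cov N x u) (dd F x v) = - G (F x) (N x) (II x u v)"
    and "G (F x) (cov N x u) (N x) = 0"
proof -
  have x: "x \<in> U" using W by auto
  note y = F_in[OF x]
  have "dd (\<lambda>y. G (F y) (N y) (dd F y v)) x u = dd (\<lambda>y. 0) x u"
    by (rule fun_cong[OF dd_cong[OF W(1,2)]]) (use N in \<open>auto simp: unit_normal_at_def\<close>)
  then have "G (F x) (cov N x u) (dd F x v) + G (F x) (N x) (cov (\<lambda>y. dd F y v) x u) = 0"
    using dd_along[OF x dN dF_differentiable[OF x]] by simp
  then show "G (F x) (cov N x u) (dd F x v) = - G (F x) (N x) (II x u v)"
    using N[OF W(2)] by (simp add: cov_dF bilinear_simps[OF cod.bil[OF y]] unit_normal_at_def)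
  have "dd (\<lambda>y. G (F y) (N y) (N y)) x u = dd (\<lambda>y. 1) x u"
    by (rule fun_cong[OF dd_cong[OF W(1,2)]]) (use N in \<open>auto simp: unit_normal_at_def\<close>)
  then show "G (F x) (cov N x u) (N x) = 0"
    using dd_along[OF x dN dN] cod.sym[OF y, of "N x"] by simp
qed

lemma mean_vector_trace:
  assumes "x \<in> U"
  shows "linear_trace (shape x \<nu>) = G (F x) \<nu> (mean_vector g G F x)"
proof -
  \<comment> \<open>The metric dual of the standard basis: testing against \<open>e b\<close> reads
    off a diagonal coefficient of the shape operator.\<close>
  define e where "e b = (THE z. \<forall>w. g x z w = b \<bullet> w)" for b :: 'e
  have "linear (\<lambda>w. b \<bullet> w)" for b :: 'e by (simp add: bounded_linear.linear bounded_linear_inner_right)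
  then have e: "g x (e b) w = b \<bullet> w" for b w
    unfolding e_def using inner_form_THE[OF dom.form[OF assms]] by simp
  have "shape x \<nu> b \<bullet> b = G (F x) \<nu> (II x b (e b))" for b
    using e[of b "shape x \<nu> b"] shape_eq[OF assms, of \<nu> b "e b"] dom.sym[OF assms]
    by (simp add: inner_commute)
  then show ?thesis
    unfolding linear_trace_def mean_vector_def e_def[symmetric]
    by (simp add: linear_sum[OF bilinear_linear_right[OF cod.bil[OF F_in[OF assms]]]])
qed

lemma mean_vector_continuous: "continuous_on U (mean_vector g G F)"
  unfolding mean_vector_def
proof (rule continuous_on_sum)
  fix b :: 'e
  have lin: "linear (\<lambda>w. b \<bullet> w)" by (simp add: bounded_linear.linear bounded_linear_inner_right)
  have "continuous_on U (\<lambda>x. THE z. \<forall>w. g x z w = b \<bullet> w)"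
    by (rule representation_continuous_on[OF dom.open_U dom.form, where \<phi> = "\<lambda>_ w. b \<bullet> w"])
      (auto intro: lin inner_form_THE[OF dom.form] smooth_onD(1)[OF dom.smooth])
  then show "continuous_on U (\<lambda>x. II x b (THE z. \<forall>w. g x z w = b \<bullet> w))"
    using continuous_on_linear_apply[of U "\<lambda>x. II x b"] bilinear_linear_right
      second_form_bilinear second_form_continuous by blast
qed

lemma mean_vector_normal:
  assumes "x \<in> U"
  shows "G (F x) (mean_vector g G F x) (dd F x w) = 0"
  unfolding mean_vector_def
  by (simp add: linear_sum[OF bilinear_linear_left[OF cod.bil[OF F_in[OF assms]]]]
      second_form_normal[OF assms])

lemma metric_along_continuous:
  assumes "continuous_on W Y" "continuous_on W Z" "W \<subseteq> U"
  shows "continuous_on W (\<lambda>x. G (F x) (Y x) (Z x))"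
proof (rule continuous_on_bilinear_apply[OF _ _ assms(1,2)])
  show "bilinear (G (F x))" if "x \<in> W" for x
    using that assms(3) by (auto intro: cod.bil F_in)
  have "continuous_on U (\<lambda>x. G (F x) v w)" for v w
    by (rule continuous_on_compose2[OF smooth_onD(1)[OF cod.smooth] smooth_onD(1)[OF smooth_F]])
      (use F_in in auto)
  then show "continuous_on W (\<lambda>x. G (F x) v w)" for v w
    using assms(3) continuous_on_subset by blast
qed

end

text \<open>Here \<open>'a\<close> models the hypersurface and \<open>'b\<close> the ambient
  space.\<close>

locale hypersurface_chart = isometric_map +
  assumes codim: "DIM('b) = DIM('a) + 1"
begin

lemma normal_decomposition:
  assumes x: "x \<in> U" and \<nu>: "unit_normal_at G F x \<nu>"
  shows "\<exists>w. Z = dd F x w + G (F x) Z \<nu> *\<^sub>R \<nu>"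
proof -
  note b = bilinear_simps[OF cod.bil[OF F_in[OF x]]]
  \<comment> \<open>Tangent part plus multiple of the normal. This map is injective between spaces
    of equal dimension by \<open>codim\<close>, hence onto.\<close>
  define \<Phi> where "\<Phi> p = dd F x (fst p) + snd p *\<^sub>R \<nu>" for p :: "'a \<times> real"
  have lin: "linear \<Phi>"
    by (rule linearI) (simp_all add: \<Phi>_def linear_add[OF dF_linear[OF x]]
        linear_scale[OF dF_linear[OF x]] algebra_simps)
  have \<Phi>\<nu>: "G (F x) (\<Phi> p) \<nu> = snd p" for p
    using \<nu> cod.sym[OF F_in[OF x], of "dd F x _" \<nu>] by (simp add: \<Phi>_def b unit_normal_at_def)
  have "\<Phi> p = 0 \<Longrightarrow> p = 0" for p
    using \<Phi>\<nu>[of p] dF_eq_iff[OF x, of "fst p" 0] linear_0[OF dF_linear[OF x]]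
    by (auto simp: \<Phi>_def b prod_eq_iff)
  then have "inj \<Phi>" using linear_injective_0[OF lin] by blast
  then have "surj \<Phi>" using lin codim by (simp add: linear_injective_imp_surjective)
  then obtain p where "Z = \<Phi> p" by (metis surjD)
  then show ?thesis using \<Phi>\<nu>[of p] by (auto simp: \<Phi>_def)
qed

lemma normal_multiple:
  assumes x: "x \<in> U" and \<nu>: "unit_normal_at G F x \<nu>" and Z: "\<And>w. G (F x) Z (dd F x w) = 0"
  shows "Z = G (F x) Z \<nu> *\<^sub>R \<nu>"
proof -
  note b = bilinear_simps[OF cod.bil[OF F_in[OF x]]]
  obtain w where w: "Z = dd F x w + G (F x) Z \<nu> *\<^sub>R \<nu>"
    using normal_decomposition[OF x \<nu>] by blast
  have "G (F x) (dd F x w) (dd F x w) = 0"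
    using arg_cong[OF w, of "\<lambda>z. G (F x) z (dd F x w)"] Z \<nu> by (simp add: b unit_normal_at_def)
  then show ?thesis using w inner_formD(5)[OF cod.form[OF F_in[OF x]]] by simp
qed

lemma unit_normal_exists:
  assumes x: "x \<in> U"
  shows "\<exists>\<nu>. unit_normal_at G F x \<nu>"
proof -
  note b = bilinear_simps[OF cod.bil[OF F_in[OF x]]]
  have "dim (range (dd F x)) \<le> DIM('a)"
    using dim_image_le[OF dF_linear[OF x], of UNIV] by simp
  then have "range (dd F x) \<noteq> UNIV" using codim by auto
  then obtain w where w: "w \<notin> range (dd F x)" by blast
  have "linear (\<lambda>v. G (F x) w (dd F x v))"
    using linear_compose[OF dF_linear[OF x] bilinear_linear_right[OF cod.bil[OF F_in[OF x]]]]
    by (simp add: o_def)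
  \<comment> \<open>The vector obtained is the tangential projection of \<open>w\<close>, pulled
    back along the differential; subtracting its image leaves a nonzero normal vector.\<close>
  from inner_form_representation[OF dom.form[OF x] this]
  obtain t where t: "\<And>v. g x t v = G (F x) w (dd F x v)" by blast
  define m where "m = w - dd F x t"
  have m: "G (F x) m (dd F x v) = 0" for v
    using t[of v] isometric[OF x, of t v] by (simp add: m_def b)
  have "m \<noteq> 0" using w by (auto simp: m_def)
  then have pos: "G (F x) m m > 0" using inner_formD(3)[OF cod.form[OF F_in[OF x]]] by blast
  have "unit_normal_at G F x ((1 / sqrt (G (F x) m m)) *\<^sub>R m)"
    using pos m by (simp add: unit_normal_at_def b)
  then show ?thesis by blast
qed

lemma unit_normal_unique:
  assumes x: "x \<in> U" and \<nu>: "unit_normal_at G F x \<nu>" and \<nu>': "unit_normal_at G F x \<nu>'"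
  shows "\<nu>' = \<nu> \<or> \<nu>' = - \<nu>"
proof -
  note b = bilinear_simps[OF cod.bil[OF F_in[OF x]]]
  define s where "s = G (F x) \<nu>' \<nu>"
  have *: "\<nu>' = s *\<^sub>R \<nu>"
    unfolding s_def using normal_multiple[OF x \<nu>, of \<nu>'] \<nu>' by (simp add: unit_normal_at_def)
  have "s * s = 1" using \<nu> \<nu>' unfolding unit_normal_at_def * by (simp add: b)
  then have "s = 1 \<or> s = -1" by (simp add: square_eq_1_iff)
  then show ?thesis using * by auto
qed

lemma second_form_shape:
  assumes x: "x \<in> U" and \<nu>: "unit_normal_at G F x \<nu>"
  shows "II x u v = g x (shape x \<nu> u) v *\<^sub>R \<nu>"
  using normal_multiple[OF x \<nu>, of "II x u v"] second_form_normal[OF x] shape_eq[OF x, of \<nu> u v]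
    cod.sym[OF F_in[OF x]] by simp

lemma gauss_shape:
  assumes x: "x \<in> U" and \<nu>: "unit_normal_at G F x \<nu>"
  shows "g x (curvature g x u v w) z
    = G (F x) (curvature G (F x) (dd F x u) (dd F x v) (dd F x w)) (dd F x z)
      + g x (shape x \<nu> v) w * g x (shape x \<nu> u) z - g x (shape x \<nu> u) w * g x (shape x \<nu> v) z"
  unfolding gauss[OF x] second_form_shape[OF x \<nu>]
  using \<nu> by (simp add: bilinear_simps[OF cod.bil[OF F_in[OF x]]] unit_normal_at_def)

text \<open>The mean curvature vector is the trace times the normal, and is unaffected by reversing
  the normal. Its squared length thus gives the squared trace as a continuous expression without any
  choice of normals.\<close>

lemma mean_vector_square:
  assumes x: "x \<in> U" and \<nu>: "unit_normal_at G F x \<nu>"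
  shows "G (F x) (mean_vector g G F x) (mean_vector g G F x) = (linear_trace (shape x \<nu>))\<^sup>2"
proof -
  define s where "s = linear_trace (shape x \<nu>)"
  have "mean_vector g G F x = s *\<^sub>R \<nu>"
    unfolding s_def mean_vector_trace[OF x]
    using normal_multiple[OF x \<nu> mean_vector_normal[OF x]] cod.sym[OF F_in[OF x]] by simp
  then show ?thesis
    using \<nu> by (simp add: s_def[symmetric] bilinear_simps[OF cod.bil[OF F_in[OF x]]]
        unit_normal_at_def power2_eq_square)
qed

text \<open>Connects the description by a normal field with \<open>shape_at\<close>. By Weingarten
  the derivative of \<open>N\<close> has no normal component, so the equation has a solution;
  injectivity of \<open>dd F x\<close> makes it unique.\<close>

lemma shape_operator_eq:
  assumes W: "open W" "x \<in> W" "W \<subseteq> U" and N: "\<And>y. y \<in> W \<Longrightarrow> unit_normal_at G F y (N y)"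
    and dN: "N differentiable (at x)"
  shows "(THE z. dd F x z = - cov N x u) = shape x (N x) u"
proof (rule the_equality)
  have x: "x \<in> U" using W by auto
  note b = bilinear_simps[OF cod.bil[OF F_in[OF x]]]
  obtain w where w: "cov N x u = dd F x w + G (F x) (cov N x u) (N x) *\<^sub>R N x"
    using normal_decomposition[OF x N[OF W(2)]] by blast
  then have w: "cov N x u = dd F x w" using weingarten(2)[OF W N dN] by simp
  have "shape x (N x) u = - w"
    by (rule shape_eqI[OF x])
      (use weingarten(1)[OF W N dN, of u] in \<open>simp add: w isometric[OF x] b linear_neg[OF dF_linear[OF x]]\<close>)
  then show 1: "dd F x (shape x (N x) u) = - cov N x u"
    by (simp add: w linear_neg[OF dF_linear[OF x]])
  fix z assume "dd F x z = - cov N x u"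
  then show "z = shape x (N x) u"
    using 1 dF_eq_iff[OF x, of z "shape x (N x) u"] by simp
qed

end

text \<open>The local isometries \<open>\<tau>\<close> and \<open>T\<close> have vanishing Hessian,
  so the chain rule transports the second fundamental form. The two shape operators are then
  conjugate under the differential of \<open>\<tau>\<close>.\<close>

lemma shape_change:
  fixes F F' :: "'e::euclidean_space \<Rightarrow> 'h::euclidean_space"
  assumes F: "isometric_map U g V G F" and F': "isometric_map U' g' V' G' F'"
    and \<tau>: "isometric_map U g U' g' \<tau>" and T: "isometric_map V G V' G' T"
    and eq: "\<And>y. y \<in> U \<Longrightarrow> T (F y) = F' (\<tau> y)" and x: "x \<in> U" and \<nu>: "unit_normal_at G F x \<nu>"
  shows "unit_normal_at G' F' (\<tau> x) (dd T (F x) \<nu>)"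
    and "linear_trace (shape_at g' G' F' (\<tau> x) (dd T (F x) \<nu>)) = linear_trace (shape_at g G F x \<nu>)"
proof -
  interpret F: isometric_map U g V G F by fact
  interpret F': isometric_map U' g' V' G' F' by fact
  interpret \<tau>: isometric_map U g U' g' \<tau> by fact
  interpret T: isometric_map V G V' G' T by fact
  note x' = \<tau>.F_in[OF x] and y = F.F_in[OF x] and U = F.dom.open_U x
  have surj: "surj (dd \<tau> x)"
    using \<tau>.dF_linear[OF x] \<tau>.dF_inj[OF x] by (simp add: linear_injective_imp_surjective)
  have d: "dd T (F x) (dd F x u) = dd F' (\<tau> x) (dd \<tau> x u)" for u
  proof -
    have "dd (\<lambda>y. T (F y)) x = dd (\<lambda>y. F' (\<tau> y)) x"
      by (rule dd_cong[OF U]) (rule eq)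
    then show ?thesis
      using dd_compose[OF T.F_differentiable[OF y] F.F_differentiable[OF x]]
        dd_compose[OF F'.F_differentiable[OF x'] \<tau>.F_differentiable[OF x]] by simp
  qed
  have II: "second_form g' G' F' (\<tau> x) (dd \<tau> x u) (dd \<tau> x v) = dd T (F x) (second_form g G F x u v)"
    for u v
  proof -
    have "second_form g G' (\<lambda>y. T (F y)) x = second_form g G' (\<lambda>y. F' (\<tau> y)) x"
      by (rule second_form_cong[OF U]) (rule eq)
    then show ?thesis
      using second_form_compose[OF U F.smooth_F F.F_in T.smooth_F, of g G' u v G]
        second_form_compose[OF U \<tau>.smooth_F \<tau>.F_in F'.smooth_F, of g G' u v g']
      by (simp add: T.second_form_isometry_zero[OF _ y] \<tau>.second_form_isometry_zero[OF _ x]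
          linear_0[OF F'.dF_linear[OF x']])
  qed
  show "unit_normal_at G' F' (\<tau> x) (dd T (F x) \<nu>)"
    unfolding unit_normal_at_def
  proof (intro conjI allI)
    show "G' (F' (\<tau> x)) (dd T (F x) \<nu>) (dd T (F x) \<nu>) = 1"
      using \<nu> T.isometric[OF y, of \<nu> \<nu>] eq[OF x] by (simp add: unit_normal_at_def)
    fix w
    obtain u where "w = dd \<tau> x u" using surj by (metis surjD)
    then show "G' (F' (\<tau> x)) (dd T (F x) \<nu>) (dd F' (\<tau> x) w) = 0"
      using \<nu> T.isometric[OF y, of \<nu> "dd F x u"] eq[OF x] by (simp add: d unit_normal_at_def)
  qed
  have shape: "F'.shape (\<tau> x) (dd T (F x) \<nu>) (dd \<tau> x u) = dd \<tau> x (F.shape x \<nu> u)" for u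
  proof (rule F'.shape_eqI[OF x'])
    fix w
    obtain v where "w = dd \<tau> x v" using surj by (metis surjD)
    then show "g' (\<tau> x) (dd \<tau> x (F.shape x \<nu> u)) w
      = G' (F' (\<tau> x)) (dd T (F x) \<nu>) (second_form g' G' F' (\<tau> x) (dd \<tau> x u) w)"
      using F.shape_eq[OF x, of \<nu> u v] T.isometric[OF y, of \<nu> "second_form g G F x u v"]
      by (simp add: \<tau>.isometric[OF x, symmetric] II eq[OF x])
  qed
  show "linear_trace (F'.shape (\<tau> x) (dd T (F x) \<nu>)) = linear_trace (F.shape x \<nu>)"
    by (rule linear_trace_conjugate[of "dd \<tau> x"])
      (rule \<tau>.dF_linear[OF x] \<tau>.dF_inj[OF x] F.shape_linear[OF x] F'.shape_linear[OF x'] shape)+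
qed

section \<open>Curvature of warped products\<close>

text \<open>The metric component of \<open>warped_chart\<close>, detached from the chart record so
  that the curvature is computed on an open set of the model space.\<close>

definition warped_metric :: "(real \<Rightarrow> real) \<Rightarrow> 'e::euclidean_space metric_tensor \<Rightarrow> (real \<times> 'e) metric_tensor" where
  "warped_metric \<omega> h = (\<lambda>(t, x) (a, u) (b, v). a * b + (\<omega> t)\<^sup>2 * h x u v)"

lemma has_derivative_fst_compose:
  assumes "(\<phi> has_real_derivative d) (at t)"
  shows "((\<lambda>p. \<phi> (fst p)) has_derivative (\<lambda>p. d * fst p)) (at (t, x))"
proof -
  have "(fst has_derivative fst) (at (t, x))"
    by (rule bounded_linear_imp_has_derivative[OF bounded_linear_fst])
  moreover have "(\<phi> has_derivative (\<lambda>a. d * a)) (at (fst (t, x)))"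
    using assms by (simp add: has_field_derivative_def)
  ultimately show ?thesis by (rule has_derivative_compose)
qed

lemma has_derivative_snd_compose:
  assumes "\<psi> differentiable (at x)"
  shows "((\<lambda>p. \<psi> (snd p)) has_derivative (\<lambda>p. dd \<psi> x (snd p))) (at (t, x))"
proof -
  have "(snd has_derivative snd) (at (t, x))"
    by (rule bounded_linear_imp_has_derivative[OF bounded_linear_snd])
  moreover have "(\<psi> has_derivative dd \<psi> x) (at (snd (t, x)))"
    using dd_has_derivative[OF assms] by simp
  ultimately show ?thesis by (rule has_derivative_compose)
qed

locale warped_chart_metric = base: metric_chart U h
  for U :: "'e::euclidean_space set" and h :: "'e metric_tensor" +
  fixes I :: "real set" and \<omega> :: "real \<Rightarrow> real"
  assumes open_I: "open I" and smooth_\<omega>: "smooth_on I \<omega>" and \<omega>_pos: "t \<in> I \<Longrightarrow> \<omega> t > 0"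
begin

abbreviation G :: "(real \<times> 'e) metric_tensor" where "G \<equiv> warped_metric \<omega> h"

lemma G_eq: "G (t, x) (a, u) (b, v) = a * b + (\<omega> t)\<^sup>2 * h x u v"
  by (simp add: warped_metric_def)

lemma \<omega>_deriv: "t \<in> I \<Longrightarrow> (\<omega> has_real_derivative deriv \<omega> t) (at t)"
  using smooth_onD(2)[OF smooth_\<omega>] by (simp add: DERIV_deriv_iff_real_differentiable)

lemma \<omega>_deriv2:
  assumes "t \<in> I"
  shows "(deriv \<omega> has_real_derivative deriv (deriv \<omega>) t) (at t)"
proof -
  have "deriv \<omega> differentiable (at t)"
  proof (rule differentiable_cong_open[OF open_I assms])
    show "(\<lambda>t. dd \<omega> t 1) differentiable (at t)"
      by (rule smooth_onD(2)[OF smooth_onD(3)[OF smooth_\<omega>] assms])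
    show "dd \<omega> s 1 = deriv \<omega> s" if "s \<in> I" for s
      using dd_deriv smooth_onD(2)[OF smooth_\<omega> that] by simp
  qed
  then show ?thesis by (simp add: DERIV_deriv_iff_real_differentiable)
qed

lemma G_smooth: "smooth_on (I \<times> U) (\<lambda>p. G p X Y)"
  unfolding smooth_on_def
proof
  fix k
  have o: "open (I \<times> U)" by (rule open_Times[OF open_I base.open_U])
  have "ck_on (I \<times> U) (\<lambda>p. \<omega> (fst p)) k"
    using smooth_\<omega> by (intro ck_on_linear_compose[OF bounded_linear_fst, of _ I] o)
      (auto simp: smooth_on_def)
  moreover have "ck_on (I \<times> U) (\<lambda>p. h (snd p) (snd X) (snd Y)) k"
    using base.smooth by (intro ck_on_linear_compose[OF bounded_linear_snd, of _ U "\<lambda>x. h x (snd X) (snd Y)"] o)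
      (auto simp: smooth_on_def)
  ultimately have "ck_on (I \<times> U) (\<lambda>p. fst X * fst Y + \<omega> (fst p) * \<omega> (fst p) * h (snd p) (snd X) (snd Y)) k"
    by (intro ck_on_add ck_on_mult ck_on_const o)
  then show "ck_on (I \<times> U) (\<lambda>p. G p X Y) k"
    by (rule ck_on_cong[OF o, rotated]) (simp add: warped_metric_def case_prod_unfold power2_eq_square)
qed

sublocale metric_chart "I \<times> U" G
proof
  show "open (I \<times> U)" by (rule open_Times[OF open_I base.open_U])
  have "bilinear (G p)" "G p X Y = G p Y X" "X \<noteq> 0 \<Longrightarrow> G p X X > 0"
    if pU: "p \<in> I \<times> U" for p X Y
  proof -
    obtain t x where p: "p = (t, x)" "t \<in> I" "x \<in> U" using pU by auto
    note b = bilinear_simps[OF base.bil[OF p(3)]]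
    show "bilinear (G p)"
      unfolding bilinear_def linear_iff
      by (auto simp: p warped_metric_def case_prod_unfold b algebra_simps)
    show "G p X Y = G p Y X"
      by (simp add: p warped_metric_def case_prod_unfold base.sym[OF p(3), of "snd X"] mult.commute)
    assume "X \<noteq> 0"
    then have "fst X \<noteq> 0 \<or> snd X \<noteq> 0" by (auto simp: prod_eq_iff)
    moreover have "(\<omega> t)\<^sup>2 > 0" using \<omega>_pos[OF p(2)] by simp
    moreover have "h x (snd X) (snd X) \<ge> 0" "snd X \<noteq> 0 \<Longrightarrow> h x (snd X) (snd X) > 0"
      using inner_formD[OF base.form[OF p(3)]] by auto
    moreover have "fst X \<noteq> 0 \<Longrightarrow> fst X * fst X > 0" "fst X * fst X \<ge> 0"
      by (auto simp: zero_less_mult_iff)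
    ultimately show "G p X X > 0"
      by (auto simp: p warped_metric_def case_prod_unfold intro: add_pos_nonneg add_nonneg_pos)
  qed
  then show "riemannian_metric_on (I \<times> U) G"
    unfolding riemannian_metric_on_def using G_smooth by blast
qed

context
  fixes t :: real and x :: 'e
  assumes t: "t \<in> I" and x: "x \<in> U"
begin

lemma dd_G: "dd (\<lambda>p. G p (b, v) (c, w)) (t, x) (a, u)
  = 2 * \<omega> t * deriv \<omega> t * a * h x v w + (\<omega> t)\<^sup>2 * dd (\<lambda>y. h y v w) x u"
proof -
  have "((\<lambda>p. b * c + (\<omega> (fst p) * \<omega> (fst p)) * h (snd p) v w) has_derivative
    (\<lambda>q. 0 + ((\<omega> (fst (t, x)) * \<omega> (fst (t, x))) * dd (\<lambda>y. h y v w) x (snd q)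
      + (\<omega> (fst (t, x)) * (deriv \<omega> t * fst q) + deriv \<omega> t * fst q * \<omega> (fst (t, x)))
         * h (snd (t, x)) v w))) (at (t, x))"
    by (intro has_derivative_add has_derivative_const has_derivative_mult has_derivative_fst_compose
        \<omega>_deriv t has_derivative_snd_compose[of "\<lambda>y. h y v w"] base.differentiable x)
  moreover have "(\<lambda>p. G p (b, v) (c, w)) = (\<lambda>p. b * c + (\<omega> (fst p) * \<omega> (fst p)) * h (snd p) v w)"
    by (auto simp: warped_metric_def power2_eq_square)
  ultimately show ?thesis
    by (simp add: dd_eqI power2_eq_square algebra_simps)
qed

lemma christoffel_warped: "christoffel G (t, x) (b, v) (c, w)
  = (- (\<omega> t * deriv \<omega> t) * h x v w,
     (deriv \<omega> t / \<omega> t) *\<^sub>R (b *\<^sub>R w + c *\<^sub>R v) + christoffel h x v w)"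
proof (rule christoffel_eqI)
  show "(t, x) \<in> I \<times> U" using t x by simp
  fix W :: "real \<times> 'e"
  obtain e z where W: "W = (e, z)" by (cases W)
  show "G (t, x) (- (\<omega> t * deriv \<omega> t) * h x v w,
      (deriv \<omega> t / \<omega> t) *\<^sub>R (b *\<^sub>R w + c *\<^sub>R v) + christoffel h x v w) W
    = koszul (t, x) (b, v) (c, w) W"
    unfolding W dd_G G_eq using \<omega>_pos[OF t]
    by (simp add: bilinear_simps[OF base.bil[OF x]] base.christoffel_koszul[OF x] field_simps power2_eq_square)
qed

end

lemma dd_christoffel_warped:
  assumes t: "t \<in> I" and x: "x \<in> U"
  shows "dd (\<lambda>p. christoffel G p (b, v) (c, w)) (t, x) (a, u)
    = (- ((deriv \<omega> t)\<^sup>2 + \<omega> t * deriv (deriv \<omega>) t) * a * h x v w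
         - \<omega> t * deriv \<omega> t * dd (\<lambda>y. h y v w) x u,
       ((deriv (deriv \<omega>) t * \<omega> t - (deriv \<omega> t)\<^sup>2) / (\<omega> t)\<^sup>2 * a) *\<^sub>R (b *\<^sub>R w + c *\<^sub>R v)
         + dd (\<lambda>y. christoffel h y v w) x u)"
proof -
  have nz: "\<omega> t \<noteq> 0" using \<omega>_pos[OF t] by simp
  have d1: "((\<lambda>s. - (\<omega> s * deriv \<omega> s)) has_real_derivative
      - (\<omega> t * deriv (deriv \<omega>) t + deriv \<omega> t * deriv \<omega> t)) (at t)"
    by (rule derivative_eq_intros \<omega>_deriv[OF t] \<omega>_deriv2[OF t] refl)+ simp
  have d2: "((\<lambda>s. deriv \<omega> s / \<omega> s) has_real_derivative
      (deriv (deriv \<omega>) t * \<omega> t - (deriv \<omega> t)\<^sup>2) / (\<omega> t)\<^sup>2) (at t)"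
    by (rule derivative_eq_intros \<omega>_deriv[OF t] \<omega>_deriv2[OF t] refl nz)+ (simp add: power2_eq_square)
  have "dd (\<lambda>p. christoffel G p (b, v) (c, w)) (t, x)
    = dd (\<lambda>p. (- (\<omega> (fst p) * deriv \<omega> (fst p)) * h (snd p) v w,
        (deriv \<omega> (fst p) / \<omega> (fst p)) *\<^sub>R (b *\<^sub>R w + c *\<^sub>R v) + christoffel h (snd p) v w)) (t, x)"
    by (rule dd_cong[OF open_U]) (use t x christoffel_warped in auto)
  also have "\<dots> = (\<lambda>q. (- (\<omega> (fst (t, x)) * deriv \<omega> (fst (t, x))) * dd (\<lambda>y. h y v w) x (snd q)
      + - (\<omega> t * deriv (deriv \<omega>) t + deriv \<omega> t * deriv \<omega> t) * fst q * h (snd (t, x)) v w,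
        ((deriv (deriv \<omega>) t * \<omega> t - (deriv \<omega> t)\<^sup>2) / (\<omega> t)\<^sup>2 * fst q) *\<^sub>R (b *\<^sub>R w + c *\<^sub>R v)
      + dd (\<lambda>y. christoffel h y v w) x (snd q)))"
    by (rule dd_eqI)
      (intro has_derivative_Pair has_derivative_add has_derivative_mult has_derivative_scaleR_left
        has_derivative_fst_compose[OF d1] has_derivative_fst_compose[OF d2]
        has_derivative_snd_compose[of "\<lambda>y. h y v w"] has_derivative_snd_compose[of "\<lambda>y. christoffel h y v w"]
        base.differentiable base.christoffel_differentiable x)
  finally show ?thesis by (simp add: power2_eq_square algebra_simps)
qed

lemma curvature_warped:
  assumes t: "t \<in> I" and x: "x \<in> U"
  shows "curvature G (t, x) (a, u) (b, v) (c, w)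
    = (- (\<omega> t * deriv (deriv \<omega>) t) * (a * h x v w - b * h x u w),
       (deriv (deriv \<omega>) t / \<omega> t * c) *\<^sub>R (a *\<^sub>R v - b *\<^sub>R u)
         - (deriv \<omega> t)\<^sup>2 *\<^sub>R (h x v w *\<^sub>R u - h x u w *\<^sub>R v) + curvature h x u v w)"
proof -
  have nz: "\<omega> t \<noteq> 0" using \<omega>_pos[OF t] by simp
  note b = bilinear_simps[OF base.bil[OF x]] bilinear_simps[OF base.christoffel_bilinear[OF x]]
  note s = base.sym[OF x, of v u] base.christoffel_sym[OF x, of v u]
    base.sym[OF x, of "christoffel h x _ _" w] base.sym[OF x, of "christoffel h x _ _" u]
    base.sym[OF x, of "christoffel h x _ _" v]
  \<comment> \<open>With \<open>r\<close> and \<open>k\<close> for the quotients of the derivatives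
    of the warping function by its value, both components become polynomial identities without
    denominators.\<close>
  define o' where "o' = \<omega> t"
  define r where "r = deriv \<omega> t / o'"
  define k where "k = deriv (deriv \<omega>) t / o'"
  have nz: "o' \<noteq> 0" using nz by (simp add: o'_def)
  have subst: "deriv \<omega> t = r * o'" "deriv (deriv \<omega>) t = k * o'"
    using nz by (simp_all add: r_def k_def)
  have quot: "(k * o' * o' - (r * o')\<^sup>2) / o'\<^sup>2 = k - r * r"
    using nz by (simp add: field_simps power2_eq_square)
  have quot': "r * o' / o' = r" "k * o' / o' = k" using nz by simp_all
  show ?thesis
    unfolding curvature_eq christoffel_warped[OF t x] dd_christoffel_warped[OF t x]
      o'_def[symmetric] subst quot quot'
  proof (rule prod_eqI, goal_cases)
    case 1
    show ?case
      by (simp add: b s base.metric_compat[OF x] algebra_simps power2_eq_square)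
  next
    case 2
    show ?case
      by (simp add: b s base.curvature_eq algebra_simps power2_eq_square)
  qed
qed

text \<open>Planes tangent to the fibre have curvature \<open>(\<epsilon> - (deriv \<omega>
  t)\<^sup>2) / (\<omega> t)\<^sup>2\<close>, which is minus alpha; planes containing the
  \<open>I\<close>-direction have minus the second derivative over the warping function, which is
  minus alpha minus beta. Hence beta measures the failure to have constant curvature.\<close>

lemma curvature_warped_space_form:
  assumes t: "t \<in> I" and x: "x \<in> U"
    and const: "\<And>u v w. curvature h x u v w = \<epsilon> *\<^sub>R (h x v w *\<^sub>R u - h x u w *\<^sub>R v)"
  shows "G (t, x) (curvature G (t, x) X Y Z) W
    = - warp_alpha \<epsilon> \<omega> t * (G (t, x) Y Z * G (t, x) X W - G (t, x) X Z * G (t, x) Y W)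
      - warp_beta \<epsilon> \<omega> t * (fst X * fst W * G (t, x) Y Z + fst Y * fst Z * G (t, x) X W
          - fst X * fst Z * G (t, x) Y W - fst Y * fst W * G (t, x) X Z)"
proof -
  have nz: "\<omega> t \<noteq> 0" using \<omega>_pos[OF t] by simp
  obtain a u b v c w e z where *: "X = (a, u)" "Y = (b, v)" "Z = (c, w)" "W = (e, z)"
    by (metis surj_pair)
  define \<alpha> where "\<alpha> = warp_alpha \<epsilon> \<omega> t"
  define \<beta> where "\<beta> = warp_beta \<epsilon> \<omega> t"
  define o' where "o' = \<omega> t"
  have 1: "\<epsilon> - (deriv \<omega> t)\<^sup>2 = - \<alpha> * o'\<^sup>2"
    using nz by (simp add: warp_alpha_def \<alpha>_def o'_def)
  have 2: "deriv (deriv \<omega>) t = (\<alpha> + \<beta>) * o'"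
    using nz by (simp add: warp_beta_def \<alpha>_def \<beta>_def o'_def)
  have "G (t, x) (curvature G (t, x) X Y Z) W
    = - (o' * deriv (deriv \<omega>) t) * (a * e * h x v w + b * c * h x u z - a * c * h x v z - b * e * h x u w)
      + o'\<^sup>2 * (\<epsilon> - (deriv \<omega> t)\<^sup>2) * (h x v w * h x u z - h x u w * h x v z)"
    unfolding * curvature_warped[OF t x] const G_eq o'_def using nz
    by (simp add: bilinear_simps[OF base.bil[OF x]] field_simps power2_eq_square)
  also have "\<dots> = - \<alpha> * (G (t, x) Y Z * G (t, x) X W - G (t, x) X Z * G (t, x) Y W)
      - \<beta> * (fst X * fst W * G (t, x) Y Z + fst Y * fst Z * G (t, x) X W
          - fst X * fst Z * G (t, x) Y W - fst Y * fst W * G (t, x) X Z)"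
    unfolding 1 2 * G_eq fst_conv o'_def[symmetric] by (simp add: algebra_simps power2_eq_square)
  finally show ?thesis unfolding \<alpha>_def \<beta>_def .
qed

end

section \<open>Self-adjoint operators annihilated by a quadratic polynomial\<close>

lemma linear_trace_add: "linear_trace (\<lambda>u. A u + B u) = linear_trace A + linear_trace B"
  by (simp add: linear_trace_def inner_add_left sum.distrib)

lemma linear_trace_scale: "linear_trace (\<lambda>u. c *\<^sub>R A u) = c * linear_trace A"
  by (simp add: linear_trace_def sum_distrib_left)

lemma linear_trace_ident: "linear_trace (\<lambda>u::'e::euclidean_space. u) = real DIM('e)"
  by (simp add: linear_trace_def)

text \<open>The trace of an idempotent is its rank. Its image is identified with a coordinate
  subspace of the same dimension, and cyclicity of the trace reduces the claim to a coordinate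
  projection.\<close>

lemma linear_trace_projection:
  fixes P :: "'e::euclidean_space \<Rightarrow> 'e"
  assumes "linear P" "\<And>u. P (P u) = P u"
  shows "linear_trace P = real (dim (range P))"
proof -
  have "dim (range P) \<le> card (Basis :: 'e set)"
    using dim_subset_UNIV[of "range P"] by simp
  then obtain D :: "'e set" where D: "D \<subseteq> Basis" "card D = dim (range P)" "finite D"
    by (metis obtain_subset_with_card_n finite_subset finite_Basis)
  have "independent D" using D(1) independent_Basis independent_mono by blast
  then have "dim (range P) = dim (span D)" using D by (simp add: dim_eq_card_independent)
  then obtain f h where f: "linear f" "f ` range P = span D" and h: "linear h" "h ` span D = range P"
    and fh: "\<And>x. x \<in> span D \<Longrightarrow> f (h x) = x" and hf: "\<And>x. x \<in> range P \<Longrightarrow> h (f x) = x"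
    using isometries_subspaces[of "range P" "span D"] linear_subspace_image[OF assms(1) subspace_UNIV]
      subspace_span by metis
  \<comment> \<open>The coordinate projection onto the span of \<open>D\<close>, whose trace can be
    counted on the standard basis.\<close>
  define q where "q y = (\<Sum>b\<in>D. (y \<bullet> b) *\<^sub>R b)" for y
  have q_lin: "linear q"
    by (rule linearI) (simp_all add: q_def inner_add_left scaleR_add_left sum.distrib scaleR_sum_right)
  have q_in: "q y \<in> span D" for y
    unfolding q_def by (intro span_sum span_scale span_base)
  have q_D: "q b = (if b \<in> D then b else 0)" if "b \<in> Basis" for b
  proof -
    have "q b = (\<Sum>a\<in>D. if a = b then b else 0)"
      unfolding q_def using D(1) that by (intro sum.cong) (auto simp: inner_Basis)
    then show ?thesis using D(3) by simp
  qed
  have q_fix: "q y = y" if "y \<in> span D" for y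
    by (rule linear_eq_on[OF q_lin linear_ident that]) (use q_D D(1) in auto)
  have 1: "h (q (f (P u))) = P u" for u
  proof -
    have "f (P u) \<in> span D" using f(2) by blast
    then show ?thesis using q_fix hf by simp
  qed
  have 2: "f (P (h (q y))) = q y" for y
  proof -
    have "h (q y) \<in> range P" using h(2) q_in by blast
    then have "P (h (q y)) = h (q y)" using assms(2) by auto
    then show ?thesis using fh[OF q_in] by simp
  qed
  have "linear (\<lambda>u. f (P u))" "linear (\<lambda>y. h (q y))"
    using linear_compose[OF assms(1) f(1)] linear_compose[OF q_lin h(1)] by (simp_all add: o_def)
  \<comment> \<open>The two orders of composing \<open>f \<circ> P\<close> and
    \<open>h \<circ> q\<close> give \<open>P\<close> and \<open>q\<close> respectively.\<close>
  from linear_trace_commute[OF this(2) this(1)] have "linear_trace P = linear_trace q"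
    by (simp add: 1 2)
  also have "\<dots> = (\<Sum>b\<in>Basis. if b \<in> D then 1 else 0)"
    unfolding linear_trace_def by (intro sum.cong) (auto simp: q_D)
  also have "\<dots> = real (card D)"
    using D(1) by (simp add: sum.If_cases Int_absorb1)
  finally show ?thesis using D(2) by simp
qed

text \<open>The shape operator at a single point, stripped of its geometry: \<open>H\<close> is its
  trace, and \<open>quad\<close> is the traced Gauss equation of an Einstein hypersurface.\<close>

locale quadratic_operator =
  fixes B :: "'e::euclidean_space \<Rightarrow> 'e \<Rightarrow> real" and A :: "'e \<Rightarrow> 'e" and H \<sigma> n :: real
  assumes form: "inner_form B" and lin: "linear A" and selfadj: "\<And>u v. B (A u) v = B u (A v)"
    and quad: "\<And>u. A (A u) = H *\<^sub>R A u - \<sigma> *\<^sub>R u" and trace: "H = linear_trace A"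
    and n: "n = real DIM('e)" and dim: "n > 3"
begin

text \<open>Reversing the unit normal changes \<open>A\<close> and \<open>H\<close> by a sign; the
  quadratic relation keeps the same \<open>\<sigma>\<close>.\<close>

lemma operator_scale:
  assumes s: "s * s = 1"
  shows "quadratic_operator B (\<lambda>u. s *\<^sub>R A u) (s * H) \<sigma> n"
proof (rule quadratic_operator.intro)
  show "linear (\<lambda>u. s *\<^sub>R A u)" using lin by (rule linear_compose_scale_right)
  show "B (s *\<^sub>R A u) v = B u (s *\<^sub>R A v)" for u v
    by (simp add: bilinear_simps[OF inner_formD(1)[OF form]] selfadj)
  show "s *\<^sub>R A (s *\<^sub>R A u) = (s * H) *\<^sub>R s *\<^sub>R A u - \<sigma> *\<^sub>R u" for u
    using s by (simp add: linear_scale[OF lin] quad algebra_simps)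
qed (simp_all add: form dim n[symmetric] trace linear_trace_scale)

text \<open>The self-adjoint operator \<open>C\<close> squares to the discriminant times the
  identity, so the squared length of \<open>C u\<close> is the discriminant times that of
  \<open>u\<close>. Positivity of the form makes the roots real without the spectral
  theorem.\<close>

lemma discriminant: "H\<^sup>2 / 4 - \<sigma> \<ge> 0" "H\<^sup>2 / 4 - \<sigma> = 0 \<Longrightarrow> A u = (H / 2) *\<^sub>R u"
proof -
  note b = bilinear_simps[OF inner_formD(1)[OF form]]
  define C where "C u = A u - (H / 2) *\<^sub>R u" for u
  have "B (C u) (C u) = (H\<^sup>2 / 4 - \<sigma>) * B u u" for u
  proof -
    have "B (C u) (C u) = B u (C (C u))"
      by (simp add: C_def b selfadj linear_diff[OF lin] linear_scale[OF lin])
    also have "C (C u) = (H\<^sup>2 / 4 - \<sigma>) *\<^sub>R u"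
      by (simp add: C_def linear_diff[OF lin] linear_scale[OF lin] quad algebra_simps power2_eq_square
          scaleR_add_left[symmetric])
    finally show ?thesis by (simp add: b)
  qed
  note C = this
  obtain e :: 'e where e: "e \<in> Basis" using nonempty_Basis by blast
  then have "B e e > 0" by (intro inner_formD(3)[OF form]) auto
  then show "H\<^sup>2 / 4 - \<sigma> \<ge> 0"
    using C[of e] inner_formD(4)[OF form, of "C e"] by (metis mult.commute zero_le_mult_iff not_less)
  show "A u = (H / 2) *\<^sub>R u" if "H\<^sup>2 / 4 - \<sigma> = 0"
    using C[of u] that inner_formD(5)[OF form, of "C u"] by (simp add: C_def)
qed

text \<open>The relation \<open>(p - 1) * \<kappa> + (q - 1) * \<mu> = 0\<close> compares the trace \<open>p * \<kappa> + q * \<mu>\<close> with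
  the sum \<open>\<kappa> + \<mu>\<close> of the roots of the quadratic polynomial.\<close>

lemma operator_cases:
  obtains (umbilic) "\<And>u. A u = (H / n) *\<^sub>R u" "\<sigma> = (n - 1) * (H / n)\<^sup>2"
  | (two) \<kappa> \<mu> p q where "\<kappa> = H / 2 + sqrt (H\<^sup>2 / 4 - \<sigma>)" "\<mu> = H / 2 - sqrt (H\<^sup>2 / 4 - \<sigma>)"
    "\<mu> < \<kappa>" "\<kappa> + \<mu> = H" "\<kappa> * \<mu> = \<sigma>" "p = dim (eigenspace A \<kappa>)" "q = dim (eigenspace A \<mu>)"
    "p \<ge> 1" "q \<ge> 1" "real p + real q = n" "(real p - 1) * \<kappa> + (real q - 1) * \<mu> = 0"
    "eigenvalues A = {\<mu>, \<kappa>}" "\<kappa> = 0 \<Longrightarrow> range A \<subseteq> eigenspace A \<mu>" "\<mu> = 0 \<Longrightarrow> range A \<subseteq> eigenspace A \<kappa>"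
proof (cases "H\<^sup>2 / 4 - \<sigma> = 0")
  case True
  then have A: "A = (\<lambda>u. (H / 2) *\<^sub>R u)" using discriminant(2) by blast
  \<comment> \<open>A double root makes \<open>A\<close> half its trace times the identity; taking
    traces leaves only \<open>H = 0\<close>, because \<open>n\<close> is not 2.\<close>
  have "H = H / 2 * n"
    using trace linear_trace_scale[of "H / 2" "\<lambda>u::'e. u"] linear_trace_ident[where 'e = 'e] by (simp add: A n)
  then have "H = 0" using dim by auto
  then show ?thesis using umbilic A True by simp
next
  case False
  define r where "r = sqrt (H\<^sup>2 / 4 - \<sigma>)"
  define \<kappa> where "\<kappa> = H / 2 + r"
  define \<mu> where "\<mu> = H / 2 - r"
  have r: "r > 0" "r\<^sup>2 = H\<^sup>2 / 4 - \<sigma>"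
    using False discriminant(1) by (simp_all add: r_def)
  have rel: "\<kappa> + \<mu> = H" "\<kappa> * \<mu> = \<sigma>" "\<mu> < \<kappa>"
    using r by (simp_all add: \<kappa>_def \<mu>_def algebra_simps power2_eq_square)
  \<comment> \<open>The Lagrange interpolation polynomial of \<open>A\<close> for the root
    \<open>\<kappa>\<close>: the projection onto its eigenspace along that of \<open>\<mu>\<close>,
    with complement \<open>R\<close>.\<close>
  define P where "P u = (1 / (\<kappa> - \<mu>)) *\<^sub>R (A u - \<mu> *\<^sub>R u)" for u
  define R where "R u = u - P u" for u
  have P_lin: "linear P"
    by (rule linearI) (simp_all add: P_def linear_add[OF lin] linear_scale[OF lin] algebra_simps)
  have R_lin: "linear R"
    unfolding R_def by (intro linear_compose_sub linear_ident P_lin)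
  have LP: "(\<kappa> - \<mu>) *\<^sub>R P u = A u - \<mu> *\<^sub>R u" for u using rel(3) by (simp add: P_def)
  have AP: "A (P u) = \<kappa> *\<^sub>R P u" for u
  proof -
    have "A (A u - \<mu> *\<^sub>R u) = \<kappa> *\<^sub>R (A u - \<mu> *\<^sub>R u)"
      by (simp add: linear_diff[OF lin] linear_scale[OF lin] quad rel(1,2)[symmetric] algebra_simps)
    then show ?thesis unfolding P_def by (simp add: linear_scale[OF lin])
  qed
  have PP: "P (P u) = P u" for u
  proof -
    have "(\<kappa> - \<mu>) *\<^sub>R P (P u) = (\<kappa> - \<mu>) *\<^sub>R P u"
      unfolding LP[of "P u"] AP by (simp add: algebra_simps)
    then show ?thesis using rel(3) by simp
  qed
  have RR: "R (R u) = R u" for u by (simp add: R_def linear_diff[OF P_lin] PP)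
  have A: "A u = \<kappa> *\<^sub>R P u + \<mu> *\<^sub>R R u" for u
    using LP[of u] by (simp add: R_def algebra_simps)
  have P_iff: "P u = u \<longleftrightarrow> u \<in> eigenspace A \<kappa>" for u
  proof
    assume "P u = u" then show "u \<in> eigenspace A \<kappa>" using AP[of u] by (simp add: eigenspace_def)
  next
    assume "u \<in> eigenspace A \<kappa>"
    then have "(\<kappa> - \<mu>) *\<^sub>R P u = (\<kappa> - \<mu>) *\<^sub>R u" unfolding LP by (simp add: eigenspace_def algebra_simps)
    then show "P u = u" using rel(3) by simp
  qed
  have R_iff: "R u = u \<longleftrightarrow> u \<in> eigenspace A \<mu>" for u
  proof -
    have "u \<in> eigenspace A \<mu> \<longleftrightarrow> (\<kappa> - \<mu>) *\<^sub>R P u = 0" unfolding LP by (simp add: eigenspace_def)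
    then show ?thesis using rel(3) by (simp add: R_def)
  qed
  have "range T = {u. T u = u}" if "\<And>u. T (T u) = T u" for T :: "'e \<Rightarrow> 'e"
    using that by (auto intro: range_eqI[OF sym])
  then have range_P: "range P = eigenspace A \<kappa>" and range_R: "range R = eigenspace A \<mu>"
    using PP RR P_iff R_iff by auto
  define p where "p = dim (eigenspace A \<kappa>)"
  define q where "q = dim (eigenspace A \<mu>)"
  have tr: "linear_trace P = real p" "linear_trace R = real q"
    using linear_trace_projection[OF P_lin PP] linear_trace_projection[OF R_lin RR]
    by (simp_all add: p_def q_def range_P range_R)
  have "linear_trace (\<lambda>u. P u + R u) = n" by (simp add: R_def linear_trace_ident n)
  then have pq: "real p + real q = n" by (simp add: linear_trace_add tr)
  have "A = (\<lambda>u. \<kappa> *\<^sub>R P u + \<mu> *\<^sub>R R u)" by (rule ext) (rule A)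
  then have "linear_trace A = linear_trace (\<lambda>u. \<kappa> *\<^sub>R P u + \<mu> *\<^sub>R R u)" by (rule arg_cong)
  then have H: "H = \<kappa> * real p + \<mu> * real q"
    using trace by (simp add: linear_trace_add linear_trace_scale tr)
  have npos: "n > 0" using dim by simp
  show ?thesis
  proof (cases "p = 0 \<or> q = 0")
    case True
    then show ?thesis
    proof
      assume "p = 0"
      then have "P u = 0" for u
        using range_P by (auto simp: p_def dim_eq_0)
      then have Au: "A u = \<mu> *\<^sub>R u" for u by (simp add: A R_def)
      have \<mu>: "\<mu> = H / n" using H pq \<open>p = 0\<close> npos by (simp add: field_simps)
      \<comment> \<open>Although \<open>\<kappa>\<close> has no eigenvectors here, it remains a root
        of the polynomial, and the sum of the roots determines it. The product of the roots then
        gives \<open>\<sigma>\<close>.\<close>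
      have "\<kappa> = (n - 1) * \<mu>" using rel(1) H pq \<open>p = 0\<close> by (simp add: algebra_simps)
      then show ?thesis using umbilic Au \<mu> rel(2) by (simp add: power2_eq_square)
    next
      assume "q = 0"
      then have "R u = 0" for u
        using range_R by (auto simp: q_def dim_eq_0)
      then have Au: "A u = \<kappa> *\<^sub>R u" for u by (simp add: A R_def)
      have \<kappa>: "\<kappa> = H / n" using H pq \<open>q = 0\<close> npos by (simp add: field_simps)
      have "\<mu> = (n - 1) * \<kappa>" using rel(1) H pq \<open>q = 0\<close> by (simp add: algebra_simps)
      then show ?thesis using umbilic Au \<kappa> rel(2) by (simp add: power2_eq_square mult_ac)
    qed
  next
    case False
    have nontriv: "\<exists>u. u \<noteq> 0 \<and> u \<in> eigenspace A a" if "dim (eigenspace A a) \<noteq> 0" for a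
      using that by (auto simp: dim_eq_0)
    have "a = \<kappa> \<or> a = \<mu>" if "u \<noteq> 0" "A u = a *\<^sub>R u" for a u
    proof -
      have "(a * a) *\<^sub>R u = (H * a - \<sigma>) *\<^sub>R u"
        using quad[of u] that(2) by (simp add: linear_scale[OF lin] algebra_simps)
      then have "a * a = H * a - \<sigma>" using that(1) by simp
      then have "(a - \<kappa>) * (a - \<mu>) = 0" by (simp add: rel(1,2)[symmetric] algebra_simps)
      then show ?thesis by simp
    qed
    then have ev: "eigenvalues A = {\<mu>, \<kappa>}"
      using nontriv[of \<kappa>] nontriv[of \<mu>] False
      by (auto simp: eigenvalues_def eigenspace_def p_def q_def)
    show ?thesis
    proof (rule two[of \<kappa> \<mu> p q])
      show "1 \<le> p" "1 \<le> q" using False by auto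
      show "(real p - 1) * \<kappa> + (real q - 1) * \<mu> = 0"
        using H rel(1) by (simp add: algebra_simps)
      show "\<kappa> = 0 \<Longrightarrow> range A \<subseteq> eigenspace A \<mu>"
        using A range_R subspace_scale[OF linear_subspace_image[OF R_lin subspace_UNIV]] by auto
      show "\<mu> = 0 \<Longrightarrow> range A \<subseteq> eigenspace A \<kappa>"
        using A range_P subspace_scale[OF linear_subspace_image[OF P_lin subspace_UNIV]] by auto
    qed (use rel pq ev in \<open>simp_all add: \<kappa>_def \<mu>_def r_def p_def q_def\<close>)
  qed
qed

text \<open>Two distinct roots would have the same sign, while the multiplicity relation combines
  them with nonnegative weights of total n - 2 > 0 and could not vanish.\<close>

lemma positive_case:
  assumes "\<sigma> > 0"
  shows "A u = (H / n) *\<^sub>R u" "\<sigma> = (n - 1) * (H / n)\<^sup>2"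
proof -
  have "(\<forall>u. A u = (H / n) *\<^sub>R u) \<and> \<sigma> = (n - 1) * (H / n)\<^sup>2"
  proof (cases rule: operator_cases)
    case umbilic
    then show ?thesis by blast
  next
    case (two \<kappa> \<mu> p q)
    have pos: "real p - 1 \<ge> 0" "real q - 1 \<ge> 0" "real p - 1 + (real q - 1) > 0"
      using two(8,9,10) dim by auto
    have "\<kappa> > 0 \<and> \<mu> > 0 \<or> \<kappa> < 0 \<and> \<mu> < 0" using assms two(5) by (metis zero_less_mult_iff)
    then have "(real p - 1) * \<kappa> + (real q - 1) * \<mu> \<noteq> 0"
    proof
      assume *: "\<kappa> > 0 \<and> \<mu> > 0"
      have "(real p - 1) * \<mu> \<le> (real p - 1) * \<kappa>" using pos two(3) by (intro mult_left_mono) auto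
      moreover have "(real p - 1 + (real q - 1)) * \<mu> > 0" using pos * by simp
      ultimately show ?thesis unfolding distrib_right by linarith
    next
      assume *: "\<kappa> < 0 \<and> \<mu> < 0"
      have "(real q - 1) * \<mu> \<le> (real q - 1) * \<kappa>" using pos two(3) by (intro mult_left_mono) auto
      moreover have "(real p - 1 + (real q - 1)) * \<kappa> < 0" using pos * by (simp add: mult_pos_neg)
      ultimately show ?thesis unfolding distrib_right by linarith
    qed
    then show ?thesis using two(11) by blast
  qed
  then show "A u = (H / n) *\<^sub>R u" "\<sigma> = (n - 1) * (H / n)\<^sup>2" by auto
qed

text \<open>One root is zero; the multiplicity relation forces the other one to be simple, and the
  range lies in its eigenspace. An umbilic operator is zero here.\<close>

lemma zero_case:
  assumes "\<sigma> = 0"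
  shows "dim (range A) \<le> 1"
proof (cases rule: operator_cases)
  case umbilic
  then have "H = 0" using assms dim by auto
  then have "range A \<subseteq> {0}" using umbilic(1) by auto
  then have "dim (range A) = 0" by (simp add: dim_eq_0)
  then show ?thesis by linarith
next
  case (two \<kappa> \<mu> p q)
  then consider "\<kappa> = 0" "\<mu> \<noteq> 0" | "\<mu> = 0" "\<kappa> \<noteq> 0" using assms by fastforce
  then show ?thesis
  proof cases
    case 1
    then have "q = 1" using two(11) by simp
    then show ?thesis using dim_subset[OF two(13)[OF 1(1)]] two(7) by simp
  next
    case 2
    then have "p = 1" using two(11) by simp
    then show ?thesis using dim_subset[OF two(14)[OF 2(1)]] two(6) by simp
  qed
qed

text \<open>The last equation leaves finitely many squared traces, since it involves only
  \<open>\<sigma>\<close> and the multiplicities. The formula for \<open>real q\<close> works in the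
  opposite direction and recovers the multiplicities from a known trace.\<close>

lemma negative_case:
  assumes "\<sigma> < 0"
  obtains \<kappa>\<^sub>1 \<kappa>\<^sub>2 p q where "\<kappa>\<^sub>2 = H / 2 + sqrt (H\<^sup>2 / 4 - \<sigma>)" "\<kappa>\<^sub>1 = H / 2 - sqrt (H\<^sup>2 / 4 - \<sigma>)"
    "\<kappa>\<^sub>1 < 0" "0 < \<kappa>\<^sub>2" "\<kappa>\<^sub>1 * \<kappa>\<^sub>2 = \<sigma>" "p = dim (eigenspace A \<kappa>\<^sub>1)" "q = dim (eigenspace A \<kappa>\<^sub>2)" "2 \<le> p" "2 \<le> q"
    "real p + real q = n" "real q * (\<kappa>\<^sub>2 - \<kappa>\<^sub>1) = H - n * \<kappa>\<^sub>1" "eigenvalues A = {\<kappa>\<^sub>1, \<kappa>\<^sub>2}"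
    "H\<^sup>2 = - \<sigma> * (real p - 1) / (real q - 1) - \<sigma> * (real q - 1) / (real p - 1) + 2 * \<sigma>"
proof (cases rule: operator_cases)
  case umbilic
  have "(n - 1) * (H / n)\<^sup>2 \<ge> 0" using dim by (intro mult_nonneg_nonneg) auto
  then show ?thesis using assms umbilic(2) by linarith
next
  case (two \<kappa> \<mu> p q)
  have sgn: "\<mu> < 0" "0 < \<kappa>"
    using assms two(3,5) by (smt (verit) mult_nonneg_nonneg mult_nonpos_nonpos)+
  \<comment> \<open>A simple root would force the other, nonzero root to be simple as well, leaving
    dimension two.\<close>
  have "p \<noteq> 1"
  proof
    assume "p = 1"
    then have "q = 1" using two(11) sgn by simp
    then show False using two(10) \<open>p = 1\<close> dim by simp
  qed
  have "q \<noteq> 1"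
  proof
    assume "q = 1"
    then have "p = 1" using two(11) sgn by simp
    then show False using two(10) \<open>q = 1\<close> dim by simp
  qed
  define a where "a = real p - 1"
  define c where "c = real q - 1"
  have ac: "a > 0" "c > 0" using \<open>p \<noteq> 1\<close> \<open>q \<noteq> 1\<close> two(8,9) by (simp_all add: a_def c_def)
  \<comment> \<open>Multiplying this relation by either root and replacing the product of the roots
    by \<open>\<sigma>\<close> isolates the two squares below.\<close>
  have rel: "a * \<kappa> = - (c * \<mu>)" using two(11) by (simp add: a_def c_def)
  have "\<kappa>\<^sup>2 = - \<sigma> * c / a"
  proof -
    have "a * \<kappa>\<^sup>2 = (a * \<kappa>) * \<kappa>" by (simp add: power2_eq_square)
    also have "\<dots> = - \<sigma> * c" unfolding rel two(5)[symmetric] by simp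
    finally show ?thesis using ac by (simp add: field_simps)
  qed
  moreover have "\<mu>\<^sup>2 = - \<sigma> * a / c"
  proof -
    have "c * \<mu>\<^sup>2 = (c * \<mu>) * \<mu>" by (simp add: power2_eq_square)
    also have "c * \<mu> = - (a * \<kappa>)" using rel by simp
    also have "- (a * \<kappa>) * \<mu> = - \<sigma> * a" unfolding two(5)[symmetric] by simp
    finally show ?thesis using ac by (simp add: field_simps)
  qed
  moreover have "H\<^sup>2 = \<kappa>\<^sup>2 + \<mu>\<^sup>2 + 2 * \<sigma>"
    unfolding two(4,5)[symmetric] by (simp add: power2_eq_square algebra_simps)
  ultimately have "H\<^sup>2 = - \<sigma> * c / a - \<sigma> * a / c + 2 * \<sigma>" by simp
  then have H2: "H\<^sup>2 = - \<sigma> * (real q - 1) / (real p - 1) - \<sigma> * (real p - 1) / (real q - 1) + 2 * \<sigma>"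
    by (simp add: a_def c_def)
  have "real p * (\<kappa> - \<mu>) = H - n * \<mu>"
    using two(11) unfolding two(4,10)[symmetric] by (simp add: algebra_simps)
  show ?thesis
  \<comment> \<open>The negative root comes first in the conclusion, so the multiplicities of
    \<open>operator_cases\<close> are exchanged. The instantiation follows the order of occurrence,
    which begins with \<open>\<kappa>\<^sub>2\<close>.\<close>
  proof (rule that[of \<kappa> \<mu> q p])
    show "real q + real p = n" using two(10) by simp
    show "real p * (\<kappa> - \<mu>) = H - n * \<mu>" by fact
    show "2 \<le> q" "2 \<le> p" using two(8,9) \<open>p \<noteq> 1\<close> \<open>q \<noteq> 1\<close> by auto
    show "\<mu> * \<kappa> = \<sigma>" using two(5) by (simp add: mult.commute)
  qed (fact two sgn H2)+
qed

end

text \<open>Writing \<open>A w\<close> as a multiple of a fixed vector, both products have the same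
  factors. In the Gauss equation this removes the contribution of a shape operator of rank at most
  one.\<close>

lemma rank_one_minor:
  fixes A :: "'e::euclidean_space \<Rightarrow> 'e" and B :: "'e \<Rightarrow> 'e \<Rightarrow> real"
  assumes "bilinear B" "\<And>u v. B (A u) v = B u (A v)" "\<And>u v. B u v = B v u" "dim (range A) \<le> 1"
  shows "B (A u) u * B (A v) v = B (A u) v * B (A v) u"
proof -
  obtain E where E: "E \<subseteq> range A" "independent E" "range A \<subseteq> span E" "card E = dim (range A)"
    using basis_exists[of "range A"] by blast
  have "finite E" using E(2) by (rule independent_imp_finite)
  then have "\<forall>a\<in>E. \<forall>b\<in>E. a = b"
    using E(4) assms(4) card_le_Suc0_iff_eq[of E] by simp
  \<comment> \<open>An empty basis, that is \<open>A = 0\<close>, is covered by an arbitrary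
    \<open>e\<close>.\<close>
  then have "\<exists>e. E \<subseteq> {e}" by (cases "E = {}") blast+
  then obtain e where "E \<subseteq> {e}" by blast
  then have "range A \<subseteq> range (\<lambda>k. k *\<^sub>R e)"
    using E(3) span_mono span_singleton by blast
  then have "\<exists>k. A w = k *\<^sub>R e" for w by auto
  then obtain \<phi> where \<phi>: "\<And>w. A w = \<phi> w *\<^sub>R e" by metis
  have "\<phi> u * B e v = \<phi> v * B e u"
    using assms(2)[of u v] assms(3)[of u "A v"] by (simp add: \<phi> bilinear_simps[OF assms(1)])
  then show ?thesis by (simp add: \<phi> bilinear_simps[OF assms(1)])
qed

section \<open>Einstein hypersurfaces of warped products in charts\<close>

lemma linear_trace_rank_one: "linear \<phi> \<Longrightarrow> linear_trace (\<lambda>u. \<phi> u *\<^sub>R v) = \<phi> v"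
  using linear_sum_Basis[of \<phi> v] by (simp add: linear_trace_def mult.commute inner_commute)

text \<open>The hypersurface and the fibre have the same dimension, hence the common model space
  \<open>'e\<close>.\<close>

locale einstein_chart = W: warped_chart_metric V h I \<omega>
    + hypersurface_chart U g "I \<times> V" "warped_metric \<omega> h" F
  for V :: "'e::euclidean_space set" and h and I \<omega> and U :: "'e set" and g F +
  fixes \<epsilon> \<Lambda> :: real
  assumes space_form: "x \<in> V \<Longrightarrow> curvature h x u v w = \<epsilon> *\<^sub>R (h x v w *\<^sub>R u - h x u w *\<^sub>R v)"
    and beta: "x \<in> U \<Longrightarrow> warp_beta \<epsilon> \<omega> (fst (F x)) * fst (dd F x u) = 0"
    and ricci: "x \<in> U \<Longrightarrow> ricci g x v w = \<Lambda> * g x v w"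
    and dim: "DIM('e) > 3"
begin

abbreviation \<alpha> where "\<alpha> x \<equiv> warp_alpha \<epsilon> \<omega> (fst (F x))"

lemma curvature_shape:
  assumes x: "x \<in> U" and \<nu>: "unit_normal_at (warped_metric \<omega> h) F x \<nu>"
  shows "curvature g x u v w = - \<alpha> x *\<^sub>R (g x v w *\<^sub>R u - g x u w *\<^sub>R v)
    + g x (shape x \<nu> v) w *\<^sub>R shape x \<nu> u - g x (shape x \<nu> u) w *\<^sub>R shape x \<nu> v"
proof (rule inner_form_eqI[OF dom.form[OF x]])
  fix z
  obtain t y where ty: "F x = (t, y)" "t \<in> I" "y \<in> V"
    using F_in[OF x] by (cases "F x") auto
  \<comment> \<open>At a fixed point beta is a number, so its product with the height differential
    vanishes only if one of the two does. Either way all beta terms drop out on tangent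
    vectors.\<close>
  have "warp_beta \<epsilon> \<omega> t = 0 \<or> (\<forall>u. fst (dd F x u) = 0)" using beta[OF x] ty by auto
  then have "W.G (F x) (curvature W.G (F x) (dd F x u) (dd F x v) (dd F x w)) (dd F x z)
    = - warp_alpha \<epsilon> \<omega> t * (g x v w * g x u z - g x u w * g x v z)"
    unfolding isometric[OF x] ty(1) W.curvature_warped_space_form[OF ty(2,3) space_form[OF ty(3)]]
    by auto
  then show "g x (curvature g x u v w) z = g x (- \<alpha> x *\<^sub>R (g x v w *\<^sub>R u - g x u w *\<^sub>R v)
    + g x (shape x \<nu> v) w *\<^sub>R shape x \<nu> u - g x (shape x \<nu> u) w *\<^sub>R shape x \<nu> v) z"
    unfolding gauss_shape[OF x \<nu>] by (simp add: ty bilinear_simps[OF dom.bil[OF x]])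
qed

lemma shape_quadratic:
  assumes x: "x \<in> U" and \<nu>: "unit_normal_at (warped_metric \<omega> h) F x \<nu>"
  shows "quadratic_operator (g x) (shape x \<nu>) (linear_trace (shape x \<nu>))
    (\<Lambda> + (real DIM('e) - 1) * \<alpha> x) (real DIM('e))"
proof (rule quadratic_operator.intro)
  define A where "A = shape x \<nu>"
  note b = bilinear_simps[OF dom.bil[OF x]]
  have lin: "linear A" unfolding A_def by (rule shape_linear[OF x])
  show "shape x \<nu> (shape x \<nu> v) = linear_trace (shape x \<nu>) *\<^sub>R shape x \<nu> v
    - (\<Lambda> + (real DIM('e) - 1) * \<alpha> x) *\<^sub>R v" for v
    unfolding A_def[symmetric]
  proof (rule inner_form_eqI[OF dom.form[OF x]])
    fix w
    have l1: "linear (\<lambda>u. g x u w)" and l2: "linear (\<lambda>u. g x (A u) w)"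
      using linear_compose[OF lin bilinear_linear_left[OF dom.bil[OF x], of w]]
      by (simp_all add: o_def bilinear_linear_left[OF dom.bil[OF x]])
    have "\<Lambda> * g x v w = ricci g x v w" by (simp add: ricci[OF x])
    \<comment> \<open>The map being traced is split into multiples of the identity and of
      \<open>A\<close> and two rank-one maps. The identity and the first rank-one map together
      produce the factor n - 1 in sigma.\<close>
    also have "\<dots> = linear_trace (\<lambda>u. ((- \<alpha> x * g x v w) *\<^sub>R u + \<alpha> x *\<^sub>R (g x u w *\<^sub>R v))
        + (g x (A v) w *\<^sub>R A u + (-1) *\<^sub>R (g x (A u) w *\<^sub>R A v)))"
      unfolding ricci_def curvature_shape[OF x \<nu>] A_def[symmetric] by (simp add: algebra_simps)
    also have "\<dots> = - \<alpha> x * g x v w * real DIM('e) + \<alpha> x * g x v w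
        + (g x (A v) w * linear_trace A - g x (A (A v)) w)"
      unfolding linear_trace_add linear_trace_scale linear_trace_rank_one[OF l1]
        linear_trace_rank_one[OF l2] linear_trace_ident by simp
    finally show "g x (A (A v)) w
      = g x (linear_trace A *\<^sub>R A v - (\<Lambda> + (real DIM('e) - 1) * \<alpha> x) *\<^sub>R v) w"
      by (simp add: b algebra_simps)
  qed
  show "g x (shape x \<nu> u) v = g x u (shape x \<nu> v)" for u v by (rule shape_selfadjoint[OF x])
qed (use dom.form[OF x] shape_linear[OF x] dim in auto)

lemma sectional_shape:
  assumes x: "x \<in> U" and \<nu>: "unit_normal_at (warped_metric \<omega> h) F x \<nu>"
    and uv: "u \<noteq> v" "independent {u, v}"
  shows "sectional g x u v = - \<alpha> x + (g x (shape x \<nu> u) u * g x (shape x \<nu> v) v - (g x (shape x \<nu> u) v)\<^sup>2)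
    / (g x u u * g x v v - (g x u v)\<^sup>2)"
proof -
  define A where "A = shape x \<nu>"
  have "g x (A v) u = g x (A u) v"
    unfolding A_def using shape_selfadjoint[OF x, of \<nu> v u] dom.sym[OF x] by simp
  then have "g x (curvature g x u v v) u = - \<alpha> x * (g x u u * g x v v - (g x u v)\<^sup>2)
    + (g x (A u) u * g x (A v) v - (g x (A u) v)\<^sup>2)"
    unfolding curvature_shape[OF x \<nu>] A_def[symmetric]
    by (simp add: bilinear_simps[OF dom.bil[OF x]] dom.sym[OF x, of v u] algebra_simps power2_eq_square)
  then show ?thesis
    using gram_nonzero[OF dom.form[OF x] uv] unfolding sectional_def A_def[symmetric]
    by (simp add: add_divide_distrib diff_divide_distrib)
qed

lemma alpha_derivative:
  assumes x: "x \<in> U"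
  shows "(\<alpha> has_derivative (\<lambda>u. 0)) (at x)"
proof -
  obtain t y where ty: "F x = (t, y)" "t \<in> I" "y \<in> V"
    using F_in[OF x] by (cases "F x") auto
  have nz: "\<omega> t \<noteq> 0" using W.\<omega>_pos[OF ty(2)] by simp
  have "((\<lambda>s. ((deriv \<omega> s)\<^sup>2 - \<epsilon>) / (\<omega> s)\<^sup>2) has_real_derivative
    2 * (deriv \<omega> t / \<omega> t) * warp_beta \<epsilon> \<omega> t) (at t)"
    by (rule derivative_eq_intros W.\<omega>_deriv[OF ty(2)] W.\<omega>_deriv2[OF ty(2)] refl)+
      (use nz in \<open>simp_all add: warp_beta_def warp_alpha_def field_simps power2_eq_square\<close>)
  then have "(warp_alpha \<epsilon> \<omega> has_derivative (\<lambda>a. 2 * (deriv \<omega> t / \<omega> t) * warp_beta \<epsilon> \<omega> t * a)) (at t)"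
    by (simp only: warp_alpha_def[abs_def] has_field_derivative_def)
  moreover have "((\<lambda>x. fst (F x)) has_derivative (\<lambda>u. fst (dd F x u))) (at x)"
    by (intro has_derivative_fst dd_has_derivative F_differentiable x)
  ultimately have "(\<alpha> has_derivative
      (\<lambda>u. 2 * (deriv \<omega> t / \<omega> t) * warp_beta \<epsilon> \<omega> t * fst (dd F x u))) (at x)"
    using has_derivative_compose[of "\<lambda>x. fst (F x)" _ x UNIV "warp_alpha \<epsilon> \<omega>"] ty(1) by simp
  moreover have "2 * (deriv \<omega> t / \<omega> t) * warp_beta \<epsilon> \<omega> t * fst (dd F x u) = 0" for u
    using beta[OF x, of u] ty(1) by simp
  ultimately show ?thesis by (simp only:)
qed

lemma alpha_locally_constant:
  assumes x: "x \<in> U"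
  obtains r where "r > 0" "ball x r \<subseteq> U" "\<And>y. y \<in> ball x r \<Longrightarrow> \<alpha> y = \<alpha> x"
proof -
  obtain r where r: "r > 0" "ball x r \<subseteq> U" using dom.open_U x open_contains_ball by blast
  have "\<alpha> y = \<alpha> x" if "y \<in> ball x r" for y
  proof -
    have "(\<alpha> has_derivative (\<lambda>u. 0)) (at y within ball x r)" if "y \<in> ball x r" for y
      using alpha_derivative[of y] r(2) that by (blast intro: has_derivative_at_withinI)
    then have "\<exists>c. \<forall>y\<in>ball x r. \<alpha> y = c"
      by (rule has_derivative_zero_constant[OF convex_ball])
    then show ?thesis using that r(1) by (metis centre_in_ball)
  qed
  with r that show ?thesis by blast
qed

end

section \<open>Charts of Riemannian manifolds\<close>

lemma metric_chart_subset: "metric_chart U g \<Longrightarrow> open V \<Longrightarrow> V \<subseteq> U \<Longrightarrow> metric_chart V g"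
  unfolding metric_chart_def riemannian_metric_on_def using smooth_on_mono by (metis subsetD)

lemma manifold_chart:
  assumes "riemannian_manifold M" "c \<in> M"
  shows "open (cdom c)" "open (cimg c)" "homeomorphism (cdom c) (cimg c) (cmap c) (cinv c)"
    "metric_chart (cimg c) (cmet c)"
  using assms unfolding riemannian_manifold_def metric_chart_def by blast+

lemma manifold_chart_maps:
  assumes "riemannian_manifold M" "c \<in> M"
  shows "continuous_on (cdom c) (cmap c)" "continuous_on (cimg c) (cinv c)"
    "p \<in> cdom c \<Longrightarrow> cinv c (cmap c p) = p" "x \<in> cimg c \<Longrightarrow> cmap c (cinv c x) = x"
    "p \<in> cdom c \<Longrightarrow> cmap c p \<in> cimg c" "x \<in> cimg c \<Longrightarrow> cinv c x \<in> cdom c"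
  using manifold_chart(3)[OF assms] unfolding homeomorphism_def by auto

lemma chart_image_open:
  assumes "riemannian_manifold M" "c \<in> M" "open W" "W \<subseteq> cdom c"
  shows "open (cmap c ` W)" "cmap c ` W \<subseteq> cimg c"
proof -
  note m = manifold_chart_maps[OF assms(1,2)]
  have "cmap c ` W = cimg c \<inter> cinv c -` W"
  proof
    show "cmap c ` W \<subseteq> cimg c \<inter> cinv c -` W" using m(3,5) assms(4) by auto
    show "cimg c \<inter> cinv c -` W \<subseteq> cmap c ` W"
      using m(4) by (metis IntE image_eqI subsetI vimageE)
  qed
  then show "open (cmap c ` W)"
    using continuous_open_preimage[OF m(2) manifold_chart(2)[OF assms(1,2)] assms(3)] by simp
  show "cmap c ` W \<subseteq> cimg c" using m(5) assms(4) by auto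
qed

text \<open>Domain and target may be shrunk freely, because comparing two pairs of charts needs all
  maps on common overlaps.\<close>

lemma transition_chart:
  assumes M: "riemannian_manifold M" "c \<in> M" "d \<in> M"
    and U: "open U" "U \<subseteq> cmap c ` (cdom c \<inter> cdom d)"
    and V: "open V" "V \<subseteq> cimg d" "transition c d ` U \<subseteq> V"
  shows "isometric_map U (cmet c) V (cmet d) (transition c d)"
proof -
  have "metric_chart U (cmet c)"
    using metric_chart_subset[OF manifold_chart(4)[OF M(1,2)] U(1)] U(2) by (auto simp: cimg_def)
  moreover have "metric_chart V (cmet d)"
    by (rule metric_chart_subset[OF manifold_chart(4)[OF M(1,3)] V(1,2)])
  moreover have "smooth_on U (transition c d)"
    using M U(2) smooth_on_mono unfolding riemannian_manifold_def by metis
  moreover have "cmet c x u v = cmet d (transition c d x) (dd (transition c d) x u) (dd (transition c d) x v)"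
    if "x \<in> U" for x u v
    using M that U(2) unfolding riemannian_manifold_def by (meson subsetD)
  ultimately show ?thesis
    using V(3) by (auto simp: isometric_map_def isometric_map_axioms_def)
qed

lemma immersion_chart:
  assumes S: "riemannian_manifold S" "c \<in> S" and M: "riemannian_manifold M" "d \<in> M"
    and f: "isometric_immersion S M f"
    and U: "open U" "U \<subseteq> cmap c ` (cdom c \<inter> f -` cdom d)"
    and V: "open V" "V \<subseteq> cimg d" "local_rep c d f ` U \<subseteq> V"
  shows "isometric_map U (cmet c) V (cmet d) (local_rep c d f)"
proof -
  have "metric_chart U (cmet c)"
    using metric_chart_subset[OF manifold_chart(4)[OF S] U(1)] U(2) by (auto simp: cimg_def)
  moreover have "metric_chart V (cmet d)"
    by (rule metric_chart_subset[OF manifold_chart(4)[OF M] V(1,2)])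
  moreover have "smooth_on U (local_rep c d f)"
    using f S(2) M(2) U(2) smooth_on_mono unfolding isometric_immersion_def by metis
  moreover have "cmet c x u v
      = cmet d (local_rep c d f x) (dd (local_rep c d f) x u) (dd (local_rep c d f) x v)"
    if "x \<in> U" for x u v
    using f S(2) M(2) that U(2) unfolding isometric_immersion_def by (meson subsetD)
  ultimately show ?thesis
    using V(3) by (auto simp: isometric_map_def isometric_map_axioms_def)
qed

lemma immersion_domain_open:
  assumes S: "riemannian_manifold S" "c \<in> S" and M: "riemannian_manifold M" "d \<in> M"
    and f: "isometric_immersion S M f"
  shows "open (cdom c \<inter> f -` cdom d)"
proof -
  have "continuous_on (cdom c) f"
    using f S(2) unfolding isometric_immersion_def carrier_def by (auto intro: continuous_on_subset)
  then show ?thesis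
    using continuous_open_preimage manifold_chart(1)[OF S] manifold_chart(1)[OF M] by blast
qed

lemma local_rep_cmap:
  "riemannian_manifold S \<Longrightarrow> c \<in> S \<Longrightarrow> p \<in> cdom c \<Longrightarrow> local_rep c d f (cmap c p) = cmap d (f p)"
  by (simp add: local_rep_def manifold_chart_maps)

lemma transition_cmap:
  "riemannian_manifold S \<Longrightarrow> c \<in> S \<Longrightarrow> p \<in> cdom c \<Longrightarrow> transition c d (cmap c p) = cmap d p"
  by (simp add: transition_def local_rep_cmap)

lemma continuous_on_open_cover:
  fixes \<phi> :: "'a::t2_space \<Rightarrow> 'b::topological_space"
  assumes "\<And>p. p \<in> A \<Longrightarrow> \<exists>O'. open O' \<and> p \<in> O' \<and> continuous_on O' \<phi>"
  shows "continuous_on A \<phi>"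
proof (rule continuous_at_imp_continuous_on, rule ballI)
  fix p assume "p \<in> A"
  then show "isCont \<phi> p" using assms continuous_on_eq_continuous_at by blast
qed

text \<open>On the overlap \<open>W\<close> in the hypersurface and \<open>D\<close> in the ambient
  space, the two local expressions of \<open>f\<close> and the two transition maps form a commuting
  square of isometric maps, as \<open>shape_change\<close> requires.\<close>

lemma shape_at_chart_change:
  fixes S :: "('s::{t2_space, second_countable_topology}, 'e::euclidean_space) rchart set"
    and M :: "('m::{t2_space, second_countable_topology}, 'h::euclidean_space) rchart set"
  assumes S: "riemannian_manifold S" "c \<in> S" "c' \<in> S" and M: "riemannian_manifold M" "d \<in> M" "d' \<in> M"
    and f: "isometric_immersion S M f"
    and p: "p \<in> cdom c" "p \<in> cdom c'" "f p \<in> cdom d" "f p \<in> cdom d'"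
    and \<nu>: "unit_normal_at (cmet d) (local_rep c d f) (cmap c p) \<nu>"
  defines "\<nu>' \<equiv> dd (transition d d') (cmap d (f p)) \<nu>"
  shows "unit_normal_at (cmet d') (local_rep c' d' f) (cmap c' p) \<nu>'"
    and "linear_trace (shape_at (cmet c') (cmet d') (local_rep c' d' f) (cmap c' p) \<nu>')
      = linear_trace (shape_at (cmet c) (cmet d) (local_rep c d f) (cmap c p) \<nu>)"
proof -
  define W where "W = (cdom c \<inter> f -` cdom d) \<inter> (cdom c' \<inter> f -` cdom d')"
  define D where "D = cdom d \<inter> cdom d'"
  have W: "open W" "W \<subseteq> cdom c" "W \<subseteq> cdom c'" "p \<in> W"
    using immersion_domain_open[OF S(1,2) M(1,2) f] immersion_domain_open[OF S(1,3) M(1,3) f] p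
    by (auto simp: W_def)
  have D: "open D" "D \<subseteq> cdom d" "D \<subseteq> cdom d'"
    using manifold_chart(1)[OF M(1,2)] manifold_chart(1)[OF M(1,3)] by (auto simp: D_def)
  have fW: "q \<in> W \<Longrightarrow> f q \<in> D" for q by (auto simp: W_def D_def)
  note rep = local_rep_cmap[OF S(1,2)] local_rep_cmap[OF S(1,3)] transition_cmap[OF S(1,2)]
    transition_cmap[OF M(1,2)]
  have F: "isometric_map (cmap c ` W) (cmet c) (cmap d ` D) (cmet d) (local_rep c d f)"
  proof (rule immersion_chart[OF S(1,2) M(1,2) f])
    show "local_rep c d f ` cmap c ` W \<subseteq> cmap d ` D" using W fW by (auto simp: rep)
  qed (use chart_image_open[OF S(1,2) W(1,2)] chart_image_open[OF M(1,2) D(1,2)] in \<open>auto simp: W_def\<close>)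
  have F': "isometric_map (cmap c' ` W) (cmet c') (cmap d' ` D) (cmet d') (local_rep c' d' f)"
  proof (rule immersion_chart[OF S(1,3) M(1,3) f])
    show "local_rep c' d' f ` cmap c' ` W \<subseteq> cmap d' ` D" using W fW by (auto simp: rep)
  qed (use chart_image_open[OF S(1,3) W(1,3)] chart_image_open[OF M(1,3) D(1,3)] in \<open>auto simp: W_def\<close>)
  have \<tau>: "isometric_map (cmap c ` W) (cmet c) (cmap c' ` W) (cmet c') (transition c c')"
  proof (rule transition_chart[OF S])
    show "transition c c' ` cmap c ` W \<subseteq> cmap c' ` W" using W by (auto simp: rep)
  qed (use chart_image_open[OF S(1,2) W(1,2)] chart_image_open[OF S(1,3) W(1,3)] in \<open>auto simp: W_def\<close>)
  have T: "isometric_map (cmap d ` D) (cmet d) (cmap d' ` D) (cmet d') (transition d d')"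
  proof (rule transition_chart[OF M])
    show "transition d d' ` cmap d ` D \<subseteq> cmap d' ` D" using D by (auto simp: rep)
  qed (use chart_image_open[OF M(1,2) D(1,2)] chart_image_open[OF M(1,3) D(1,3)] in \<open>auto simp: D_def\<close>)
  have eq: "transition d d' (local_rep c d f y) = local_rep c' d' f (transition c c' y)"
    if "y \<in> cmap c ` W" for y
    using that W fW D by (auto simp: rep subset_iff)
  have x: "cmap c p \<in> cmap c ` W" using W(4) by blast
  note change = shape_change[OF F F' \<tau> T eq x \<nu>]
  show "unit_normal_at (cmet d') (local_rep c' d' f) (cmap c' p) \<nu>'"
    "linear_trace (shape_at (cmet c') (cmet d') (local_rep c' d' f) (cmap c' p) \<nu>')
      = linear_trace (shape_at (cmet c) (cmet d) (local_rep c d f) (cmap c p) \<nu>)"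
    using change p by (simp_all add: rep \<nu>'_def)
qed

section \<open>The warped product as a Riemannian manifold\<close>

lemma
  fixes c :: "('q, 'e::euclidean_space) rchart"
  shows cmap_warped_chart: "cmap (warped_chart I \<omega> c) = (\<lambda>(t, p). (t, cmap c p))"
  and cdom_warped_chart: "cdom (warped_chart I \<omega> c) = I \<times> cdom c"
  and cmet_warped_chart: "cmet (warped_chart I \<omega> c) = warped_metric \<omega> (cmet c)"
  by (simp_all add: warped_chart_def warped_metric_def)

lemma cimg_warped_chart:
  fixes c :: "('q, 'e::euclidean_space) rchart"
  shows "cimg (warped_chart I \<omega> c) = I \<times> cimg c"
  by (auto simp: cimg_def cmap_warped_chart cdom_warped_chart image_iff)

lemma cinv_warped_chart:
  fixes M :: "('q::{t2_space, second_countable_topology}, 'e::euclidean_space) rchart set"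
  assumes "riemannian_manifold M" "c \<in> M" "t \<in> I" "x \<in> cimg c"
  shows "cinv (warped_chart I \<omega> c) (t, x) = (t, cinv c x)"
proof -
  note m = manifold_chart_maps[OF assms(1,2)]
  have "inj_on (cmap (warped_chart I \<omega> c)) (I \<times> cdom c)"
    using m(3) by (auto simp: inj_on_def cmap_warped_chart) metis
  moreover have "(t, cinv c x) \<in> I \<times> cdom c" using assms m(6) by auto
  moreover have "cmap (warped_chart I \<omega> c) (t, cinv c x) = (t, x)"
    using m(4)[OF assms(4)] by (simp add: cmap_warped_chart)
  ultimately show ?thesis unfolding cinv_def cdom_warped_chart by (metis inv_into_f_f)
qed

lemma riemannian_manifold_warped_product:
  fixes Q :: "('q::{t2_space, second_countable_topology}, 'e::euclidean_space) rchart set"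
  assumes Q: "riemannian_manifold Q" and I: "open I" "I \<noteq> {}" and \<omega>: "smooth_on I \<omega>" "\<forall>t\<in>I. \<omega> t > 0"
  shows "riemannian_manifold (warped_product I \<omega> Q)"
proof -
  have chart: "warped_chart_metric (cimg c) (cmet c) I \<omega>" if "c \<in> Q" for c
    using manifold_chart(4)[OF Q that] I \<omega>
    by (simp add: warped_chart_metric_def warped_chart_metric_axioms_def)
  have 1: "carrier (warped_product I \<omega> Q) \<noteq> {}"
    using Q I(2) unfolding riemannian_manifold_def carrier_def warped_product_def
    by (auto simp: cdom_warped_chart)
  have 2: "open (cdom w) \<and> open (cimg w) \<and> homeomorphism (cdom w) (cimg w) (cmap w) (cinv w)
      \<and> riemannian_metric_on (cimg w) (cmet w)" if w: "w = warped_chart I \<omega> c" and c: "c \<in> Q" for w c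
  proof (intro conjI)
    interpret warped_chart_metric "cimg c" "cmet c" I \<omega> by (rule chart[OF c])
    note m = manifold_chart_maps[OF Q c]
    show "open (cdom w)" "open (cimg w)"
      unfolding w cdom_warped_chart cimg_warped_chart
      using open_Times I(1) manifold_chart[OF Q c] by blast+
    show "riemannian_metric_on (cimg w) (cmet w)"
      unfolding w cmet_warped_chart cimg_warped_chart by (rule metric)
    \<comment> \<open>The inverse of the warped chart is an \<open>inv_into\<close>, known only on
      the chart image; it is therefore compared there with the explicit product inverse.\<close>
    show "homeomorphism (cdom w) (cimg w) (cmap w) (cinv w)"
    proof (rule homeomorphism_cong)
      have "continuous_on (I \<times> cdom c) (\<lambda>z. (fst z, cmap c (snd z)))"
        by (intro continuous_on_Pair continuous_on_fst continuous_on_id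
            continuous_on_compose2[OF m(1)] continuous_on_snd) auto
      moreover have "continuous_on (I \<times> cimg c) (\<lambda>z. (fst z, cinv c (snd z)))"
        by (intro continuous_on_Pair continuous_on_fst continuous_on_id
            continuous_on_compose2[OF m(2)] continuous_on_snd) auto
      ultimately show "homeomorphism (I \<times> cdom c) (I \<times> cimg c)
          (\<lambda>z. (fst z, cmap c (snd z))) (\<lambda>z. (fst z, cinv c (snd z)))"
        by (rule homeomorphismI) (use m in auto)
      show "cinv w y = (fst y, cinv c (snd y))" if "y \<in> I \<times> cimg c" for y
        unfolding w using cinv_warped_chart[OF Q c, of "fst y" I "snd y" \<omega>] that by auto
    qed (auto simp: w cdom_warped_chart cimg_warped_chart cmap_warped_chart case_prod_unfold)
  qed
  have 3: "smooth_on (cmap w ` (cdom w \<inter> cdom w')) (transition w w')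
      \<and> (\<forall>z \<in> cmap w ` (cdom w \<inter> cdom w'). \<forall>X Y.
        cmet w z X Y = cmet w' (transition w w' z) (dd (transition w w') z X) (dd (transition w w') z Y))"
    if w: "w = warped_chart I \<omega> c" "w' = warped_chart I \<omega> c'" and c: "c \<in> Q" "c' \<in> Q" for w w' c c'
  proof -
    define U where "U = cmap c ` (cdom c \<inter> cdom c')"
    define \<tau> where "\<tau> = transition c c'"
    have U: "open U" "U \<subseteq> cimg c"
      unfolding U_def
      using chart_image_open[OF Q c(1), of "cdom c \<inter> cdom c'"] manifold_chart(1)[OF Q] c by auto
    have \<tau>: "smooth_on U \<tau>" and iso: "\<And>x u v. x \<in> U \<Longrightarrow>
        cmet c x u v = cmet c' (\<tau> x) (dd \<tau> x u) (dd \<tau> x v)"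
      using Q c unfolding riemannian_manifold_def U_def \<tau>_def by blast+
    have dom: "cmap w ` (cdom w \<inter> cdom w') = I \<times> U"
      by (auto simp: w cdom_warped_chart cmap_warped_chart U_def image_iff)
    have o: "open (I \<times> U)" using open_Times I(1) U(1) by blast
    have eq: "transition w w' z = (fst z, \<tau> (snd z))" if "z \<in> I \<times> U" for z
      using that U(2) cinv_warped_chart[OF Q c(1), of "fst z" I "snd z" \<omega>]
      by (auto simp: w transition_def local_rep_def cmap_warped_chart \<tau>_def)
    have "smooth_on (I \<times> U) (\<lambda>z. (fst z, \<tau> (snd z)))"
      unfolding smooth_on_def
    proof
      fix k
      have "ck_on UNIV (\<lambda>t::real. t) k" by (cases k) (auto simp: ck_on_const)
      then have "ck_on (I \<times> U) (\<lambda>z. fst z) k"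
        using ck_on_linear_compose[OF bounded_linear_fst, of "I \<times> U" UNIV "\<lambda>t. t" k] o by simp
      moreover have "ck_on (I \<times> U) (\<lambda>z. \<tau> (snd z)) k"
        using \<tau> by (intro ck_on_linear_compose[OF bounded_linear_snd, of _ U] o) (auto simp: smooth_on_def)
      ultimately show "ck_on (I \<times> U) (\<lambda>z. (fst z, \<tau> (snd z))) k"
        by (rule ck_on_Pair[OF o])
    qed
    then have "smooth_on (I \<times> U) (transition w w')"
      by (rule smooth_on_cong[OF o, rotated]) (simp add: eq)
    moreover have "cmet w z X Y
        = cmet w' (transition w w' z) (dd (transition w w') z X) (dd (transition w w') z Y)"
      if z: "z \<in> I \<times> U" for z X Y
    proof -
      obtain t x where tx: "z = (t, x)" "t \<in> I" "x \<in> U" using z by auto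
      have "dd (transition w w') z = dd (\<lambda>z. (fst z, \<tau> (snd z))) z"
        by (rule dd_cong[OF o z]) (rule eq)
      also have "\<dots> = (\<lambda>X. (fst X, dd \<tau> x (snd X)))"
        unfolding tx(1)
        by (intro dd_eqI has_derivative_Pair has_derivative_snd_compose smooth_onD(2)[OF \<tau> tx(3)]
            bounded_linear_imp_has_derivative bounded_linear_fst)
      finally show ?thesis
        using iso[OF tx(3)] eq[OF z] unfolding w cmet_warped_chart tx(1)
        by (simp add: warped_metric_def case_prod_unfold)
    qed
    ultimately show ?thesis unfolding dom by blast
  qed
  show ?thesis
    unfolding riemannian_manifold_def using 1 2 3 unfolding warped_product_def by blast
qed

section \<open>Einstein hypersurfaces of warped products\<close>

locale einstein_hypersurface =
  fixes I :: "real set" and \<omega> :: "real \<Rightarrow> real" and \<epsilon> \<Lambda> n :: real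
    and Q :: "('q::{t2_space, second_countable_topology}, 'e::euclidean_space) rchart set"
    and S :: "('s::{t2_space, second_countable_topology}, 'e) rchart set"
    and f :: "'s \<Rightarrow> real \<times> 'q"
  assumes n: "n = real DIM('e)" and dim: "n > 3" and I: "open I" "I \<noteq> {}"
    and \<omega>: "smooth_on I \<omega>" "\<forall>t\<in>I. \<omega> t > 0"
    and Q: "riemannian_manifold Q" "has_constant_curvature \<epsilon> Q"
    and hyp: "hypersurface S (warped_product I \<omega> Q) f"
    and conn: "connected (carrier S)" and einstein: "einstein \<Lambda> S"
    and beta: "\<forall>c\<in>S. \<forall>p\<in>cdom c. warp_beta \<epsilon> \<omega> (fst (f p)) *\<^sub>R height_gradient c f p = 0"
begin

abbreviation M where "M \<equiv> warped_product I \<omega> Q"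
abbreviation \<alpha> where "\<alpha> p \<equiv> warp_alpha \<epsilon> \<omega> (fst (f p))"
abbreviation domain where "domain c d \<equiv> cdom c \<inter> f -` cdom d"
abbreviation normal where "normal c d p \<equiv> unit_normal_at (cmet d) (local_rep c d f) (cmap c p)"
abbreviation shp where "shp c d p \<equiv> shape_at (cmet c) (cmet d) (local_rep c d f) (cmap c p)"
abbreviation met where "met c p \<equiv> cmet c (cmap c p)"
abbreviation tr where "tr c d p \<nu> \<equiv> linear_trace (shp c d p \<nu>)"

lemma S: "riemannian_manifold S" and f: "isometric_immersion S M f"
  using hyp by (auto simp: hypersurface_def)

lemma M: "riemannian_manifold M"
  by (rule riemannian_manifold_warped_product[OF Q(1) I \<omega>])

lemma domain_open: "c \<in> S \<Longrightarrow> d \<in> M \<Longrightarrow> open (domain c d)"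
  by (rule immersion_domain_open[OF S _ M _ f])

lemma chart_domain:
  assumes "p \<in> carrier S"
  obtains c d where "c \<in> S" "d \<in> M" "p \<in> domain c d"
proof -
  have "f p \<in> carrier M" using f assms by (auto simp: isometric_immersion_def)
  then show ?thesis using assms that unfolding carrier_def by blast
qed

lemma fst_local_rep: "d \<in> M \<Longrightarrow> fst (local_rep c d f x) = fst (f (cinv c x))"
  by (auto simp: local_rep_def warped_product_def cmap_warped_chart case_prod_unfold)

lemma isometric_chart:
  assumes c: "c \<in> S" and d: "d \<in> M"
  shows "isometric_map (cmap c ` domain c d) (cmet c) (cimg d) (cmet d) (local_rep c d f)"
proof (rule immersion_chart[OF S c M d f])
  show "open (cmap c ` domain c d)"
    using chart_image_open(1)[OF S c domain_open[OF c d]] by simp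
  show "local_rep c d f ` cmap c ` domain c d \<subseteq> cimg d"
  proof
    fix y assume "y \<in> local_rep c d f ` cmap c ` domain c d"
    then obtain p where "p \<in> cdom c" "f p \<in> cdom d" "y = local_rep c d f (cmap c p)" by blast
    then show "y \<in> cimg d"
      using manifold_chart_maps(5)[OF M d, of "f p"] by (simp add: local_rep_cmap[OF S c])
  qed
qed (use manifold_chart[OF M d] in auto)

lemma einstein_chart:
  assumes c: "c \<in> S" and e: "e \<in> Q"
  defines "d \<equiv> warped_chart I \<omega> e"
  shows "einstein_chart (cimg e) (cmet e) I \<omega> (cmap c ` domain c d) (cmet c) (local_rep c d f) \<epsilon> \<Lambda>"
proof -
  have d: "d \<in> M" using e by (simp add: d_def warped_product_def)
  have met: "cmet d = warped_metric \<omega> (cmet e)" "cimg d = I \<times> cimg e"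
    by (simp_all add: d_def cmet_warped_chart cimg_warped_chart)
  interpret F: isometric_map "cmap c ` domain c d" "cmet c" "I \<times> cimg e" "warped_metric \<omega> (cmet e)"
    "local_rep c d f"
    using isometric_chart[OF c d] by (simp add: met)
  interpret h: metric_chart "cimg e" "cmet e" by (rule manifold_chart(4)[OF Q(1) e])
  interpret W: warped_chart_metric "cimg e" "cmet e" I \<omega>
    by unfold_locales (use I \<omega> in auto)
  show ?thesis
  proof unfold_locales
    fix x u v w
    show "curvature (cmet e) x u v w = \<epsilon> *\<^sub>R (cmet e x v w *\<^sub>R u - cmet e x u w *\<^sub>R v)" if "x \<in> cimg e"
      by (rule h.constant_sectional_curvature[OF that])
        (use Q(2) e that in \<open>auto simp: has_constant_curvature_def\<close>)
    assume x: "x \<in> cmap c ` domain c d"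
    then have "x \<in> cimg c" by (auto simp: cimg_def)
    then show "ricci (cmet c) x v w = \<Lambda> * cmet c x v w"
      using einstein c by (simp add: einstein_def)
    obtain p where p: "p \<in> domain c d" "x = cmap c p" using x by blast
    then have px: "cinv c x = p" using manifold_chart_maps(3)[OF S c] by simp
    define \<xi> where "\<xi> = fst \<circ> f \<circ> cinv c"
    have \<xi>: "\<xi> = (\<lambda>x. fst (local_rep c d f x))"
      by (auto simp: \<xi>_def fst_local_rep[OF d])
    have "(\<xi> has_derivative (\<lambda>u. fst (dd (local_rep c d f) x u))) (at x)"
      unfolding \<xi> by (intro has_derivative_fst dd_has_derivative F.F_differentiable x)
    note d\<xi> = dd_eqI[OF this] and lin = dd_linear[OF differentiableI[OF this]]
    \<comment> \<open>The gradient represents the height differential, so the vanishing of beta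
      times the vector gives the vanishing of beta times the linear form.\<close>
    define T where "T = height_gradient c f p"
    have T: "cmet c x T u = dd \<xi> x u" for u
      unfolding T_def height_gradient_def gradient_def \<xi>_def[symmetric] p(2)[symmetric]
      by (rule inner_form_THE[OF F.dom.form[OF x] lin])
    have "warp_beta \<epsilon> \<omega> (fst (f p)) *\<^sub>R T = 0"
      using beta c p(1) by (simp add: T_def)
    then have "cmet c x (warp_beta \<epsilon> \<omega> (fst (f p)) *\<^sub>R T) u = 0"
      by (simp only: bilinear_lzero[OF F.dom.bil[OF x]])
    then have "warp_beta \<epsilon> \<omega> (fst (f p)) * cmet c x T u = 0"
      by (simp only: bilinear_lmul[OF F.dom.bil[OF x]] real_scaleR_def)
    then show "warp_beta \<epsilon> \<omega> (fst (local_rep c d f x)) * fst (dd (local_rep c d f) x u) = 0"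
      unfolding fst_local_rep[OF d] px T d\<xi> .
  qed (use dim n in auto)
qed

lemma hypersurface_chart:
  assumes c: "c \<in> S" and d: "d \<in> M"
  shows "hypersurface_chart (cmap c ` domain c d) (cmet c) (cimg d) (cmet d) (local_rep c d f)"
  using isometric_chart[OF c d] by (simp add: hypersurface_chart_def hypersurface_chart_axioms_def)

lemma \<alpha>_local_rep: "c \<in> S \<Longrightarrow> d \<in> M \<Longrightarrow> p \<in> cdom c \<Longrightarrow>
    warp_alpha \<epsilon> \<omega> (fst (local_rep c d f (cmap c p))) = \<alpha> p"
  by (simp add: fst_local_rep manifold_chart_maps(3)[OF S])

lemma shape_quadratic:
  assumes c: "c \<in> S" and d: "d \<in> M" and p: "p \<in> domain c d" and \<nu>: "normal c d p \<nu>"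
  shows "quadratic_operator (met c p) (shp c d p \<nu>) (tr c d p \<nu>)
    (\<Lambda> + (n - 1) * \<alpha> p) n"
proof -
  obtain e where e: "e \<in> Q" "d = warped_chart I \<omega> e" using d by (auto simp: warped_product_def)
  interpret E: einstein_chart "cimg e" "cmet e" I \<omega> "cmap c ` domain c d" "cmet c" "local_rep c d f" \<epsilon> \<Lambda>
    unfolding e(2) by (rule einstein_chart[OF c e(1)])
  show ?thesis
    using E.shape_quadratic[of "cmap c p" \<nu>] p \<nu> \<alpha>_local_rep[OF c d]
    by (simp add: e(2) cmet_warped_chart n)
qed

lemma sectional_shape:
  assumes c: "c \<in> S" and d: "d \<in> M" and p: "p \<in> domain c d" and \<nu>: "normal c d p \<nu>"
    and uv: "u \<noteq> v" "independent {u, v}"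
  defines "A \<equiv> shp c d p \<nu>" and "B \<equiv> met c p"
  shows "sectional (cmet c) (cmap c p) u v
    = - \<alpha> p + (B (A u) u * B (A v) v - (B (A u) v)\<^sup>2) / (B u u * B v v - (B u v)\<^sup>2)"
    and "B u u * B v v - (B u v)\<^sup>2 \<noteq> 0"
proof -
  obtain e where e: "e \<in> Q" "d = warped_chart I \<omega> e" using d by (auto simp: warped_product_def)
  interpret E: einstein_chart "cimg e" "cmet e" I \<omega> "cmap c ` domain c d" "cmet c" "local_rep c d f" \<epsilon> \<Lambda>
    unfolding e(2) by (rule einstein_chart[OF c e(1)])
  show "sectional (cmet c) (cmap c p) u v
    = - \<alpha> p + (B (A u) u * B (A v) v - (B (A u) v)\<^sup>2) / (B u u * B v v - (B u v)\<^sup>2)"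
    using E.sectional_shape[of "cmap c p" \<nu> u v] p \<nu> \<alpha>_local_rep[OF c d] uv
    by (simp add: e(2) cmet_warped_chart A_def B_def)
  show "B u u * B v v - (B u v)\<^sup>2 \<noteq> 0"
    unfolding B_def by (rule gram_nonzero[OF E.dom.form uv]) (use p in auto)
qed

lemma normal_exists: "c \<in> S \<Longrightarrow> d \<in> M \<Longrightarrow> p \<in> domain c d \<Longrightarrow> \<exists>\<nu>. normal c d p \<nu>"
  using hypersurface_chart.unit_normal_exists[OF hypersurface_chart, of c d] by blast

lemma \<alpha>_constant: "\<alpha> constant_on carrier S"
proof (rule locally_constant_imp_constant[OF conn])
  fix p assume "p \<in> carrier S"
  then obtain c d where c: "c \<in> S" and d: "d \<in> M" and p: "p \<in> domain c d" by (rule chart_domain)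
  obtain e where e: "e \<in> Q" "d = warped_chart I \<omega> e" using d by (auto simp: warped_product_def)
  interpret E: einstein_chart "cimg e" "cmet e" I \<omega> "cmap c ` domain c d" "cmet c" "local_rep c d f" \<epsilon> \<Lambda>
    unfolding e(2) by (rule einstein_chart[OF c e(1)])
  have "cmap c p \<in> cmap c ` domain c d" using p by blast
  then obtain r where r: "r > 0" "ball (cmap c p) r \<subseteq> cmap c ` domain c d"
    "\<And>y. y \<in> ball (cmap c p) r \<Longrightarrow> warp_alpha \<epsilon> \<omega> (fst (local_rep c d f y))
      = warp_alpha \<epsilon> \<omega> (fst (local_rep c d f (cmap c p)))"
    using E.alpha_locally_constant by blast
  define O' where "O' = cdom c \<inter> cmap c -` ball (cmap c p) r"
  have "open O'"
    unfolding O'_def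
    by (rule continuous_open_preimage[OF manifold_chart_maps(1)[OF S c] manifold_chart(1)[OF S c] open_ball])
  moreover have "O' \<subseteq> carrier S" using c by (auto simp: O'_def carrier_def)
  moreover have "p \<in> O'" using p r(1) by (simp add: O'_def)
  moreover have "\<alpha> q = \<alpha> p" if "q \<in> O'" for q
    using r(3)[of "cmap c q"] that p \<alpha>_local_rep[OF c d] by (simp add: O'_def)
  ultimately show "\<exists>T. openin (top_of_set (carrier S)) T \<and> p \<in> T \<and> (\<forall>x\<in>T. \<alpha> x = \<alpha> p)"
    by (meson open_subset)
qed

section \<open>The squared trace as a function on the hypersurface\<close>

text \<open>Transported by the transition map, the first normal becomes a unit normal in the second
  pair of charts, where unit normals are unique up to sign. The trace changes by that sign at
  most.\<close>

lemma trace_square_unique: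
  assumes c: "c \<in> S" "d \<in> M" "p \<in> domain c d" "normal c d p \<nu>"
    and c': "c' \<in> S" "d' \<in> M" "p \<in> domain c' d'" "normal c' d' p \<nu>'"
  shows "(tr c' d' p \<nu>')\<^sup>2 = (tr c d p \<nu>)\<^sup>2"
proof -
  interpret hypersurface_chart "cmap c' ` domain c' d'" "cmet c'" "cimg d'" "cmet d'" "local_rep c' d' f"
    by (rule hypersurface_chart[OF c'(1,2)])
  have x: "cmap c' p \<in> cmap c' ` domain c' d'" using c' by blast
  define \<mu> where "\<mu> = dd (transition d d') (cmap d (f p)) \<nu>"
  have \<mu>: "normal c' d' p \<mu>" "tr c' d' p \<mu> = tr c d p \<nu>"
    unfolding \<mu>_def by (rule shape_at_chart_change[OF S c(1) c'(1) M c(2) c'(2) f]; use c c' in auto)+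
  consider "\<nu>' = \<mu>" | "\<nu>' = (-1) *\<^sub>R \<mu>" using unit_normal_unique[OF x \<mu>(1) c'(4)] by auto
  then show ?thesis
  proof cases
    case 2
    have "shp c' d' p \<nu>' = (\<lambda>u. (-1) *\<^sub>R shp c' d' p \<mu> u)"
      unfolding 2 using shape_scale[OF x] by blast
    then show ?thesis using \<mu>(2) by (simp only: linear_trace_scale) simp
  qed (use \<mu> in simp)
qed

text \<open>The square of n times the mean curvature. Squaring removes the dependence on the normal,
  and the choice operator removes that on the charts.\<close>

definition H2 :: "'s \<Rightarrow> real" where
  "H2 p = (SOME r. \<exists>c\<in>S. \<exists>d\<in>M. \<exists>\<nu>. p \<in> domain c d \<and> normal c d p \<nu> \<and> r = (tr c d p \<nu>)\<^sup>2)"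

lemma H2_eq:
  assumes "c \<in> S" "d \<in> M" "p \<in> domain c d" "normal c d p \<nu>"
  shows "H2 p = (tr c d p \<nu>)\<^sup>2"
proof -
  have "\<exists>c\<in>S. \<exists>d\<in>M. \<exists>\<nu>. p \<in> domain c d \<and> normal c d p \<nu> \<and> H2 p = (tr c d p \<nu>)\<^sup>2"
    unfolding H2_def by (rule someI_ex) (use assms in blast)
  then show ?thesis using trace_square_unique[OF assms] by auto
qed

text \<open>Locally this is the squared length of the mean curvature vector, which is continuous
  even though the normals are chosen independently point by point.\<close>

lemma H2_continuous: "continuous_on (carrier S) H2"
proof (rule continuous_on_open_cover)
  fix p assume "p \<in> carrier S"
  then obtain c d where c: "c \<in> S" and d: "d \<in> M" and p: "p \<in> domain c d" by (rule chart_domain)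
  interpret hypersurface_chart "cmap c ` domain c d" "cmet c" "cimg d" "cmet d" "local_rep c d f"
    by (rule hypersurface_chart[OF c d])
  define \<eta> where "\<eta> x = cmet d (local_rep c d f x) (mean_vector (cmet c) (cmet d) (local_rep c d f) x)
    (mean_vector (cmet c) (cmet d) (local_rep c d f) x)" for x
  have "continuous_on (cmap c ` domain c d) \<eta>"
    unfolding \<eta>_def by (rule metric_along_continuous[OF mean_vector_continuous mean_vector_continuous order.refl])
  then have "continuous_on (domain c d) (\<lambda>q. \<eta> (cmap c q))"
    by (rule continuous_on_compose2[OF _ continuous_on_subset[OF manifold_chart_maps(1)[OF S c]]]) auto
  moreover have "\<eta> (cmap c q) = H2 q" if q: "q \<in> domain c d" for q
  proof -
    obtain \<nu> where \<nu>: "normal c d q \<nu>" using normal_exists[OF c d q] by blast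
    show ?thesis
      unfolding H2_eq[OF c d q \<nu>] \<eta>_def by (rule mean_vector_square[OF _ \<nu>]) (use q in blast)
  qed
  ultimately have "continuous_on (domain c d) H2"
    by (rule continuous_on_eq)
  then show "\<exists>O'. open O' \<and> p \<in> O' \<and> continuous_on O' H2"
    using domain_open[OF c d] p by blast
qed

section \<open>Unit normal fields and the sign of the trace\<close>

lemma unit_normal_fieldD:
  assumes "unit_normal_field S M f W N"
  shows "open W" "W \<subseteq> carrier S"
    and "d \<in> M \<Longrightarrow> d' \<in> M \<Longrightarrow> p \<in> W \<Longrightarrow> f p \<in> cdom d \<Longrightarrow> f p \<in> cdom d'
      \<Longrightarrow> N d' p = dd (transition d d') (cmap d (f p)) (N d p)"
    and "c \<in> S \<Longrightarrow> d \<in> M \<Longrightarrow> smooth_on (cmap c ` (W \<inter> domain c d)) (N d \<circ> cinv c)"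
    and "c \<in> S \<Longrightarrow> d \<in> M \<Longrightarrow> p \<in> W \<inter> domain c d \<Longrightarrow> normal c d p (N d p)"
proof -
  note * = assms[unfolded unit_normal_field_def Int_assoc]
  show "open W" "W \<subseteq> carrier S" using * by blast+
  show "N d' p = dd (transition d d') (cmap d (f p)) (N d p)"
    if "d \<in> M" "d' \<in> M" "p \<in> W" "f p \<in> cdom d" "f p \<in> cdom d'"
    using * that by (meson IntI)
  show "smooth_on (cmap c ` (W \<inter> domain c d)) (N d \<circ> cinv c)" if "c \<in> S" "d \<in> M"
    using * that by meson
  assume c: "c \<in> S" "d \<in> M" and p: "p \<in> W \<inter> domain c d"
  then have "cmet d (cmap d (f p)) (N d p) (N d p) = 1 \<and> (\<forall>u. cmet d (cmap d (f p)) (N d p)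
      (dd (local_rep c d f) (cmap c p) u) = 0)"
    using * by meson
  moreover have "local_rep c d f (cmap c p) = cmap d (f p)"
    using local_rep_cmap[OF S c(1)] p by blast
  ultimately show "normal c d p (N d p)" by (simp add: unit_normal_at_def)
qed

lemma normal_field_chart:
  assumes N: "unit_normal_field S M f W N" and c: "c \<in> S" and d: "d \<in> M" and p: "p \<in> W \<inter> domain c d"
  shows "normal c d p (N d p)" "shape_operator c d f N (cmap c p) u = shp c d p (N d p) u"
    and "continuous_on (W \<inter> domain c d) (\<lambda>p. tr c d p (N d p))"
proof -
  interpret hypersurface_chart "cmap c ` domain c d" "cmet c" "cimg d" "cmet d" "local_rep c d f"
    by (rule hypersurface_chart[OF c d])
  note inv = manifold_chart_maps(3)[OF S c]
  define W' where "W' = cmap c ` (W \<inter> domain c d)"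
  have "open (W \<inter> domain c d)"
    using unit_normal_fieldD(1)[OF N] domain_open[OF c d] by blast
  then have W': "open W'" "cmap c p \<in> W'" "W' \<subseteq> cmap c ` domain c d"
    unfolding W'_def using chart_image_open(1)[OF S c, of "W \<inter> domain c d"] p by auto
  note nrm = unit_normal_fieldD(5)[OF N c d]
  show "normal c d p (N d p)" by (rule nrm[OF p])
  have nrm': "unit_normal_at (cmet d) (local_rep c d f) y ((N d \<circ> cinv c) y)" if "y \<in> W'" for y
    using that nrm inv by (auto simp: W'_def)
  have sm: "smooth_on W' (N d \<circ> cinv c)"
    unfolding W'_def by (rule unit_normal_fieldD(4)[OF N c d])
  show "shape_operator c d f N (cmap c p) u = shp c d p (N d p) u"
    using shape_operator_eq[OF W' nrm' smooth_onD(2)[OF sm W'(2)], of u] inv p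
    by (simp add: shape_operator_def)
  \<comment> \<open>The trace along \<open>N\<close> is the inner product of \<open>N\<close> with
    the mean curvature vector, and both are continuous.\<close>
  have "continuous_on W' (\<lambda>x. cmet d (local_rep c d f x) ((N d \<circ> cinv c) x)
      (mean_vector (cmet c) (cmet d) (local_rep c d f) x))" (is "continuous_on W' ?\<eta>")
    using W'(3) by (intro metric_along_continuous smooth_onD(1)[OF sm]
        continuous_on_subset[OF mean_vector_continuous])
  then have "continuous_on (W \<inter> domain c d) (\<lambda>q. ?\<eta> (cmap c q))"
    by (rule continuous_on_compose2[OF _ continuous_on_subset[OF manifold_chart_maps(1)[OF S c]]])
      (auto simp: W'_def)
  moreover have "?\<eta> (cmap c q) = tr c d q (N d q)" if "q \<in> W \<inter> domain c d" for q
    using that inv mean_vector_trace[of "cmap c q" "N d q"] by auto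
  ultimately show "continuous_on (W \<inter> domain c d) (\<lambda>p. tr c d p (N d p))"
    by (rule continuous_on_eq)
qed

text \<open>Along a normal field the trace is continuous and takes only the values \<open>h\<close>
  and \<open>-h\<close>, so it is constant on a connected set; \<open>s\<close> turns that constant
  into \<open>h\<close>.\<close>

lemma normal_field_sign:
  assumes N: "unit_normal_field S M f W N" and W: "connected W" and h: "\<And>p. p \<in> carrier S \<Longrightarrow> H2 p = h\<^sup>2"
  shows "\<exists>s\<in>{1, -1}. \<forall>c\<in>S. \<forall>d\<in>M. \<forall>p\<in>W \<inter> domain c d. s * tr c d p (N d p) = h"
proof -
  \<comment> \<open>Glues the local traces to one function on \<open>W\<close>. The transformation
    law of the components of \<open>N\<close> makes the value independent of the charts.\<close>
  define \<phi> where "\<phi> p = (SOME r. \<exists>c\<in>S. \<exists>d\<in>M. p \<in> domain c d \<and> r = tr c d p (N d p))" for p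
  have WS: "W \<subseteq> carrier S" by (rule unit_normal_fieldD(2)[OF N])
  have \<phi>: "\<phi> p = tr c d p (N d p)" if c: "c \<in> S" "d \<in> M" and p: "p \<in> W \<inter> domain c d" for c d p
  proof -
    have "\<exists>c\<in>S. \<exists>d\<in>M. p \<in> domain c d \<and> \<phi> p = tr c d p (N d p)"
      unfolding \<phi>_def by (rule someI_ex) (use c p in blast)
    then obtain c' d' where c': "c' \<in> S" "d' \<in> M" "p \<in> domain c' d'"
      "\<phi> p = tr c' d' p (N d' p)" by blast
    have "N d p = dd (transition d' d) (cmap d' (f p)) (N d' p)"
      using unit_normal_fieldD(3)[OF N c'(2) c(2)] c' p by blast
    moreover have "normal c' d' p (N d' p)" using normal_field_chart(1)[OF N c'(1,2)] c'(3) p by blast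
    ultimately show ?thesis
      using shape_at_chart_change(2)[OF S c'(1) c(1) M c'(2) c(2) f, of p "N d' p"] c' p by simp
  qed
  have "\<phi> p = h \<or> \<phi> p = - h" if p: "p \<in> W" for p
  proof -
    obtain c d where c: "c \<in> S" "d \<in> M" "p \<in> domain c d" using chart_domain WS p by blast
    then have "(\<phi> p)\<^sup>2 = h\<^sup>2"
      using \<phi>[of c d p] H2_eq[OF c normal_field_chart(1)[OF N c(1,2)]] h WS p by auto
    then show ?thesis by (simp add: power2_eq_iff)
  qed
  note pm = this
  then have "finite (\<phi> ` W)" by (intro finite_subset[of "\<phi> ` W" "{h, -h}"]) auto
  moreover have "continuous_on W \<phi>"
  proof (rule continuous_on_open_cover)
    fix p assume p: "p \<in> W"
    obtain c d where c: "c \<in> S" "d \<in> M" "p \<in> domain c d" using chart_domain WS p by blast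
    have "continuous_on (W \<inter> domain c d) \<phi>"
    proof (rule continuous_on_eq[OF normal_field_chart(3)[OF N c(1,2)]])
      show "p \<in> W \<inter> domain c d" using p c(3) by blast
    qed (simp add: \<phi>[OF c(1,2)])
    moreover have "open (W \<inter> domain c d)"
      using unit_normal_fieldD(1)[OF N] domain_open[OF c(1,2)] by blast
    ultimately show "\<exists>O'. open O' \<and> p \<in> O' \<and> continuous_on O' \<phi>" using p c(3) by blast
  qed
  ultimately have "\<phi> constant_on W"
    using continuous_finite_range_constant[OF W] by blast
  then obtain k where k: "\<And>p. p \<in> W \<Longrightarrow> \<phi> p = k" by (auto simp: constant_on_def)
  have "(\<forall>p\<in>W. 1 * \<phi> p = h) \<or> (\<forall>p\<in>W. (-1) * \<phi> p = h)"
    using pm k by (metis minus_minus mult_1 mult_minus1)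
  then show ?thesis using \<phi> by (metis IntD1 insertI1 insertI2)
qed

text \<open>For properties that hold for either normal, such as a rank bound; the sign can then
  always be 1.\<close>

lemma shape_operator_satisfies_pointwise:
  assumes "\<And>B A H p. p \<in> carrier S \<Longrightarrow> quadratic_operator B A H (\<Lambda> + (n - 1) * \<alpha> p) n \<Longrightarrow> P A"
  shows "shape_operator_satisfies S M f P"
  unfolding shape_operator_satisfies_def
proof (intro allI impI, elim conjE)
  fix W N assume N: "unit_normal_field S M f W N"
  show "\<exists>s\<in>{1, -1}. \<forall>c\<in>S. \<forall>d\<in>M. \<forall>p\<in>W \<inter> cdom c \<inter> f -` cdom d.
    P (\<lambda>u. s *\<^sub>R shape_operator c d f N (cmap c p) u)"
  proof (rule bexI[of _ 1], intro ballI)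
    fix c d p assume c: "c \<in> S" "d \<in> M" and "p \<in> W \<inter> cdom c \<inter> f -` cdom d"
    then have p: "p \<in> W \<inter> domain c d" by auto
    then have "P (shp c d p (N d p))"
      using assms[OF _ shape_quadratic[OF c _ normal_field_chart(1)[OF N c p]]] c by (auto simp: carrier_def)
    then show "P (\<lambda>u. 1 *\<^sub>R shape_operator c d f N (cmap c p) u)"
      using normal_field_chart(2)[OF N c p] by simp
  qed simp
qed

text \<open>For properties sensitive to the sign. Normalizing the trace to one fixed
  \<open>h\<close> makes the constants in \<open>P\<close> the same for all normal fields, however
  their domains are placed.\<close>

lemma shape_operator_satisfies_trace:
  assumes h: "\<And>p. p \<in> carrier S \<Longrightarrow> H2 p = h\<^sup>2"
    and P: "\<And>B A p. p \<in> carrier S \<Longrightarrow> quadratic_operator B A h (\<Lambda> + (n - 1) * \<alpha> p) n \<Longrightarrow> P A"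
  shows "shape_operator_satisfies S M f P"
  unfolding shape_operator_satisfies_def
proof (intro allI impI, elim conjE)
  fix W N assume N: "unit_normal_field S M f W N" and W: "connected W"
  obtain s where s: "s \<in> {1, -1}"
    "\<And>c d p. c \<in> S \<Longrightarrow> d \<in> M \<Longrightarrow> p \<in> W \<inter> domain c d \<Longrightarrow> s * tr c d p (N d p) = h"
    using normal_field_sign[OF N W h] by blast
  show "\<exists>s\<in>{1, -1}. \<forall>c\<in>S. \<forall>d\<in>M. \<forall>p\<in>W \<inter> cdom c \<inter> f -` cdom d.
    P (\<lambda>u. s *\<^sub>R shape_operator c d f N (cmap c p) u)"
  proof (rule bexI[OF _ s(1)], intro ballI)
    fix c d p assume c: "c \<in> S" "d \<in> M" and "p \<in> W \<inter> cdom c \<inter> f -` cdom d"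
    then have p: "p \<in> W \<inter> domain c d" by auto
    have "s * s = 1" using s(1) by auto
    from quadratic_operator.operator_scale[OF shape_quadratic[OF c _ normal_field_chart(1)[OF N c p]] this]
    have "P (\<lambda>u. s *\<^sub>R shp c d p (N d p) u)"
      using P[of p] s(2)[OF c p] p c by (auto simp: carrier_def)
    then show "P (\<lambda>u. s *\<^sub>R shape_operator c d f N (cmap c p) u)"
      using normal_field_chart(2)[OF N c p] by simp
  qed
qed

section \<open>The three signs of sigma\<close>

context
  fixes \<sigma> assumes \<sigma>: "\<And>p. p \<in> carrier S \<Longrightarrow> \<sigma> = \<Lambda> + (n - 1) * \<alpha> p"
begin

lemma quadratic:
  assumes "c \<in> S" "d \<in> M" "p \<in> domain c d" "normal c d p \<nu>"
  shows "quadratic_operator (met c p) (shp c d p \<nu>) (tr c d p \<nu>) \<sigma> n"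
  using shape_quadratic[OF assms] \<sigma>[of p] assms(1,3) by (auto simp: carrier_def)

lemma \<alpha>_eq: "p \<in> carrier S \<Longrightarrow> \<alpha> p = (\<sigma> - \<Lambda>) / (n - 1)"
  using \<sigma>[of p] dim by (simp add: field_simps)

text \<open>By the Gauss equation the sectional curvature is the constant minus alpha plus a
  quotient of two determinants, and the hypothesis fixes that quotient.\<close>

lemma constant_curvatureI:
  assumes "\<And>c d p \<nu> u v. c \<in> S \<Longrightarrow> d \<in> M \<Longrightarrow> p \<in> domain c d \<Longrightarrow> normal c d p \<nu>
    \<Longrightarrow> met c p (shp c d p \<nu> u) u * met c p (shp c d p \<nu> v) v
        - (met c p (shp c d p \<nu> u) v)\<^sup>2
      = k * (met c p u u * met c p v v - (met c p u v)\<^sup>2)"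
  shows "trivial_einstein S"
  unfolding trivial_einstein_def has_constant_curvature_def
proof (intro exI ballI allI impI)
  fix c x and u v :: 'e assume c: "c \<in> S" and "x \<in> cimg c" and uv: "u \<noteq> v \<and> independent {u, v}"
  then obtain p where p: "p \<in> cdom c" "x = cmap c p" by (auto simp: cimg_def)
  then have pS: "p \<in> carrier S" using c by (auto simp: carrier_def)
  then have "f p \<in> carrier M" using f by (auto simp: isometric_immersion_def)
  then obtain d where d: "d \<in> M" "p \<in> domain c d" using p by (auto simp: carrier_def)
  obtain \<nu> where \<nu>: "normal c d p \<nu>" using normal_exists[OF c d] by blast
  from uv have uv: "u \<noteq> v" "independent {u, v}" by auto
  show "sectional (cmet c) x u v = - ((\<sigma> - \<Lambda>) / (n - 1)) + k"
    unfolding p(2) sectional_shape(1)[OF c d \<nu> uv] assms[OF c d \<nu>] \<alpha>_eq[OF pS]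
    using sectional_shape(2)[OF c d \<nu> uv] by simp
qed

lemma positive:
  assumes "\<sigma> > 0"
  shows "trivial_einstein S" "\<exists>\<kappa>. shape_operator_satisfies S M f (\<lambda>A. \<forall>u. A u = \<kappa> *\<^sub>R u)"
proof -
  show "trivial_einstein S"
  proof (rule constant_curvatureI[of "\<sigma> / (n - 1)"])
    fix c d p \<nu> u v assume *: "c \<in> S" "d \<in> M" "p \<in> domain c d" "normal c d p \<nu>"
    interpret q: quadratic_operator "met c p" "shp c d p \<nu>" "tr c d p \<nu>" \<sigma> n
      by (rule quadratic[OF *])
    \<comment> \<open>The umbilical factor at this point. Its square is determined by
      \<open>\<sigma>\<close>, which is what the curvature requires; its sign depends on the
      normal.\<close>
    define k where "k = tr c d p \<nu> / n"
    have k: "\<sigma> / (n - 1) = k\<^sup>2" using q.positive_case(2)[OF assms] dim by (simp add: k_def)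
    show "met c p (shp c d p \<nu> u) u * met c p (shp c d p \<nu> v) v
        - (met c p (shp c d p \<nu> u) v)\<^sup>2
      = \<sigma> / (n - 1) * (met c p u u * met c p v v - (met c p u v)\<^sup>2)"
      unfolding k q.positive_case(1)[OF assms] k_def[symmetric]
      by (simp add: bilinear_simps[OF inner_formD(1)[OF q.form]] power2_eq_square algebra_simps)
  qed
  \<comment> \<open>The nonnegative one of the two possible traces of an umbilic operator with this
    \<open>\<sigma>\<close>.\<close>
  define h where "h = n * sqrt (\<sigma> / (n - 1))"
  have "shape_operator_satisfies S M f (\<lambda>A. \<forall>u. A u = (h / n) *\<^sub>R u)"
  proof (rule shape_operator_satisfies_trace[of h])
    fix p assume p: "p \<in> carrier S"
    then obtain c d where c: "c \<in> S" "d \<in> M" "p \<in> domain c d" by (rule chart_domain)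
    obtain \<nu> where \<nu>: "normal c d p \<nu>" using normal_exists[OF c] by blast
    have "\<sigma> = (n - 1) * (tr c d p \<nu> / n)\<^sup>2"
      by (rule quadratic_operator.positive_case(2)[OF quadratic[OF c \<nu>] assms])
    then have "(tr c d p \<nu>)\<^sup>2 = n\<^sup>2 * (\<sigma> / (n - 1))"
      using dim by (simp add: power_divide field_simps)
    then show "H2 p = h\<^sup>2" unfolding H2_eq[OF c \<nu>] h_def using assms dim by (simp add: power_mult_distrib)
  next
    fix B A p assume "p \<in> carrier S" "quadratic_operator B A h (\<Lambda> + (n - 1) * \<alpha> p) n"
    then show "\<forall>u. A u = (h / n) *\<^sub>R u"
      using quadratic_operator.positive_case(1)[of B A h \<sigma> n] assms \<sigma> by simp
  qed
  then show "\<exists>\<kappa>. shape_operator_satisfies S M f (\<lambda>A. \<forall>u. A u = \<kappa> *\<^sub>R u)" by blast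
qed

lemma zero:
  assumes "\<sigma> = 0"
  shows "trivial_einstein S" "shape_operator_satisfies S M f (\<lambda>A. dim (range A) \<le> 1)"
proof -
  show "trivial_einstein S"
  proof (rule constant_curvatureI[of 0])
    fix c d p \<nu> u v assume *: "c \<in> S" "d \<in> M" "p \<in> domain c d" "normal c d p \<nu>"
    define A where "A = shp c d p \<nu>"
    define B where "B = met c p"
    interpret q: quadratic_operator B A "linear_trace A" \<sigma> n
      unfolding A_def B_def by (rule quadratic[OF *])
    note form = inner_formD[OF q.form]
    have "B (A v) u = B (A u) v" using q.selfadj[of v u] form(2) by simp
    moreover have "B (A u) u * B (A v) v = B (A u) v * B (A v) u"
      by (rule rank_one_minor[OF form(1)]) (rule q.selfadj form(2) q.zero_case[OF assms])+
    ultimately show "met c p (shp c d p \<nu> u) u * met c p (shp c d p \<nu> v) v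
        - (met c p (shp c d p \<nu> u) v)\<^sup>2
      = 0 * (met c p u u * met c p v v - (met c p u v)\<^sup>2)"
      unfolding A_def[symmetric] B_def[symmetric] by (simp add: power2_eq_square)
  qed
  \<comment> \<open>The rank is the same for both normals, so the trace need not be constant
    here.\<close>
  show "shape_operator_satisfies S M f (\<lambda>A. dim (range A) \<le> 1)"
  proof (rule shape_operator_satisfies_pointwise)
    fix B A H p assume "p \<in> carrier S" "quadratic_operator B A H (\<Lambda> + (n - 1) * \<alpha> p) n"
    then show "dim (range A) \<le> 1"
      using quadratic_operator.zero_case[of B A H \<sigma> n] assms \<sigma> by simp
  qed
qed

lemma H2_constant:
  assumes "\<sigma> < 0"
  obtains h where "\<And>p. p \<in> carrier S \<Longrightarrow> H2 p = h\<^sup>2"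
proof -
  \<comment> \<open>The value of the squared trace for given multiplicities. Pairs with an entry 1,
    where division by zero gives 0, merely enlarge the finite set of candidates.\<close>
  define \<Phi> where "\<Phi> = (\<lambda>(p, q). - \<sigma> * (real p - 1) / (real q - 1) - \<sigma> * (real q - 1) / (real p - 1) + 2 * \<sigma>)"
  have *: "H2 p \<in> \<Phi> ` ({..DIM('e)} \<times> {..DIM('e)}) \<and> H2 p \<ge> 0" if p: "p \<in> carrier S" for p
  proof -
    obtain c d where c: "c \<in> S" "d \<in> M" "p \<in> domain c d" using chart_domain[OF p] by blast
    obtain \<nu> where \<nu>: "normal c d p \<nu>" using normal_exists[OF c] by blast
    interpret q: quadratic_operator "met c p" "shp c d p \<nu>" "tr c d p \<nu>" \<sigma> n
      by (rule quadratic[OF c \<nu>])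
    obtain a b where ab: "real a + real b = n" "H2 p = \<Phi> (a, b)"
      unfolding H2_eq[OF c \<nu>] \<Phi>_def prod.case using q.negative_case[OF assms] by metis
    then have "a \<le> DIM('e)" "b \<le> DIM('e)" using n by linarith+
    moreover have "H2 p \<ge> 0" unfolding H2_eq[OF c \<nu>] by simp
    ultimately show ?thesis using ab(2) by auto
  qed
  then have "H2 ` carrier S \<subseteq> \<Phi> ` ({..DIM('e)} \<times> {..DIM('e)})" by blast
  then have "finite (H2 ` carrier S)" by (rule finite_subset) simp
  then have "H2 constant_on carrier S"
    by (rule continuous_finite_range_constant[OF conn H2_continuous])
  then obtain k where k: "\<And>p. p \<in> carrier S \<Longrightarrow> H2 p = k" by (auto simp: constant_on_def)
  \<comment> \<open>The constant is nonnegative as a square, so it has a root \<open>h\<close> that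
    can serve as the normalized trace.\<close>
  have "H2 p = (sqrt k)\<^sup>2" if "p \<in> carrier S" for p
    using k[OF that] *[OF that] by simp
  then show ?thesis by (rule that)
qed

text \<open>Nontriviality follows by comparing two planes: one inside the eigenspace of
  \<open>\<kappa>\<^sub>2\<close>, one spanned by eigenvectors of both roots. Constancy of the
  principal curvatures and multiplicities follows from the constant squared trace, since
  \<open>h\<close> and \<open>\<sigma>\<close> determine them all.\<close>

lemma negative:
  assumes "\<sigma> < 0"
  shows "\<not> trivial_einstein S"
    and "\<exists>\<kappa>\<^sub>1 \<kappa>\<^sub>2 m\<^sub>1 m\<^sub>2. \<kappa>\<^sub>1 < 0 \<and> 0 < \<kappa>\<^sub>2 \<and> m\<^sub>1 \<ge> 2 \<and> m\<^sub>2 \<ge> 2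
      \<and> shape_operator_satisfies S M f (\<lambda>A. eigenvalues A = {\<kappa>\<^sub>1, \<kappa>\<^sub>2}
          \<and> dim (eigenspace A \<kappa>\<^sub>1) = m\<^sub>1 \<and> dim (eigenspace A \<kappa>\<^sub>2) = m\<^sub>2)"
    and "\<exists>h. shape_operator_satisfies S M f (\<lambda>A. mean_curvature A = h)"
proof -
  obtain p\<^sub>0 where p\<^sub>0: "p\<^sub>0 \<in> carrier S" using S by (auto simp: riemannian_manifold_def)
  obtain c d where c: "c \<in> S" "d \<in> M" "p\<^sub>0 \<in> domain c d" using chart_domain[OF p\<^sub>0] by blast
  obtain \<nu> where \<nu>: "normal c d p\<^sub>0 \<nu>" using normal_exists[OF c] by blast
  define B where "B = met c p\<^sub>0"
  define A where "A = shp c d p\<^sub>0 \<nu>"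
  interpret q: quadratic_operator B A "linear_trace A" \<sigma> n
    unfolding A_def B_def by (rule quadratic[OF c \<nu>])
  show "\<not> trivial_einstein S"
  proof
    note b = bilinear_simps[OF inner_formD(1)[OF q.form]]
    assume "trivial_einstein S"
    then obtain k where k: "\<And>u v. u \<noteq> v \<Longrightarrow> independent {u, v} \<Longrightarrow> sectional (cmet c) (cmap c p\<^sub>0) u v = k"
      using c unfolding trivial_einstein_def has_constant_curvature_def cimg_def by blast
    obtain \<kappa>\<^sub>1 \<kappa>\<^sub>2 a b where "\<kappa>\<^sub>2 = linear_trace A / 2 + sqrt ((linear_trace A)\<^sup>2 / 4 - \<sigma>)"
      "\<kappa>\<^sub>1 = linear_trace A / 2 - sqrt ((linear_trace A)\<^sup>2 / 4 - \<sigma>)"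
      and \<kappa>: "\<kappa>\<^sub>1 < 0" "0 < \<kappa>\<^sub>2" "\<kappa>\<^sub>1 * \<kappa>\<^sub>2 = \<sigma>"
      and "a = dim (eigenspace A \<kappa>\<^sub>1)" and dim\<^sub>2: "b = dim (eigenspace A \<kappa>\<^sub>2)" "2 \<le> a" "2 \<le> b"
      and "real a + real b = n" "real b * (\<kappa>\<^sub>2 - \<kappa>\<^sub>1) = linear_trace A - n * \<kappa>\<^sub>1"
      and ev: "eigenvalues A = {\<kappa>\<^sub>1, \<kappa>\<^sub>2}"
      by (rule q.negative_case[OF assms])
    obtain E where E: "E \<subseteq> eigenspace A \<kappa>\<^sub>2" "independent E"
      "eigenspace A \<kappa>\<^sub>2 \<subseteq> span E" "card E = dim (eigenspace A \<kappa>\<^sub>2)"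
      by (rule basis_exists)
    have "finite E" using E(2) by (rule independent_imp_finite)
    moreover have "\<not> card E \<le> Suc 0" using E(4) dim\<^sub>2 by simp
    ultimately obtain u v where uv: "u \<in> E" "v \<in> E" "u \<noteq> v"
      using card_le_Suc0_iff_eq[of E] by blast
    then have ind: "independent {u, v}" using independent_mono[OF E(2), of "{u, v}"] uv by blast
    have Au: "A u = \<kappa>\<^sub>2 *\<^sub>R u" "A v = \<kappa>\<^sub>2 *\<^sub>R v" using uv E(1) by (auto simp: eigenspace_def)
    note sec = sectional_shape[OF c \<nu>, folded A_def B_def]
    \<comment> \<open>A plane within one eigenspace, available because its multiplicity is at least
      two.\<close>
    have "B (A u) u * B (A v) v - (B (A u) v)\<^sup>2 = \<kappa>\<^sub>2 * \<kappa>\<^sub>2 * (B u u * B v v - (B u v)\<^sup>2)"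
      by (simp add: Au b power2_eq_square algebra_simps)
    then have 1: "k = - \<alpha> p\<^sub>0 + \<kappa>\<^sub>2 * \<kappa>\<^sub>2"
      using sec[OF uv(3) ind] k[OF uv(3) ind] by simp
    obtain w where w: "w \<noteq> 0" "A w = \<kappa>\<^sub>1 *\<^sub>R w"
      using ev by (auto simp: eigenvalues_def eigenspace_def)
    \<comment> \<open>Eigenvectors of a self-adjoint operator for distinct eigenvalues are
      orthogonal.\<close>
    have orth: "B u w = 0"
      using q.selfadj[of u w] \<kappa>(1,2) by (simp add: Au w(2) b)
    have "u \<notin> span {w}"
    proof
      assume "u \<in> span {w}"
      then obtain r where r: "u = r *\<^sub>R w" by (auto simp: span_singleton)
      then have "r * B w w = 0" using orth by (simp add: b)
      then have "u = 0" using r w(1) inner_formD(5)[OF q.form] by simp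
      then show False using ind by (auto simp: dependent_zero)
    qed
    then have ind': "u \<noteq> w" "independent {u, w}"
      using w(1) by (auto simp: independent_insert span_base)
    have "B (A u) u * B (A w) w - (B (A u) w)\<^sup>2 = \<sigma> * (B u u * B w w - (B u w)\<^sup>2)"
      by (simp add: Au w(2) b orth \<kappa>(3)[symmetric])
    then have "k = - \<alpha> p\<^sub>0 + \<sigma>"
      using sec[OF ind'] k[OF ind'] by simp
    then have "\<kappa>\<^sub>2 * \<kappa>\<^sub>2 < 0" using 1 assms by linarith
    then show False using not_square_less_zero by blast
  qed
  obtain h where h: "\<And>p. p \<in> carrier S \<Longrightarrow> H2 p = h\<^sup>2" using H2_constant[OF assms] by blast
  have "(linear_trace A)\<^sup>2 = h\<^sup>2" using h[OF p\<^sub>0] H2_eq[OF c \<nu>] by (simp add: A_def)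
  then have "linear_trace A = h \<or> linear_trace A = - h" by (simp add: power2_eq_iff)
  \<comment> \<open>The normal at the base point is oriented so that the trace there is
    \<open>h\<close>. The constants are read off at this point and compared with all others.\<close>
  then obtain s :: real where s: "s * s = 1" "s * linear_trace A = h" by (metis minus_minus mult_1 mult_minus1)
  interpret s: quadratic_operator B "\<lambda>u. s *\<^sub>R A u" h \<sigma> n
    using q.operator_scale[OF s(1)] s(2) by simp
  obtain \<kappa>\<^sub>1 \<kappa>\<^sub>2 m\<^sub>1 m\<^sub>2 where \<kappa>: "\<kappa>\<^sub>2 = h / 2 + sqrt (h\<^sup>2 / 4 - \<sigma>)" "\<kappa>\<^sub>1 = h / 2 - sqrt (h\<^sup>2 / 4 - \<sigma>)"
    "\<kappa>\<^sub>1 < 0" "0 < \<kappa>\<^sub>2" "\<kappa>\<^sub>1 * \<kappa>\<^sub>2 = \<sigma>"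
    and "m\<^sub>1 = dim (eigenspace (\<lambda>u. s *\<^sub>R A u) \<kappa>\<^sub>1)" "m\<^sub>2 = dim (eigenspace (\<lambda>u. s *\<^sub>R A u) \<kappa>\<^sub>2)"
    and m: "2 \<le> m\<^sub>1" "2 \<le> m\<^sub>2" "real m\<^sub>1 + real m\<^sub>2 = n" "real m\<^sub>2 * (\<kappa>\<^sub>2 - \<kappa>\<^sub>1) = h - n * \<kappa>\<^sub>1"
    by (rule s.negative_case[OF assms])
  have "eigenvalues A = {\<kappa>\<^sub>1, \<kappa>\<^sub>2} \<and> dim (eigenspace A \<kappa>\<^sub>1) = m\<^sub>1 \<and> dim (eigenspace A \<kappa>\<^sub>2) = m\<^sub>2"
    if "quadratic_operator B A h \<sigma> n" for B A
  proof -
    interpret r: quadratic_operator B A h \<sigma> n by fact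
    obtain k\<^sub>1 k\<^sub>2 p q where k: "k\<^sub>2 = h / 2 + sqrt (h\<^sup>2 / 4 - \<sigma>)" "k\<^sub>1 = h / 2 - sqrt (h\<^sup>2 / 4 - \<sigma>)"
      and "k\<^sub>1 < 0" "0 < k\<^sub>2" "k\<^sub>1 * k\<^sub>2 = \<sigma>"
      and dims: "p = dim (eigenspace A k\<^sub>1)" "q = dim (eigenspace A k\<^sub>2)" "2 \<le> p" "2 \<le> q"
        "real p + real q = n" "real q * (k\<^sub>2 - k\<^sub>1) = h - n * k\<^sub>1" "eigenvalues A = {k\<^sub>1, k\<^sub>2}"
      by (rule r.negative_case[OF assms])
    \<comment> \<open>Both pairs of roots are given by the same expression in \<open>h\<close> and
      \<open>\<sigma>\<close>.\<close>
    have "k\<^sub>1 = \<kappa>\<^sub>1" "k\<^sub>2 = \<kappa>\<^sub>2" by (simp_all only: k \<kappa>(1,2))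
    note * = dims[unfolded this]
    have "real q * (\<kappa>\<^sub>2 - \<kappa>\<^sub>1) = real m\<^sub>2 * (\<kappa>\<^sub>2 - \<kappa>\<^sub>1)" using *(6) m(4) by simp
    \<comment> \<open>The factor \<open>\<kappa>\<^sub>2 - \<kappa>\<^sub>1\<close> is positive and
      can be cancelled.\<close>
    then have "q = m\<^sub>2" using \<kappa>(3,4) by simp
    then show ?thesis using *(1,2,5,7) m(3) by auto
  qed
  then have "shape_operator_satisfies S M f (\<lambda>A. eigenvalues A = {\<kappa>\<^sub>1, \<kappa>\<^sub>2}
      \<and> dim (eigenspace A \<kappa>\<^sub>1) = m\<^sub>1 \<and> dim (eigenspace A \<kappa>\<^sub>2) = m\<^sub>2)"
    by (intro shape_operator_satisfies_trace[OF h]) (simp_all add: \<sigma>[symmetric])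
  then show "\<exists>\<kappa>\<^sub>1 \<kappa>\<^sub>2 m\<^sub>1 m\<^sub>2. \<kappa>\<^sub>1 < 0 \<and> 0 < \<kappa>\<^sub>2 \<and> m\<^sub>1 \<ge> 2 \<and> m\<^sub>2 \<ge> 2
      \<and> shape_operator_satisfies S M f (\<lambda>A. eigenvalues A = {\<kappa>\<^sub>1, \<kappa>\<^sub>2}
          \<and> dim (eigenspace A \<kappa>\<^sub>1) = m\<^sub>1 \<and> dim (eigenspace A \<kappa>\<^sub>2) = m\<^sub>2)"
    using \<kappa>(3,4) m(1,2) by blast
  have "shape_operator_satisfies S M f (\<lambda>A. mean_curvature A = h / n)"
    by (intro shape_operator_satisfies_trace[OF h])
      (auto simp: mean_curvature_def n dest: quadratic_operator.trace)
  then show "\<exists>h. shape_operator_satisfies S M f (\<lambda>A. mean_curvature A = h)" by blast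
qed

end

end

theorem theorem3:
  fixes n :: nat and I :: "real set" and \<omega> :: "real \<Rightarrow> real" and \<epsilon> \<Lambda> :: real
    and Q :: "('q::{t2_space, second_countable_topology}, 'e::euclidean_space) rchart set"
    and S :: "('s::{t2_space, second_countable_topology}, 'e) rchart set"
    and f :: "'s \<Rightarrow> real \<times> 'q"
  assumes "n = DIM('e)" and "n > 3"
    and "open I" and "is_interval I" and "I \<noteq> {}"
    and "smooth_on I \<omega>" and "\<forall>t\<in>I. \<omega> t > 0"
    and "\<epsilon> \<in> {-1, 0, 1}"
    and "simply_connected_space_form \<epsilon> Q"
    and "hypersurface S (warped_product I \<omega> Q) f"
    and "connected (carrier S)"
    and "einstein \<Lambda> S"
    and "\<forall>c\<in>S. \<forall>p\<in>cdom c. warp_beta \<epsilon> \<omega> (fst (f p)) *\<^sub>R height_gradient c f p = 0"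
  shows "(\<lambda>p. warp_alpha \<epsilon> \<omega> (fst (f p))) constant_on carrier S
    \<and> (\<forall>\<sigma>. (\<forall>p\<in>carrier S. \<sigma> = \<Lambda> + (real n - 1) * warp_alpha \<epsilon> \<omega> (fst (f p))) \<longrightarrow>
        (\<sigma> > 0 \<longrightarrow> trivial_einstein S
           \<and> (\<exists>\<kappa>. shape_operator_satisfies S (warped_product I \<omega> Q) f
                (\<lambda>A. \<forall>u. A u = \<kappa> *\<^sub>R u)))
      \<and> (\<sigma> = 0 \<longrightarrow> trivial_einstein S
           \<and> shape_operator_satisfies S (warped_product I \<omega> Q) f (\<lambda>A. dim (range A) \<le> 1))
      \<and> (\<sigma> < 0 \<longrightarrow> \<not> trivial_einstein S
           \<and> (\<exists>\<kappa>\<^sub>1 \<kappa>\<^sub>2 m\<^sub>1 m\<^sub>2. \<kappa>\<^sub>1 < 0 \<and> 0 < \<kappa>\<^sub>2 \<and> m\<^sub>1 \<ge> 2 \<and> m\<^sub>2 \<ge> 2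
                \<and> shape_operator_satisfies S (warped_product I \<omega> Q) f
                    (\<lambda>A. eigenvalues A = {\<kappa>\<^sub>1, \<kappa>\<^sub>2}
                       \<and> dim (eigenspace A \<kappa>\<^sub>1) = m\<^sub>1 \<and> dim (eigenspace A \<kappa>\<^sub>2) = m\<^sub>2))
           \<and> (\<exists>h. shape_operator_satisfies S (warped_product I \<omega> Q) f
                (\<lambda>A. mean_curvature A = h))))"
proof -
  interpret einstein_hypersurface I \<omega> \<epsilon> \<Lambda> "real n" Q S f
    by unfold_locales (use assms in \<open>simp_all add: simply_connected_space_form_def\<close>)
  show ?thesis
  proof (rule conjI[OF \<alpha>_constant], intro allI impI, goal_cases)
    case (1 \<sigma>)
    then have \<sigma>: "\<And>p. p \<in> carrier S \<Longrightarrow> \<sigma> = \<Lambda> + (real n - 1) * warp_alpha \<epsilon> \<omega> (fst (f p))"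
      by blast
    show ?case
      by (intro conjI impI; (rule positive[OF \<sigma>] zero[OF \<sigma>] negative[OF \<sigma>], assumption))
  qed
qed

end
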